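(* Let $N\ge 1$ be an integer and let $m,p,\sigma$ be real numbers with $m_c<m<1$, $p>1$ and $\sigma>\sigma_*$. For $A\in(0,\infty)$ let $f(\cdot;A)$ be the profile solving $$(f^m)''(\xi)+\frac{N-1}{\xi}(f^m)'(\xi)+\alpha f(\xi)+\beta\xi f'(\xi)-\xi^{\sigma}f^p(\xi)=0,\quad \xi>0,\qquad f(0;A)=A,\quad f'(0;A)=0.$$ Then there exists $A^*\in(0,\infty)$ such that $f(\cdot;A^* )$ is defined for all $\xi\in(0,\infty)$ and $$\lim_{\xi\to\infty}\xi^{(\sigma+2)/(p-m)}f(\xi;A^* )=L\in(0,\infty).$$ Moreover, there exists $A_*\in(0,\infty)$ with $A_*\le A^*$ such that for every $A\in(0,A_* )$ the profile $f(\cdot;A)$ has a unique positive minimum; more precisely, there exists $\xi_0(A)$ with $0<\xi_0(A)<\xi_{\max}(A)$ such that $$\min_{\xi\in(0,\xi_{\max}(A))}f(\xi;A)=f(\xi_0(A);A)\in(0,A),$$ and $f(\cdot;A)$ is increasing for $\xi>\xi_0(A)$ (that is, on $(\xi_0(A),\xi_{\max}(A))$).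
   Context: Notation: $m_c:=\frac{(N-2)_+}{N}$ (so $m_c=(N-2)/N$ if $N\ge3$ and $m_c=0$ if $N\in\{1,2\}$), $\sigma_*:=\frac{2(p-1)}{1-m}$, and $$\alpha:=\frac{\sigma+2}{(1-m)(\sigma-\sigma_* )},\qquad \beta:=\frac{p-m}{(1-m)(\sigma-\sigma_* )}.$$ The profile $f(\cdot;A)$ is the positive solution of the stated singular initial value problem, considered on its maximal interval of existence as a positive solution, denoted $[0,\xi_{\max}(A))$ with $\xi_{\max}(A)\in(0,\infty]$. Such profiles give backward self-similar solutions $U_{A,T}(x,t)=(T-t)^{\alpha}f(|x|(T-t)^{\beta};A)$ of $u_t=\Delta u^m-|x|^{\sigma}u^p$. *)

theory Defs
  imports "HOL-Analysis.Analysis"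
begin

definition m_crit :: "nat \<Rightarrow> real" where
  "m_crit N = max (real N - 2) 0 / real N"

definition sigma_crit :: "real \<Rightarrow> real \<Rightarrow> real" where
  "sigma_crit m p = 2 * (p - 1) / (1 - m)"

definition alpha_exp :: "real \<Rightarrow> real \<Rightarrow> real \<Rightarrow> real" where
  "alpha_exp m p \<sigma> = (\<sigma> + 2) / ((1 - m) * (\<sigma> - sigma_crit m p))"

definition beta_exp :: "real \<Rightarrow> real \<Rightarrow> real \<Rightarrow> real" where
  "beta_exp m p \<sigma> = (p - m) / ((1 - m) * (\<sigma> - sigma_crit m p))"

(* deriv is a total operator, so the differentiability of f and of (f^m)' is required explicitly;
   the differentiability of f^m follows since f is positive. *)
definition satisfies_profile_ode ::
  "nat \<Rightarrow> real \<Rightarrow> real \<Rightarrow> real \<Rightarrow> (real \<Rightarrow> real) \<Rightarrow> real \<Rightarrow> bool" where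
  "satisfies_profile_ode N m p \<sigma> f \<xi> \<longleftrightarrow>
     f differentiable (at \<xi>) \<and>
     deriv (\<lambda>x. f x powr m) differentiable (at \<xi>) \<and>
     deriv (deriv (\<lambda>x. f x powr m)) \<xi>
       + (real N - 1) / \<xi> * deriv (\<lambda>x. f x powr m) \<xi>
       + alpha_exp m p \<sigma> * f \<xi> + beta_exp m p \<sigma> * \<xi> * deriv f \<xi>
       - \<xi> powr \<sigma> * f \<xi> powr p = 0"

(* Positive solution on [0,R), with 0 < R \<le> \<infinity>, of the singular initial value problem.
   The condition f'(0) = 0 is a one-sided derivative. Values of f outside [0,R) are irrelevant. *)
definition positive_solution ::
  "nat \<Rightarrow> real \<Rightarrow> real \<Rightarrow> real \<Rightarrow> real \<Rightarrow> (real \<Rightarrow> real) \<Rightarrow> ereal \<Rightarrow> bool" where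
  "positive_solution N m p \<sigma> A f R \<longleftrightarrow>
     0 < R \<and> f 0 = A \<and> (f has_real_derivative 0) (at 0 within {0..}) \<and>
     (\<forall>\<xi>. 0 \<le> \<xi> \<and> ereal \<xi> < R \<longrightarrow> f \<xi> > 0) \<and>
     (\<forall>\<xi>. 0 < \<xi> \<and> ereal \<xi> < R \<longrightarrow> satisfies_profile_ode N m p \<sigma> f \<xi>)"

(* f is the profile f(.;A) and R = \<xi>_max(A): a positive solution with no proper extension. *)
definition is_profile ::
  "nat \<Rightarrow> real \<Rightarrow> real \<Rightarrow> real \<Rightarrow> real \<Rightarrow> (real \<Rightarrow> real) \<Rightarrow> ereal \<Rightarrow> bool" where
  "is_profile N m p \<sigma> A f R \<longleftrightarrow>
     positive_solution N m p \<sigma> A f R \<and>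
     \<not> (\<exists>g S. R < S \<and> positive_solution N m p \<sigma> A g S \<and>
              (\<forall>\<xi>. 0 \<le> \<xi> \<and> ereal \<xi> < R \<longrightarrow> g \<xi> = f \<xi>))"

end

theory Submission
  imports Defs
begin

text \<open>
  The substitution \<open>v = f^m\<close>, with \<open>n = 1/m\<close>, \<open>q = p/m\<close> and \<open>k = N - 1\<close>, turns the profile equation into
  a planar system without second derivatives. If \<open>Z = x^k (v' + \<beta> x v^n)\<close> denotes the total flux through the
  sphere of radius \<open>x\<close>, then
  \<open>v' = Z / x^k - \<beta> x v^n\<close> and \<open>Z' = x^k (x^\<sigma> v^q - (\<alpha> - N \<beta>) v^n)\<close>, with \<open>Z(0) = 0\<close>.
  The powers \<open>n\<close> and \<open>q\<close> exceed 1, so the system is Lipschitz in \<open>v\<close> even at \<open>v = 0\<close>; truncated to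
  \<open>0 \<le> v \<le> M\<close> it becomes a Volterra equation whose solutions exist on every interval and depend
  continuously on \<open>v(0)\<close>, and which may be followed through a zero of \<open>v\<close>.

  At a critical point \<open>v'' = v^n (x^\<sigma> v^(q-n) - \<alpha>)\<close>. A profile starts decreasing. At its first critical
  point the ratio \<open>x^\<sigma> v^(q-n)\<close> is larger than \<open>\<alpha>\<close>; afterwards \<open>v\<close> and therefore the ratio grow, so no second
  critical point occurs. A profile that turns (\<open>turns\<close>) thus has exactly the shape described in the second
  half of the theorem (\<open>turning_min\<close>), and any other profile decreases strictly as long as it exists.

  Turning is an open condition on the initial value \<open>a = v(0)\<close> (\<open>turns_open\<close>). It holds for small \<open>a\<close>
  (\<open>turns_of_small\<close>): a profile needs a radius of order \<open>a^((1-n)/2)\<close> to lose half of its height, and since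
  \<open>\<sigma> > \<sigma>_*\<close> absorption dominates at that radius when \<open>a\<close> is small. It fails for some large \<open>a\<close>
  (\<open>not_turns_of_large\<close>): below a radius \<open>L\<close> that does not depend on \<open>a\<close> absorption offsets at most half of the sink in \<open>Z'\<close>, while
  the mass inside \<open>L\<close> tends to infinity with \<open>a\<close> because \<open>m > m_c\<close>; the resulting inward flux forces
  \<open>v\<close> to vanish before \<open>L\<close>. Hence the supremum \<open>a*\<close> of all \<open>a\<close> such that every smaller
  initial value turns is positive and finite, does not turn, and all smaller values do
  (\<open>critical_value\<close>). One value \<open>A_* = A^* = a*^(1/m)\<close> serves both halves of the theorem.

  The profile with initial value \<open>a*\<close> exists globally (\<open>critical_global\<close>). If it stopped at a finite radius it would vanish
  there with negative slope, its truncated continuation would become negative, and so would those of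
  nearby smaller \<open>a\<close>; but these turn and stay above a positive minimum.

  For the decay put \<open>\<kappa> = (\<sigma>+2)/(q-1)\<close>, \<open>W = x^\<kappa> v\<close> and \<open>P = x W'\<close>. In the variable \<open>ln x\<close> these satisfy an
  autonomous equation, up to a damping coefficient that tends to 0 while \<open>W\<close> is bounded, with equilibrium \<open>W^(q-1) = K\<close>. The function
  \<open>W\<close> increases from 0 and can have only maxima below the equilibrium and only minima above it, so it is
  eventually monotone (\<open>P_dichotomy\<close>). If it increased to infinity, the superlinear term \<open>W^q\<close> would make \<open>v'\<close>
  positive; if it decreased to 0, the linear term \<open>-K W\<close> would drive it below 0. So \<open>W\<close>
  tends to a positive limit (\<open>W_converges\<close>), and \<open>f x^((\<sigma>+2)/(p-m)) = W^(1/m)\<close>.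
\<close>

section \<open>Volterra equations with a causal Lipschitz right-hand side\<close>

text \<open>The value \<open>F w s\<close> may depend on all of \<open>w\<close> on \<open>[0, s]\<close>, since the flux through a sphere collects the
  sources inside it. This history dependence replaces the singular coefficient \<open>(N-1)/\<xi>\<close>.\<close>

definition causal_lipschitz :: "real \<Rightarrow> real \<Rightarrow> ((real \<Rightarrow> real) \<Rightarrow> real \<Rightarrow> real) \<Rightarrow> bool" where
  "causal_lipschitz C X F \<longleftrightarrow>
     (\<forall>w. continuous_on {0..X} w \<longrightarrow> continuous_on {0..X} (F w)) \<and>
     (\<forall>w1 w2 s D. continuous_on {0..X} w1 \<longrightarrow> continuous_on {0..X} w2 \<longrightarrow> 0 \<le> s \<longrightarrow> s \<le> X \<longrightarrow>
        (\<forall>r\<in>{0..s}. \<bar>w1 r - w2 r\<bar> \<le> D) \<longrightarrow> \<bar>F w1 s - F w2 s\<bar> \<le> C * D)"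

lemma causal_lipschitz_cont:
  "causal_lipschitz C X F \<Longrightarrow> continuous_on {0..X} w \<Longrightarrow> continuous_on {0..X} (F w)"
  by (auto simp: causal_lipschitz_def)

lemma causal_lipschitz_bound:
  "causal_lipschitz C X F \<Longrightarrow> continuous_on {0..X} w1 \<Longrightarrow> continuous_on {0..X} w2 \<Longrightarrow> 0 \<le> s \<Longrightarrow> s \<le> X \<Longrightarrow>
    (\<And>r. 0 \<le> r \<Longrightarrow> r \<le> s \<Longrightarrow> \<bar>w1 r - w2 r\<bar> \<le> D) \<Longrightarrow> \<bar>F w1 s - F w2 s\<bar> \<le> C * D"
  by (auto simp: causal_lipschitz_def)

text \<open>Integrating \<open>C exp (2 C s)\<close> gives at most half of \<open>exp (2 C x)\<close>. In the norm with this weight, integration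
  of \<open>F\<close> is therefore a contraction on intervals of any length, and no restart at a later point, which a
  history-dependent equation would not permit, is needed.\<close>

lemma causal_integral_contraction:
  assumes F: "causal_lipschitz C X F" and C: "0 < C"
    and w: "continuous_on {0..X} w1" "continuous_on {0..X} w2"
    and D: "0 \<le> D" "\<And>r. 0 \<le> r \<Longrightarrow> r \<le> X \<Longrightarrow> \<bar>w1 r - w2 r\<bar> \<le> D * exp (2 * C * r)"
    and x: "0 \<le> x" "x \<le> X"
  shows "\<bar>integral {0..x} (F w1) - integral {0..x} (F w2)\<bar> \<le> D / 2 * exp (2 * C * x)"
proof -
  have c: "continuous_on {0..x} (F w1)" "continuous_on {0..x} (F w2)"
    using x by (auto intro: continuous_on_subset[OF causal_lipschitz_cont[OF F w(1)]]
        continuous_on_subset[OF causal_lipschitz_cont[OF F w(2)]])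
  have I: "((\<lambda>s. C * (D * exp (2 * C * s))) has_integral D / 2 * exp (2 * C * x) - D / 2 * exp (2 * C * 0)) {0..x}"
    using C x(1) by (intro fundamental_theorem_of_calculus)
      (auto intro!: derivative_eq_intros simp: has_real_derivative_iff_has_vector_derivative[symmetric])
  have "integral {0..x} (F w1) - integral {0..x} (F w2) = integral {0..x} (\<lambda>s. F w1 s - F w2 s)"
    using c by (simp add: integral_diff integrable_continuous_real)
  also have "norm \<dots> \<le> integral {0..x} (\<lambda>s. C * (D * exp (2 * C * s)))"
  proof (rule integral_norm_bound_integral)
    show "(\<lambda>s. F w1 s - F w2 s) integrable_on {0..x}"
      using c by (intro integrable_continuous_real continuous_intros)
    show "(\<lambda>s. C * (D * exp (2 * C * s))) integrable_on {0..x}"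
      using I by blast
    fix s assume s: "s \<in> {0..x}"
    have "\<bar>F w1 s - F w2 s\<bar> \<le> C * (D * exp (2 * C * s))"
    proof (rule causal_lipschitz_bound[OF F w])
      fix r assume r: "0 \<le> r" "r \<le> s"
      have "\<bar>w1 r - w2 r\<bar> \<le> D * exp (2 * C * r)" using D(2) r s x by auto
      also have "\<dots> \<le> D * exp (2 * C * s)" using r C D(1) by (intro mult_left_mono) auto
      finally show "\<bar>w1 r - w2 r\<bar> \<le> D * exp (2 * C * s)" .
    qed (use s x in auto)
    then show "norm (F w1 s - F w2 s) \<le> C * (D * exp (2 * C * s))" by simp
  qed
  also have "\<dots> = D / 2 * exp (2 * C * x) - D / 2 * exp (2 * C * 0)" by (rule integral_unique[OF I])
  also have "\<dots> \<le> D / 2 * exp (2 * C * x)" using D(1) by simp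
  finally show ?thesis by simp
qed

text \<open>At the point where the weighted distance is largest, the contraction absorbs half of it, and the
  other half is bounded by the distance of the initial values.\<close>

lemma volterra_stability:
  assumes F: "causal_lipschitz C X F" and C: "0 < C"
    and w: "continuous_on {0..X} w1" "continuous_on {0..X} w2"
    and eq1: "\<And>x. 0 \<le> x \<Longrightarrow> x \<le> X \<Longrightarrow> w1 x = a1 + integral {0..x} (F w1)"
    and eq2: "\<And>x. 0 \<le> x \<Longrightarrow> x \<le> X \<Longrightarrow> w2 x = a2 + integral {0..x} (F w2)"
    and x: "0 \<le> x" "x \<le> X"
  shows "\<bar>w1 x - w2 x\<bar> \<le> 2 * \<bar>a1 - a2\<bar> * exp (2 * C * x)"
proof -
  define d where "d r = \<bar>w1 r - w2 r\<bar> * exp (- (2 * C * r))" for r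
  have "\<exists>r0\<in>{0..X}. \<forall>r\<in>{0..X}. d r \<le> d r0"
    by (rule continuous_attains_sup) (use x w in \<open>auto intro!: continuous_intros simp: d_def\<close>)
  then obtain r0 where r0: "0 \<le> r0" "r0 \<le> X" and max: "\<And>r. 0 \<le> r \<Longrightarrow> r \<le> X \<Longrightarrow> d r \<le> d r0"
    by auto
  have w_d: "\<bar>w1 r - w2 r\<bar> = d r * exp (2 * C * r)" for r
    by (simp add: d_def mult_exp_exp)
  have d0: "0 \<le> d r0" by (simp add: d_def)
  have "\<bar>integral {0..r0} (F w1) - integral {0..r0} (F w2)\<bar> \<le> d r0 / 2 * exp (2 * C * r0)"
    by (rule causal_integral_contraction[OF F C w d0 _ r0]) (simp add: w_d max)
  then have "d r0 * exp (2 * C * r0) \<le> \<bar>a1 - a2\<bar> + d r0 / 2 * exp (2 * C * r0)"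
    using eq1[OF r0] eq2[OF r0] w_d[of r0] by linarith
  then have "d r0 * exp (2 * C * r0) \<le> 2 * \<bar>a1 - a2\<bar>" by simp
  moreover have "d r0 * 1 \<le> d r0 * exp (2 * C * r0)"
    using d0 C r0 by (intro mult_left_mono) auto
  ultimately have "d x \<le> 2 * \<bar>a1 - a2\<bar>" using max[OF x] by linarith
  then show ?thesis unfolding w_d by (intro mult_right_mono) auto
qed

text \<open>The fixed point is sought as the weighted function \<open>u = exp (- 2 C x) w\<close>, extended by constants outside
  \<open>[0, X]\<close> so that it belongs to the complete space of bounded continuous functions on the line.\<close>

lemma volterra_existence:
  assumes F: "causal_lipschitz C X F" and C: "0 < C" and X: "0 \<le> X"
  shows "\<exists>w. continuous_on {0..X} w \<and> (\<forall>x\<in>{0..X}. w x = a + integral {0..x} (F w))"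
proof -
  define y where "y x = max 0 (min X x)" for x :: real
  have y: "0 \<le> y x" "y x \<le> X" "0 \<le> x \<Longrightarrow> x \<le> X \<Longrightarrow> y x = x" for x
    using X by (auto simp: y_def)
  define E where "E u = (\<lambda>r. exp (2 * C * r) * apply_bcontfun u r)" for u :: "real \<Rightarrow>\<^sub>C real"
  define T where "T u x = exp (- (2 * C * x)) * (a + integral {0..x} (F (E u)))" for u x
  define S where "S u = Bcontfun (\<lambda>x. T u (y x))" for u
  have E_cont: "continuous_on {0..X} (E u)" for u
    unfolding E_def
    by (intro continuous_intros) auto
  have F_cont: "continuous_on {0..X} (F (E u))" for u
    by (rule causal_lipschitz_cont[OF F E_cont])
  have I_cont: "continuous_on {0..X} (\<lambda>x. integral {0..x} (F (E u)))" for u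
    by (rule indefinite_integral_continuous_1) (rule integrable_continuous_real[OF F_cont])
  have T_cont: "continuous_on {0..X} (T u)" for u
    unfolding T_def by (intro continuous_intros I_cont)
  have Ty: "(\<lambda>x. T u (y x)) \<in> bcontfun" for u
  proof -
    have "continuous_on UNIV (\<lambda>x. T u (y x))"
      by (rule continuous_on_compose2[OF T_cont]) (auto simp: y_def X intro!: continuous_intros)
    moreover have "bounded (range (\<lambda>x. T u (y x)))"
      by (rule bounded_subset[OF compact_imp_bounded[OF compact_continuous_image[OF T_cont compact_Icc]]])
         (use y in auto)
    ultimately show ?thesis by (simp add: bcontfun_def)
  qed
  have S_apply: "apply_bcontfun (S u) x = T u (y x)" for u x
    unfolding S_def using Ty by (simp add: Bcontfun_inverse)
  have "\<forall>u u'. dist (S u) (S u') \<le> 1 / 2 * dist u u'"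
  proof (intro allI dist_bound)
    fix u u' :: "real \<Rightarrow>\<^sub>C real" and x :: real
    have "\<bar>integral {0..y x} (F (E u)) - integral {0..y x} (F (E u'))\<bar> \<le> dist u u' / 2 * exp (2 * C * y x)"
    proof (rule causal_integral_contraction[OF F C E_cont E_cont])
      fix r :: real
      have "\<bar>apply_bcontfun u r - apply_bcontfun u' r\<bar> \<le> dist u u'"
        using dist_bounded[of u r u'] by (simp add: dist_real_def)
      then show "\<bar>E u r - E u' r\<bar> \<le> dist u u' * exp (2 * C * r)"
        by (simp add: E_def abs_mult flip: right_diff_distrib)
    qed (use y in auto)
    then have "exp (- (2 * C * y x)) * \<bar>integral {0..y x} (F (E u)) - integral {0..y x} (F (E u'))\<bar>
      \<le> exp (- (2 * C * y x)) * (dist u u' / 2 * exp (2 * C * y x))"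
      by (intro mult_left_mono) auto
    also have "\<dots> = 1 / 2 * dist u u'" by (simp add: exp_minus field_simps)
    also have "exp (- (2 * C * y x)) * \<bar>integral {0..y x} (F (E u)) - integral {0..y x} (F (E u'))\<bar>
        = dist (apply_bcontfun (S u) x) (apply_bcontfun (S u') x)"
      by (simp add: S_apply T_def dist_real_def abs_mult flip: right_diff_distrib)
    finally show "dist (apply_bcontfun (S u) x) (apply_bcontfun (S u') x) \<le> 1 / 2 * dist u u'" .
  qed
  then have "\<exists>!u. S u = u" by (intro banach_fix_type[of "1/2"]) auto
  then obtain u where u: "S u = u" by blast
  show ?thesis
  proof (intro exI[of _ "E u"] conjI ballI)
    show "continuous_on {0..X} (E u)" by (rule E_cont)
    fix x assume "x \<in> {0..X}"
    then have "apply_bcontfun u x = T u x" using S_apply[of u x] u y by simp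
    then show "E u x = a + integral {0..x} (F (E u))"
      by (simp add: E_def[of u] T_def mult_exp_exp flip: mult.assoc)
  qed
qed

section \<open>The profile equation as an integral equation\<close>

definition clip :: "real \<Rightarrow> real \<Rightarrow> real" where
  "clip M y = min M (max 0 y)"

lemma clip_bounds: "0 \<le> M \<Longrightarrow> 0 \<le> clip M y" "0 \<le> M \<Longrightarrow> clip M y \<le> M"
  by (auto simp: clip_def)

lemma clip_id: "0 \<le> y \<Longrightarrow> y \<le> M \<Longrightarrow> clip M y = y"
  by (auto simp: clip_def)

lemma clip_dist: "0 \<le> M \<Longrightarrow> \<bar>clip M x - clip M y\<bar> \<le> \<bar>x - y\<bar>"
  by (auto simp: clip_def min_def max_def)

lemma continuous_on_clip: "continuous_on S w \<Longrightarrow> continuous_on S (\<lambda>r. clip M (w r))"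
  unfolding clip_def by (intro continuous_intros)

lemma powr_lipschitz:
  fixes c M y1 y2 :: real
  assumes "1 < c" "0 \<le> y1" "y1 \<le> M" "0 \<le> y2" "y2 \<le> M"
  shows "\<bar>y1 powr c - y2 powr c\<bar> \<le> c * M powr (c - 1) * \<bar>y1 - y2\<bar>"
  using assms
proof (induction y1 y2 rule: linorder_wlog)
  case (sym a b)
  then show ?case by (simp add: abs_minus_commute)
next
  case (le a b)
  show ?case
  proof (cases "a = b")
    case False
    then have ab: "a < b" using le by simp
    have cont: "continuous_on {a..b} (\<lambda>y. y powr c)"
      using le by (intro continuous_on_powr' continuous_intros) auto
    have "\<exists>l z. a < z \<and> z < b \<and> DERIV (\<lambda>y. y powr c) z :> l \<and> b powr c - a powr c = (b - a) * l"
    proof (rule MVT[OF ab cont])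
      fix x assume "a < x" "x < b"
      then show "(\<lambda>y. y powr c) differentiable (at x)"
        using le has_real_derivative_powr[of x c] by (auto simp: real_differentiable_def)
    qed
    then obtain l z where z: "a < z" "z < b" and l: "DERIV (\<lambda>y. y powr c) z :> l"
      and eq: "b powr c - a powr c = (b - a) * l" by blast
    have "l = c * z powr (c - 1)"
      using DERIV_unique[OF l has_real_derivative_powr[of z c]] z le by simp
    moreover have "z powr (c - 1) \<le> M powr (c - 1)"
      using z le by (intro powr_mono2) auto
    ultimately have l2: "l \<le> c * M powr (c - 1)" using le by simp
    have "a powr c \<le> b powr c" using le by (intro powr_mono2) auto
    then have "\<bar>a powr c - b powr c\<bar> = (b - a) * l" using eq by simp
    also have "\<dots> \<le> (b - a) * (c * M powr (c - 1))" using l2 ab by (intro mult_left_mono) auto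
    finally show ?thesis using ab by (simp add: mult.commute)
  qed simp
qed

lemma weighted_integral_bound:
  fixes h :: "real \<Rightarrow> real"
  assumes "continuous_on {0..x} h" "0 \<le> x" "\<And>r. 0 \<le> r \<Longrightarrow> r \<le> x \<Longrightarrow> \<bar>h r\<bar> \<le> B"
  shows "\<bar>integral {0..x} (\<lambda>r. r ^ k * h r)\<bar> \<le> x ^ k * B * x"
proof -
  have B: "0 \<le> B" using assms(3)[of 0] assms(2) by linarith
  have "norm (integral {0..x} (\<lambda>r. r ^ k * h r)) \<le> (x ^ k * B) * (x - 0)"
  proof (rule integral_bound)
    fix t assume t: "t \<in> {0..x}"
    then have "\<bar>t ^ k\<bar> * \<bar>h t\<bar> \<le> x ^ k * B"
      using assms B by (intro mult_mono) (auto simp: power_abs intro!: power_mono)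
    then show "norm (t ^ k * h t) \<le> x ^ k * B" by (simp add: abs_mult)
  qed (use assms in \<open>auto intro!: continuous_intros\<close>)
  then show ?thesis by simp
qed

text \<open>The equation is \<open>v'' + k/x v' + \<alpha> v^n + \<beta> x (v^n)' = x^\<sigma> v^q\<close>. The last two assumptions are
  \<open>\<sigma> > \<sigma>_*\<close> and \<open>m > m_c\<close> after the substitution \<open>n = 1/m\<close>, \<open>q = p/m\<close>, \<open>k = N - 1\<close>.\<close>

locale shooting =
  fixes k :: nat and n q \<sigma> \<beta> :: real
  assumes n1: "1 < n" and nq: "n < q" and beta_pos: "0 < \<beta>"
    and supercritical: "2 * (q - n) < \<sigma> * (n - 1)"
    and fast_diffusion: "(real k + 1) * (n - 1) < 2 * n"
begin

text \<open>The slow decay exponent of \<open>v\<close>; it satisfies \<open>\<alpha> = \<beta> n \<kappa>\<close>, so that \<open>x^(- \<kappa>)\<close> solves the first-order part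
  \<open>\<alpha> v^n + \<beta> x (v^n)' = 0\<close> of the equation. The excess \<open>\<alpha> - N \<beta>\<close> is what remains of \<open>\<alpha>\<close> once the drift is written in
  divergence form.\<close>

definition "kap = (\<sigma> + 2) / (q - 1)"
definition "alp = \<beta> * n * kap"
definition "eps = alp - (real k + 1) * \<beta>"

text \<open>By the divergence theorem this is \<open>x^k (w' + \<beta> x w^n)\<close> for a solution \<open>w\<close>: sources
  collected from the centre, where the flux vanishes.\<close>

definition flux :: "(real \<Rightarrow> real) \<Rightarrow> real \<Rightarrow> real" where
  "flux w x = integral {0..x} (\<lambda>r. r ^ k * (r powr \<sigma> * w r powr q - eps * w r powr n))"

definition vel :: "(real \<Rightarrow> real) \<Rightarrow> real \<Rightarrow> real" where
  "vel w x = flux w x / x ^ k - \<beta> * x * w x powr n"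

text \<open>Both notions of solution are integral equations. The differences are written on the right-hand
  side so that the equations can be used for rewriting without looping. Truncation makes the
  nonlinearity globally Lipschitz, and a truncated solution may continue with negative values after reaching 0.\<close>

definition sol :: "(real \<Rightarrow> real) \<Rightarrow> real \<Rightarrow> bool" where
  "sol w X \<longleftrightarrow> continuous_on {0..X} w \<and> (\<forall>x\<in>{0..X}. 0 < w x) \<and>
     (\<forall>x\<in>{0..X}. integral {0..x} (vel w) = w x - w 0)"

definition tsol :: "real \<Rightarrow> (real \<Rightarrow> real) \<Rightarrow> real \<Rightarrow> bool" where
  "tsol M w X \<longleftrightarrow> continuous_on {0..X} w \<and>
     (\<forall>x\<in>{0..X}. integral {0..x} (vel (\<lambda>r. clip M (w r))) = w x - w 0)"

lemma sigma_pos: "0 < \<sigma>"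
proof -
  have "0 < 2 * (q - n)" using nq by simp
  then have "0 < \<sigma> * (n - 1)" using supercritical by (rule less_trans)
  then show ?thesis using n1 by (simp add: zero_less_mult_iff)
qed

lemma kap_pos: "0 < kap"
  using sigma_pos n1 nq by (simp add: kap_def)

lemma kap_eq: "kap * (q - 1) = \<sigma> + 2"
  using n1 nq by (simp add: kap_def)

text \<open>The condition \<open>\<sigma> > \<sigma>_*\<close> says that the decay exponent \<open>n \<kappa>\<close> of \<open>f\<close> exceeds the exponent \<open>\<kappa> + 2\<close> with
  which diffusion and absorption decay: the linear terms are negligible at infinity.\<close>

lemma theta_pos: "2 < kap * (n - 1)"
proof -
  have "2 * (q - 1) < (\<sigma> + 2) * (n - 1)" using supercritical by (simp add: algebra_simps)
  then have "2 < (\<sigma> + 2) * (n - 1) / (q - 1)" using n1 nq by (simp add: pos_less_divide_eq)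
  then show ?thesis by (simp add: kap_def)
qed

text \<open>The first inequality makes the mass of a slowly decaying profile finite at infinity and
  yields \<open>\<alpha> > N \<beta>\<close>; the second makes \<open>x^(- \<kappa>)\<close> subharmonic, which is needed for a positive singular
  stationary solution. Both come from \<open>m > m_c\<close> together with \<open>\<kappa> (n - 1) > 2\<close>.\<close>

lemma dim_less: "real k + 1 < n * kap" "real k < kap + 1"
proof -
  have "(real k + 1) * (n - 1) < n * (kap * (n - 1))"
    using fast_diffusion mult_strict_left_mono[OF theta_pos, of n] n1 by linarith
  then show "real k + 1 < n * kap" using n1 by (simp flip: mult.assoc)
  have "real k * (n - 1) < (kap + 1) * (n - 1)"
    using fast_diffusion theta_pos by (simp add: algebra_simps)
  then show "real k < kap + 1" using n1 by simp
qed

lemma alp_pos: "0 < alp"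
  using beta_pos n1 kap_pos by (simp add: alp_def)

lemma eps_pos: "0 < eps"
  using mult_strict_left_mono[OF dim_less(1) beta_pos] by (simp add: eps_def alp_def algebra_simps)

lemma source_continuous:
  assumes "continuous_on {0..X} w" "\<And>x. 0 \<le> x \<Longrightarrow> x \<le> X \<Longrightarrow> 0 \<le> w x"
  shows "continuous_on {0..X} (\<lambda>r. r powr \<sigma> * w r powr q - eps * w r powr n)"
  using assms sigma_pos n1 nq by (intro continuous_intros continuous_on_powr') auto

lemma flux_cong: "(\<And>r. 0 \<le> r \<Longrightarrow> r \<le> x \<Longrightarrow> w1 r = w2 r) \<Longrightarrow> flux w1 x = flux w2 x"
  unfolding flux_def by (rule integral_cong) auto

lemma vel_cong: "0 \<le> x \<Longrightarrow> (\<And>r. 0 \<le> r \<Longrightarrow> r \<le> x \<Longrightarrow> w1 r = w2 r) \<Longrightarrow> vel w1 x = vel w2 x"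
  unfolding vel_def using flux_cong[of x w1 w2] by simp

lemma flux_0 [simp]: "flux w 0 = 0"
  by (simp add: flux_def)

lemma vel_0 [simp]: "vel w 0 = 0"
  by (simp add: vel_def)

lemma flux_continuous:
  assumes "continuous_on {0..X} w" "\<And>x. 0 \<le> x \<Longrightarrow> x \<le> X \<Longrightarrow> 0 \<le> w x"
  shows "continuous_on {0..X} (flux w)"
  unfolding flux_def
  by (intro indefinite_integral_continuous_1 integrable_continuous_real continuous_on_mult
      continuous_on_power continuous_on_id source_continuous assms)

text \<open>Only the origin needs an argument: bounded sources produce a flux of order \<open>x^(k+1)\<close>, so the
  quotient by \<open>x^k\<close> tends to 0.\<close>

lemma vel_continuous:
  assumes w: "continuous_on {0..X} w" "\<And>x. 0 \<le> x \<Longrightarrow> x \<le> X \<Longrightarrow> 0 \<le> w x"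
  shows "continuous_on {0..X} (vel w)"
proof -
  let ?h = "\<lambda>r. r powr \<sigma> * w r powr q - eps * w r powr n"
  have h: "continuous_on {0..X} ?h" by (rule source_continuous) (use w in auto)
  have "bounded (?h ` {0..X})"
    by (rule compact_imp_bounded[OF compact_continuous_image[OF h compact_Icc]])
  then obtain B where "\<forall>y\<in>?h ` {0..X}. norm y \<le> B" unfolding bounded_iff by blast
  then have B: "\<bar>?h r\<bar> \<le> B" if "0 \<le> r" "r \<le> X" for r using that by auto
  have "continuous (at x within {0..X}) (\<lambda>x. flux w x / x ^ k)" if x: "x \<in> {0..X}" for x
  proof (cases "x = 0")
    case True
    have "\<forall>\<^sub>F y in at 0 within {0..X}. norm (flux w y / y ^ k) \<le> B * y"
      unfolding eventually_at_filter
    proof (intro always_eventually allI impI)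
      fix y assume y: "y \<noteq> 0" "y \<in> {0..X}"
      have "\<bar>flux w y\<bar> \<le> y ^ k * B * y"
        unfolding flux_def
        by (rule weighted_integral_bound) (use y B in \<open>auto intro: continuous_on_subset[OF h]\<close>)
      then show "norm (flux w y / y ^ k) \<le> B * y"
        using y by (simp add: power_abs divide_le_eq mult_ac)
    qed
    moreover have "((\<lambda>y. B * y) \<longlongrightarrow> 0) (at 0 within {0..X})"
      by (auto intro!: tendsto_eq_intros)
    ultimately have "((\<lambda>y. flux w y / y ^ k) \<longlongrightarrow> 0) (at 0 within {0..X})"
      by (rule Lim_null_comparison)
    then show ?thesis using True by (simp add: continuous_within)
  next
    case False
    have "continuous (at x within {0..X}) (flux w)"
      using flux_continuous[OF w] x by (simp add: continuous_on_eq_continuous_within)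
    then show ?thesis using False by (intro continuous_intros) auto
  qed
  then have "continuous_on {0..X} (\<lambda>x. flux w x / x ^ k)"
    by (simp add: continuous_on_eq_continuous_within)
  moreover have "continuous_on {0..X} (\<lambda>x. w x powr n)"
    by (rule continuous_on_powr'[OF w(1) continuous_on_const]) (use n1 w(2) in auto)
  ultimately show ?thesis
    unfolding vel_def by (intro continuous_on_diff continuous_on_mult continuous_on_const continuous_on_id)
qed

text \<open>The same order counting as at the origin: a difference \<open>D\<close> of the sources changes the flux
  by at most a multiple of \<open>s^(k+1) D\<close>, so dividing by \<open>s^k\<close> is harmless.\<close>

lemma truncated_vel_causal_lipschitz:
  assumes M: "0 \<le> M" and X: "0 \<le> X"
  obtains C where "0 < C" "causal_lipschitz C X (\<lambda>w. vel (\<lambda>r. clip M (w r)))"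
proof -
  define Ln where "Ln = n * M powr (n - 1)"
  define Lq where "Lq = q * M powr (q - 1)"
  have L: "0 \<le> Ln" "0 \<le> Lq" using n1 nq by (auto simp: Ln_def Lq_def)
  have lipn: "\<bar>clip M a powr n - clip M b powr n\<bar> \<le> Ln * \<bar>a - b\<bar>" for a b
    using order_trans[OF powr_lipschitz[OF n1, of "clip M a" M "clip M b"]
        mult_left_mono[OF clip_dist[OF M] L(1)[unfolded Ln_def]]] clip_bounds[OF M]
    by (auto simp: Ln_def)
  have lipq: "\<bar>clip M a powr q - clip M b powr q\<bar> \<le> Lq * \<bar>a - b\<bar>" for a b
    using order_trans[OF powr_lipschitz[of q "clip M a" M "clip M b"]
        mult_left_mono[OF clip_dist[OF M] L(2)[unfolded Lq_def]]] clip_bounds[OF M] n1 nq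
    by (auto simp: Lq_def)
  define B where "B = X powr \<sigma> * Lq + eps * Ln"
  have B: "0 \<le> B" using L eps_pos by (auto simp: B_def)
  define C where "C = B * X + \<beta> * X * Ln + 1"
  have C0: "0 \<le> B * X + \<beta> * X * Ln" using B L X beta_pos by auto
  then have "0 < C" by (simp add: C_def)
  moreover have "causal_lipschitz C X (\<lambda>w. vel (\<lambda>r. clip M (w r)))"
    unfolding causal_lipschitz_def
  proof (intro conjI allI impI)
    fix w :: "real \<Rightarrow> real" assume "continuous_on {0..X} w"
    then show "continuous_on {0..X} (vel (\<lambda>r. clip M (w r)))"
      by (intro vel_continuous continuous_on_clip clip_bounds M)
  next
    fix w1 w2 :: "real \<Rightarrow> real" and s D
    assume w1: "continuous_on {0..X} w1" and w2: "continuous_on {0..X} w2"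
      and s: "0 \<le> s" "s \<le> X" and D: "\<forall>r\<in>{0..s}. \<bar>w1 r - w2 r\<bar> \<le> D"
    have D0: "0 \<le> D" using D[rule_format, of s] s by auto
    let ?h = "\<lambda>w r. r powr \<sigma> * clip M (w r) powr q - eps * clip M (w r) powr n"
    have h: "continuous_on {0..X} (?h w)" if "continuous_on {0..X} w" for w
      by (rule source_continuous) (use that M in \<open>auto intro: continuous_on_clip clip_bounds\<close>)
    have hs: "continuous_on {0..s} (?h w1)" "continuous_on {0..s} (?h w2)"
      using h[OF w1] h[OF w2] s by (auto intro: continuous_on_subset)
    have "flux (\<lambda>r. clip M (w1 r)) s - flux (\<lambda>r. clip M (w2 r)) s
        = integral {0..s} (\<lambda>r. r ^ k * ?h w1 r) - integral {0..s} (\<lambda>r. r ^ k * ?h w2 r)"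
      by (simp add: flux_def)
    also have "\<dots> = integral {0..s} (\<lambda>r. r ^ k * ?h w1 r - r ^ k * ?h w2 r)"
      by (intro integral_diff[symmetric] integrable_continuous_real continuous_on_mult
          continuous_on_power continuous_on_id hs)
    also have "\<dots> = integral {0..s} (\<lambda>r. r ^ k * (?h w1 r - ?h w2 r))"
      by (simp only: right_diff_distrib)
    finally have eq: "flux (\<lambda>r. clip M (w1 r)) s - flux (\<lambda>r. clip M (w2 r)) s
        = integral {0..s} (\<lambda>r. r ^ k * (?h w1 r - ?h w2 r))" .
    have "\<bar>flux (\<lambda>r. clip M (w1 r)) s - flux (\<lambda>r. clip M (w2 r)) s\<bar> \<le> s ^ k * (B * D) * s"
      unfolding eq
    proof (rule weighted_integral_bound)
      fix r assume r: "0 \<le> r" "r \<le> s"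
      have "?h w1 r - ?h w2 r = r powr \<sigma> * (clip M (w1 r) powr q - clip M (w2 r) powr q)
          - eps * (clip M (w1 r) powr n - clip M (w2 r) powr n)" by (simp add: algebra_simps)
      also have "\<bar>\<dots>\<bar> \<le> r powr \<sigma> * \<bar>clip M (w1 r) powr q - clip M (w2 r) powr q\<bar>
          + eps * \<bar>clip M (w1 r) powr n - clip M (w2 r) powr n\<bar>"
        using eps_pos by (intro order_trans[OF abs_triangle_ineq4]) (auto simp: abs_mult)
      also have "\<dots> \<le> X powr \<sigma> * (Lq * D) + eps * (Ln * D)"
      proof (intro add_mono mult_mono)
        show "r powr \<sigma> \<le> X powr \<sigma>" using r s sigma_pos by (intro powr_mono2) auto
        have d: "\<bar>w1 r - w2 r\<bar> \<le> D" using D r by auto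
        show "\<bar>clip M (w1 r) powr q - clip M (w2 r) powr q\<bar> \<le> Lq * D"
          using order_trans[OF lipq mult_left_mono[OF d L(2)]] .
        show "\<bar>clip M (w1 r) powr n - clip M (w2 r) powr n\<bar> \<le> Ln * D"
          using order_trans[OF lipn mult_left_mono[OF d L(1)]] .
      qed (use eps_pos in auto)
      also have "\<dots> = B * D" by (simp add: B_def algebra_simps)
      finally show "\<bar>?h w1 r - ?h w2 r\<bar> \<le> B * D" .
    qed (use s in \<open>auto intro: continuous_on_diff[OF hs]\<close>)
    then have "\<bar>(flux (\<lambda>r. clip M (w1 r)) s - flux (\<lambda>r. clip M (w2 r)) s) / s ^ k\<bar> \<le> B * D * s"
      using s B D0 by (cases "s = 0") (auto simp: power_abs divide_le_eq mult_ac abs_divide)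
    also have "\<dots> \<le> B * D * X" using s B D0 by (intro mult_left_mono) auto
    finally have 1: "\<bar>flux (\<lambda>r. clip M (w1 r)) s / s ^ k - flux (\<lambda>r. clip M (w2 r)) s / s ^ k\<bar> \<le> B * D * X"
      by (simp add: diff_divide_distrib)
    have "\<bar>w1 s - w2 s\<bar> \<le> D" using D s by auto
    then have "\<bar>clip M (w1 s) powr n - clip M (w2 s) powr n\<bar> \<le> Ln * D"
      using order_trans[OF lipn mult_left_mono[OF _ L(1)]] by blast
    then have "\<beta> * s * \<bar>clip M (w1 s) powr n - clip M (w2 s) powr n\<bar> \<le> \<beta> * X * (Ln * D)"
      using s X beta_pos L D0 by (intro mult_mono) auto
    then have 2: "\<bar>\<beta> * s * clip M (w1 s) powr n - \<beta> * s * clip M (w2 s) powr n\<bar> \<le> \<beta> * X * (Ln * D)"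
      using s beta_pos by (simp add: abs_mult flip: right_diff_distrib)
    have "\<bar>vel (\<lambda>r. clip M (w1 r)) s - vel (\<lambda>r. clip M (w2 r)) s\<bar> \<le> B * D * X + \<beta> * X * (Ln * D)"
      using 1 2 unfolding vel_def by linarith
    also have "\<dots> \<le> C * D" using D0 by (simp add: C_def algebra_simps)
    finally show "\<bar>vel (\<lambda>r. clip M (w1 r)) s - vel (\<lambda>r. clip M (w2 r)) s\<bar> \<le> C * D" .
  qed
  ultimately show thesis by (rule that)
qed

lemma tsol_exists:
  assumes "0 \<le> M" "0 \<le> X"
  obtains w where "tsol M w X" "w 0 = a"
proof -
  obtain C where C: "0 < C" "causal_lipschitz C X (\<lambda>w. vel (\<lambda>r. clip M (w r)))"
    using truncated_vel_causal_lipschitz[OF assms] .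
  obtain w where w: "continuous_on {0..X} w"
    "\<forall>x\<in>{0..X}. w x = a + integral {0..x} (vel (\<lambda>r. clip M (w r)))"
    using volterra_existence[OF C(2,1) assms(2), of a] by blast
  have "w 0 = a" using bspec[OF w(2), of 0] assms by simp
  moreover have "integral {0..x} (vel (\<lambda>r. clip M (w r))) = w x - a" if "x \<in> {0..X}" for x
    using bspec[OF w(2) that] by linarith
  ultimately show thesis using w(1) by (intro that[of w]) (auto simp: tsol_def)
qed

lemma tsol_stable:
  assumes "0 \<le> M" "0 \<le> X"
  obtains K where "0 < K"
    "\<And>w1 w2 x. tsol M w1 X \<Longrightarrow> tsol M w2 X \<Longrightarrow> 0 \<le> x \<Longrightarrow> x \<le> X \<Longrightarrow> \<bar>w1 x - w2 x\<bar> \<le> K * \<bar>w1 0 - w2 0\<bar>"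
proof -
  obtain C where C: "0 < C" "causal_lipschitz C X (\<lambda>w. vel (\<lambda>r. clip M (w r)))"
    using truncated_vel_causal_lipschitz[OF assms] .
  show thesis
  proof (rule that[of "2 * exp (2 * C * X)"])
    fix w1 w2 x assume w: "tsol M w1 X" "tsol M w2 X" and x: "0 \<le> x" "x \<le> X"
    have "\<bar>w1 x - w2 x\<bar> \<le> 2 * \<bar>w1 0 - w2 0\<bar> * exp (2 * C * x)"
      using w by (intro volterra_stability[OF C(2,1) _ _ _ _ x]) (simp_all add: tsol_def)
    also have "\<dots> \<le> 2 * \<bar>w1 0 - w2 0\<bar> * exp (2 * C * X)"
      using C x by (intro mult_left_mono) auto
    finally show "\<bar>w1 x - w2 x\<bar> \<le> 2 * exp (2 * C * X) * \<bar>w1 0 - w2 0\<bar>" by (simp add: mult_ac)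
  qed simp
qed

lemma tsol_unique:
  assumes "0 \<le> M" "tsol M w1 X" "tsol M w2 X" "w1 0 = w2 0" "0 \<le> x" "x \<le> X"
  shows "w1 x = w2 x"
proof -
  obtain K where "\<And>w1 w2 x. tsol M w1 X \<Longrightarrow> tsol M w2 X \<Longrightarrow> 0 \<le> x \<Longrightarrow> x \<le> X \<Longrightarrow>
      \<bar>w1 x - w2 x\<bar> \<le> K * \<bar>w1 0 - w2 0\<bar>"
    using tsol_stable[of M X] assms by (metis order_trans)
  from this[OF assms(2,3,5,6)] assms(4) show ?thesis by simp
qed

lemma tsol_mono: "tsol M w X \<Longrightarrow> Y \<le> X \<Longrightarrow> tsol M w Y"
  by (auto simp: tsol_def intro: continuous_on_subset)

lemma sol_mono: "sol w X \<Longrightarrow> Y \<le> X \<Longrightarrow> sol w Y"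
  by (auto simp: sol_def intro: continuous_on_subset)

lemma integral_vel_clip_cong:
  assumes "\<And>r. 0 \<le> r \<Longrightarrow> r \<le> x \<Longrightarrow> clip M (w r) = clip M' (w r)" "0 \<le> x"
  shows "integral {0..x} (vel (\<lambda>r. clip M (w r))) = integral {0..x} (vel (\<lambda>r. clip M' (w r)))"
  by (rule integral_cong, rule vel_cong) (use assms in auto)

lemma sol_imp_tsol:
  assumes "sol w X" "\<And>x. 0 \<le> x \<Longrightarrow> x \<le> X \<Longrightarrow> w x \<le> M"
  shows "tsol M w X"
proof -
  have "integral {0..x} (vel (\<lambda>r. clip M (w r))) = integral {0..x} (vel w)" if "0 \<le> x" "x \<le> X" for x
    by (rule integral_cong, rule vel_cong) (use assms that in \<open>auto simp: sol_def intro!: clip_id less_imp_le[of 0]\<close>)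
  then show ?thesis using assms(1) by (simp add: tsol_def sol_def)
qed

lemma tsol_imp_sol:
  assumes "tsol M w X" "\<And>x. 0 \<le> x \<Longrightarrow> x \<le> X \<Longrightarrow> w x \<le> M" "\<And>x. 0 \<le> x \<Longrightarrow> x \<le> X \<Longrightarrow> 0 < w x"
  shows "sol w X"
proof -
  have "integral {0..x} (vel (\<lambda>r. clip M (w r))) = integral {0..x} (vel w)" if "0 \<le> x" "x \<le> X" for x
    by (rule integral_cong, rule vel_cong) (use assms that in \<open>auto intro!: clip_id less_imp_le[of 0]\<close>)
  then show ?thesis using assms by (simp add: tsol_def sol_def)
qed

lemma tsol_enlarge:
  assumes "tsol M w X" "\<And>x. 0 \<le> x \<Longrightarrow> x \<le> X \<Longrightarrow> w x \<le> M" "M \<le> M'" "0 \<le> M"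
  shows "tsol M' w X"
proof -
  have "integral {0..x} (vel (\<lambda>r. clip M (w r))) = integral {0..x} (vel (\<lambda>r. clip M' (w r)))"
    if "0 \<le> x" "x \<le> X" for x
  proof (rule integral_vel_clip_cong)
    fix r assume "0 \<le> r" "r \<le> x"
    then have "w r \<le> M" using assms(2) that by auto
    then show "clip M (w r) = clip M' (w r)" using assms(3,4) by (auto simp: clip_def)
  qed (use that in auto)
  then show ?thesis using assms(1) by (simp add: tsol_def)
qed

lemma cont_bounded_above:
  assumes "continuous_on {0..X::real} w"
  obtains M :: real where "0 < M" "\<And>x. 0 \<le> x \<Longrightarrow> x \<le> X \<Longrightarrow> w x \<le> M"
proof -
  have "bounded (w ` {0..X})"
    by (rule compact_imp_bounded[OF compact_continuous_image[OF assms compact_Icc]])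
  then obtain B where B: "0 < B" "\<forall>y\<in>w ` {0..X}. norm y \<le> B" unfolding bounded_pos by blast
  show thesis by (rule that[OF B(1)]) (use B(2) in force)
qed

text \<open>A truncated solution that stays below its truncation level agrees with every genuine
  solution: enlarging the level until it also dominates the genuine solution, both solve one and the
  same truncated problem.\<close>

lemma sol_eq_tsol:
  assumes "tsol M w X" "\<And>x. 0 \<le> x \<Longrightarrow> x \<le> X \<Longrightarrow> w x \<le> M" "0 \<le> M" "sol u X" "u 0 = w 0" "0 \<le> x" "x \<le> X"
  shows "u x = w x"
proof -
  obtain B where B: "0 < B" "\<And>x. 0 \<le> x \<Longrightarrow> x \<le> X \<Longrightarrow> u x \<le> B"
    using cont_bounded_above[of X u] assms(4) by (auto simp: sol_def)
  have "tsol (max M B) w X" by (rule tsol_enlarge[OF assms(1,2)]) (use assms(3) in auto)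
  moreover have "tsol (max M B) u X" by (rule sol_imp_tsol[OF assms(4)]) (use B(2) in force)
  ultimately show ?thesis using B(1) assms(3,5-7) by (auto intro: tsol_unique[of "max M B" u X w x])
qed

lemma sol_unique:
  assumes "sol u X" "sol w X" "u 0 = w 0" "0 \<le> x" "x \<le> X"
  shows "u x = w x"
proof -
  obtain B where B: "0 < B" "\<And>x. 0 \<le> x \<Longrightarrow> x \<le> X \<Longrightarrow> w x \<le> B"
    using cont_bounded_above[of X w] assms(2) by (auto simp: sol_def)
  show ?thesis by (rule sol_eq_tsol[OF sol_imp_tsol[OF assms(2) B(2)] B(2) less_imp_le[OF B(1)] assms(1,3-5)])
qed

subsection \<open>Derivatives\<close>

lemma flux_deriv:
  assumes "continuous_on {0..X} w" "\<And>x. 0 \<le> x \<Longrightarrow> x \<le> X \<Longrightarrow> 0 \<le> w x" "0 < x" "x < X"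
  shows "(flux w has_real_derivative x ^ k * (x powr \<sigma> * w x powr q - eps * w x powr n)) (at x)"
proof -
  have "continuous_on {0..X} (\<lambda>r. r ^ k * (r powr \<sigma> * w r powr q - eps * w r powr n))"
    by (intro continuous_on_mult continuous_on_power continuous_on_id source_continuous)
      (use assms in auto)
  from integral_has_real_derivative[OF this, of x] show ?thesis
    unfolding flux_def using assms by (simp add: at_within_Icc_at)
qed

lemma tsol_deriv:
  assumes "tsol M w X" "0 \<le> M" "0 < x" "x < X"
  shows "(w has_real_derivative vel (\<lambda>r. clip M (w r)) x) (at x)"
proof -
  have "continuous_on {0..X} (vel (\<lambda>r. clip M (w r)))"
    by (rule vel_continuous) (use assms in \<open>auto simp: tsol_def intro: continuous_on_clip clip_bounds\<close>)
  from integral_has_real_derivative[OF this, of x]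
  have "((\<lambda>x. w 0 + integral {0..x} (vel (\<lambda>r. clip M (w r)))) has_real_derivative vel (\<lambda>r. clip M (w r)) x) (at x)"
    using assms by (auto simp: at_within_Icc_at intro!: derivative_eq_intros)
  then show ?thesis
    by (rule has_field_derivative_transform_within_open[where S = "{0<..<X}"])
       (use assms in \<open>auto simp: tsol_def\<close>)
qed

lemma sol_D:
  assumes "sol w X"
  shows "continuous_on {0..X} w" "\<And>x. 0 \<le> x \<Longrightarrow> x \<le> X \<Longrightarrow> 0 < w x" "\<And>x. 0 \<le> x \<Longrightarrow> x \<le> X \<Longrightarrow> 0 \<le> w x"
  using assms by (auto simp: sol_def order.strict_implies_order)

lemma sol_deriv_within:
  assumes "sol w X" "0 \<le> x" "x \<le> X"
  shows "(w has_real_derivative vel w x) (at x within {0..X})"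
proof -
  have "continuous_on {0..X} (vel w)"
    by (rule vel_continuous[OF sol_D(1,3)[OF assms(1)]])
  from integral_has_real_derivative[OF this, of x]
  have "((\<lambda>x. w 0 + integral {0..x} (vel w)) has_real_derivative vel w x) (at x within {0..X})"
    using assms by (auto intro!: derivative_eq_intros)
  then show ?thesis
    by (rule has_field_derivative_transform_within[where d = 1]) (use assms in \<open>auto simp: sol_def\<close>)
qed

lemma sol_deriv:
  assumes "sol w X" "0 < x" "x < X"
  shows "(w has_real_derivative vel w x) (at x)"
  using sol_deriv_within[OF assms(1), of x] assms by (simp add: at_within_Icc_at)

lemma sol_flux_deriv:
  assumes "sol w X" "0 < x" "x < X"
  shows "(flux w has_real_derivative x ^ k * (x powr \<sigma> * w x powr q - eps * w x powr n)) (at x)"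
  by (rule flux_deriv[OF sol_D(1,3)[OF assms(1)] assms(2,3)])

text \<open>This is the second-order equation, solved for the second derivative.\<close>

lemma sol_vel_deriv:
  assumes "sol w X" "0 < x" "x < X"
  shows "(vel w has_real_derivative x powr \<sigma> * w x powr q - alp * w x powr n
           - (real k / x + \<beta> * n * x * w x powr (n - 1)) * vel w x) (at x)"
proof -
  have wx: "0 < w x" using sol_D(2)[OF assms(1)] assms by auto
  have xk: "real k * x ^ (k - 1) = real k / x * x ^ k"
    using assms by (cases k) auto
  let ?S = "x powr \<sigma> * w x powr q - eps * w x powr n"
  have pw: "((\<lambda>x. w x powr n) has_real_derivative n * w x powr (n - 1) * vel w x) (at x)"
    using DERIV_fun_powr[OF sol_deriv[OF assms] wx, of n] by simp
  have fl: "((\<lambda>x. flux w x / x ^ k) has_real_derivative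
      ((x ^ k * ?S) * x ^ k - flux w x * (real k * x ^ (k - 1))) / (x ^ k * x ^ k)) (at x)"
    by (rule DERIV_divide[OF sol_flux_deriv[OF assms]])
       (use assms DERIV_pow[of k x UNIV] in auto)
  have "((\<lambda>x. flux w x / x ^ k - \<beta> * x * w x powr n) has_real_derivative
      ((x ^ k * ?S) * x ^ k - flux w x * (real k * x ^ (k - 1))) / (x ^ k * x ^ k)
        - (\<beta> * w x powr n + \<beta> * x * (n * w x powr (n - 1) * vel w x))) (at x)"
    by (rule DERIV_cong, rule DERIV_diff[OF fl DERIV_mult[OF DERIV_cmult[OF DERIV_ident] pw]])
       (simp add: algebra_simps)
  also have "((x ^ k * ?S) * x ^ k - flux w x * (real k * x ^ (k - 1))) / (x ^ k * x ^ k)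
      = ?S - real k / x * (flux w x / x ^ k)"
  proof -
    have "((a * S) * a - F * (c * a)) / (a * a) = S - c * (F / a)" if "a \<noteq> 0" for a S F c :: real
      using that by (simp add: divide_simps) (simp add: algebra_simps)
    note * = this
    show ?thesis unfolding xk by (rule *) (use assms in simp)
  qed
  also have "\<dots> = ?S - real k / x * (vel w x + \<beta> * x * w x powr n)"
    by (simp add: vel_def)
  finally have A: "((\<lambda>x. flux w x / x ^ k - \<beta> * x * w x powr n) has_real_derivative
     ?S - real k / x * (vel w x + \<beta> * x * w x powr n)
        - (\<beta> * w x powr n + \<beta> * x * (n * w x powr (n - 1) * vel w x))) (at x)" .
  have E: "?S - real k / x * (vel w x + \<beta> * x * w x powr n)
        - (\<beta> * w x powr n + \<beta> * x * (n * w x powr (n - 1) * vel w x))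
     = x powr \<sigma> * w x powr q - alp * w x powr n
           - (real k / x + \<beta> * n * x * w x powr (n - 1)) * vel w x"
    using assms by (simp add: eps_def field_simps)
  have V: "vel w = (\<lambda>x. flux w x / x ^ k - \<beta> * x * w x powr n)"
    by (simp add: fun_eq_iff vel_def)
  show ?thesis by (rule A[unfolded E, folded V])
qed

end

section \<open>Shape of a single profile\<close>

lemma first_zero:
  fixes D :: "real \<Rightarrow> real"
  assumes "continuous_on {a..b} D" "D a < 0" "0 \<le> D b" "a \<le> b"
  obtains c where "a < c" "c \<le> b" "D c = 0" "\<And>x. a \<le> x \<Longrightarrow> x < c \<Longrightarrow> D x < 0"
proof -
  define S where "S = {a..b} \<inter> D -` {0..}"
  have "closed S"
    unfolding S_def by (rule continuous_closed_preimage[OF assms(1)]) auto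
  then have "compact S"
    using compact_Int_closed[of "{a..b}" S] by (auto simp: S_def Int_absorb2)
  moreover have "S \<noteq> {}" using assms by (auto simp: S_def)
  ultimately obtain c where c: "c \<in> S" "\<And>x. x \<in> S \<Longrightarrow> c \<le> x"
    using compact_attains_inf by metis
  have neg: "D x < 0" if "a \<le> x" "x < c" for x
    using c that by (force simp: S_def)
  have ac: "a < c" using c(1) assms(2) by (cases "a = c") (auto simp: S_def)
  have "D c = 0"
  proof -
    have "\<exists>x. a \<le> x \<and> x \<le> c \<and> D x = 0"
      by (rule IVT') (use c(1) assms in \<open>auto simp: S_def intro: continuous_on_subset\<close>)
    then show ?thesis using neg by (metis less_irrefl order_le_less)
  qed
  then show thesis using that ac neg c(1) by (auto simp: S_def)
qed

context shooting
begin

text \<open>Absorption divided by \<open>w^n\<close>. Sources in the flux are \<open>w^n (ratio - (\<alpha> - N \<beta>))\<close>, and at a critical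
  point the second derivative is \<open>w^n (ratio - \<alpha>)\<close>.\<close>

definition ratio :: "(real \<Rightarrow> real) \<Rightarrow> real \<Rightarrow> real" where
  "ratio w x = x powr \<sigma> * w x powr (q - n)"

lemma source_ratio: "0 < w x \<Longrightarrow> x powr \<sigma> * w x powr q - c * w x powr n = w x powr n * (ratio w x - c)"
  by (simp add: ratio_def algebra_simps flip: powr_add)

lemma ratio_0 [simp]: "ratio w 0 = 0"
  by (simp add: ratio_def)

lemma ratio_continuous:
  assumes "sol w X"
  shows "continuous_on {0..X} (ratio w)"
proof -
  have "continuous_on {0..X} (\<lambda>x. x powr \<sigma>)"
    by (rule continuous_on_powr'[OF continuous_on_id continuous_on_const]) (use sigma_pos in auto)
  moreover have "continuous_on {0..X} (\<lambda>x. w x powr (q - n))"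
    by (rule continuous_on_powr'[OF sol_D(1)[OF assms] continuous_on_const])
       (use nq sol_D(3)[OF assms] in auto)
  ultimately show ?thesis unfolding ratio_def by (rule continuous_on_mult)
qed

lemma flux_deriv_ratio:
  assumes "sol w X" "0 < x" "x < X"
  shows "(flux w has_real_derivative x ^ k * (w x powr n * (ratio w x - eps))) (at x)"
  using sol_flux_deriv[OF assms] source_ratio[of w x eps] sol_D(2)[OF assms(1), of x] assms by simp

lemma sol_continuous:
  assumes "sol w X"
  shows "continuous_on {0..X} (flux w)" "continuous_on {0..X} (vel w)"
  using flux_continuous[OF sol_D(1,3)[OF assms]] vel_continuous[OF sol_D(1,3)[OF assms]] by auto

lemma flux_nonpos:
  assumes "sol w X" "0 \<le> x" "x \<le> X" "\<And>y. 0 < y \<Longrightarrow> y < x \<Longrightarrow> ratio w y \<le> eps"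
  shows "flux w x \<le> 0"
proof -
  have "flux w x \<le> flux w 0"
  proof (rule DERIV_nonpos_imp_decreasing_open[of 0 x "flux w"])
    fix y assume y: "0 < y" "y < x"
    have "y ^ k * (w y powr n * (ratio w y - eps)) \<le> 0"
      using assms(4)[OF y] y by (intro mult_nonneg_nonpos) auto
    then show "\<exists>d. (flux w has_real_derivative d) (at y) \<and> d \<le> 0"
      using flux_deriv_ratio[OF assms(1), of y] y assms by auto
  qed (use assms in \<open>auto intro: continuous_on_subset[OF sol_continuous(1)]\<close>)
  then show ?thesis by simp
qed

text \<open>Where absorption is weak no source is positive, so the flux points inwards and only the
  drift term of the velocity is needed.\<close>

lemma vel_le_of_ratio:
  assumes "sol w X" "0 < x" "x \<le> X" "\<And>y. 0 < y \<Longrightarrow> y < x \<Longrightarrow> ratio w y \<le> eps"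
  shows "vel w x \<le> - \<beta> * x * w x powr n" "vel w x < 0"
proof -
  have "flux w x / x ^ k \<le> 0"
    using flux_nonpos[OF assms(1) _ assms(3,4)] assms(2) by (simp add: divide_nonpos_pos)
  then show *: "vel w x \<le> - \<beta> * x * w x powr n" by (simp add: vel_def)
  have "0 < \<beta> * x * w x powr n" using assms beta_pos sol_D(2)[OF assms(1), of x] by simp
  then show "vel w x < 0" using * by linarith
qed

lemma vel_neg_near_0:
  assumes "sol w X" "0 < X"
  obtains d where "0 < d" "d \<le> X" "\<And>x. 0 < x \<Longrightarrow> x \<le> d \<Longrightarrow> vel w x < 0"
proof -
  from ratio_continuous[OF assms(1)] have "\<exists>d>0. \<forall>x\<in>{0..X}. dist x 0 < d \<longrightarrow> dist (ratio w x) (ratio w 0) < eps"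
    unfolding continuous_on_iff using assms(2) eps_pos by (metis atLeastAtMost_iff less_imp_le order_refl)
  then obtain d where d: "0 < d" "\<And>x. 0 \<le> x \<Longrightarrow> x \<le> X \<Longrightarrow> x < d \<Longrightarrow> ratio w x < eps"
    by (auto simp: dist_real_def abs_less_iff)
  show thesis
  proof (rule that[of "min d X"])
    fix x assume "0 < x" "x \<le> min d X"
    then show "vel w x < 0"
      by (intro vel_le_of_ratio(2)[OF assms(1)]) (auto intro!: less_imp_le[OF d(2)])
  qed (use d assms in auto)
qed

lemma vel_deriv_at_critical:
  assumes "sol w X" "0 < x" "x < X" "vel w x = 0"
  shows "(vel w has_real_derivative w x powr n * (ratio w x - alp)) (at x)"
  using sol_vel_deriv[OF assms(1-3)] source_ratio[of w x alp] sol_D(2)[OF assms(1), of x] assms by simp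

text \<open>The second derivative cannot be negative at the end of a decreasing stretch. In the
  borderline case it vanishes, but then the third derivative is that of \<open>x^\<sigma> w^q\<close> at fixed \<open>w\<close>, hence
  positive, and the velocity would have a strict minimum at the critical point.\<close>

lemma ratio_at_first_critical:
  assumes sol: "sol w X" and x0: "0 < x0" "x0 < X" and crit: "vel w x0 = 0"
    and neg: "\<And>x. 0 < x \<Longrightarrow> x < x0 \<Longrightarrow> vel w x < 0"
  shows "alp < ratio w x0"
proof (rule ccontr)
  have w0: "0 < w x0" using sol_D(2)[OF sol] x0 by auto
  note V = vel_deriv_at_critical[OF sol x0 crit]
  assume "\<not> alp < ratio w x0"
  then consider "ratio w x0 < alp" | "ratio w x0 = alp" by linarith
  then show False
  proof cases
    case 1
    then have "w x0 powr n * (ratio w x0 - alp) < 0" using w0 by (simp add: mult_pos_neg)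
    from DERIV_neg_dec_left[OF V this] obtain d where d: "0 < d"
      "\<forall>h>0. h < d \<longrightarrow> vel w x0 < vel w (x0 - h)" by blast
    define h where "h = min d x0 / 2"
    have "0 < h" "h < d" "h < x0" using d x0 by (auto simp: h_def)
    then show False using d(2) neg[of "x0 - h"] crit by auto
  next
    case 2
    \<comment> \<open>The derivative of the velocity vanishes at \<open>x0\<close>, so one more derivative has to be taken.\<close>
    let ?c = "\<lambda>x. real k / x + \<beta> * n * x * w x powr (n - 1)"
    define dV where "dV x = x powr \<sigma> * w x powr q - alp * w x powr n - ?c x * vel w x" for x
    have dw: "(w has_real_derivative 0) (at x0)" using sol_deriv[OF sol x0] crit by simp
    have pw: "((\<lambda>x. w x powr r) has_real_derivative 0) (at x0)" for r
      using DERIV_fun_powr[OF dw w0, of r] by simp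
    have dx: "((\<lambda>x. x powr \<sigma>) has_real_derivative \<sigma> * x0 powr (\<sigma> - 1)) (at x0)"
      using has_real_derivative_powr[OF x0(1), of \<sigma>] by simp
    have dv: "(vel w has_real_derivative 0) (at x0)" using V 2 by simp
    have dc: "(?c has_real_derivative - (real k / x0\<^sup>2) + \<beta> * n * w x0 powr (n - 1)) (at x0)"
    proof (rule DERIV_add)
      show "((\<lambda>x. real k / x) has_real_derivative - (real k / x0\<^sup>2)) (at x0)"
        using x0 by (auto intro!: derivative_eq_intros simp: power2_eq_square)
      show "((\<lambda>x. \<beta> * n * x * w x powr (n - 1)) has_real_derivative \<beta> * n * w x0 powr (n - 1)) (at x0)"
        by (rule DERIV_cong, rule DERIV_mult[OF DERIV_cmult[OF DERIV_ident] pw]) simp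
    qed
    have "(dV has_real_derivative (\<sigma> * x0 powr (\<sigma> - 1) * w x0 powr q + 0 * x0 powr \<sigma> - alp * 0)
        - ((- (real k / x0\<^sup>2) + \<beta> * n * w x0 powr (n - 1)) * vel w x0 + 0 * ?c x0)) (at x0)"
      unfolding dV_def by (intro DERIV_diff DERIV_mult DERIV_cmult dx dv dc pw)
    then have ddV: "(dV has_real_derivative \<sigma> * x0 powr (\<sigma> - 1) * w x0 powr q) (at x0)"
      by (simp add: crit)
    have "0 < \<sigma> * x0 powr (\<sigma> - 1) * w x0 powr q" using sigma_pos x0 w0 by simp
    from DERIV_pos_inc_left[OF ddV this] obtain d where d: "0 < d"
      "\<forall>h>0. h < d \<longrightarrow> dV (x0 - h) < dV x0" by blast
    have dV0: "dV x0 = 0" using source_ratio[of w x0 alp] w0 2 crit by (simp add: dV_def)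
    define h where "h = min d x0 / 2"
    have h: "0 < h" "h < d" "h < x0" using d x0 by (auto simp: h_def)
    have "vel w (x0 - h) > vel w x0"
    proof (rule DERIV_neg_imp_decreasing_open[of "x0 - h" x0 "vel w"])
      fix x assume x: "x0 - h < x" "x < x0"
      have "dV (x0 - (x0 - x)) < dV x0"
        using d(2) x h by (intro d(2)[rule_format]) auto
      then have "dV x < 0" using dV0 by simp
      moreover have "(vel w has_real_derivative dV x) (at x)"
        unfolding dV_def by (rule sol_vel_deriv[OF sol]) (use x h x0 in auto)
      ultimately show "\<exists>y. (vel w has_real_derivative y) (at x) \<and> y < 0" by blast
    qed (use h x0 in \<open>auto intro: continuous_on_subset[OF sol_continuous(2)[OF sol]]\<close>)
    then show False using neg[of "x0 - h"] h crit by simp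
  qed
qed

text \<open>While \<open>w\<close> does not decrease, the ratio grows and stays above \<open>\<alpha>\<close>; a next critical point would be
  reached with positive second derivative, that is, from negative velocity.\<close>

lemma vel_pos_after_critical:
  assumes sol: "sol w X" and x0: "0 < x0" "x0 < X" and crit: "vel w x0 = 0"
    and r0: "alp < ratio w x0" and x: "x0 < x" "x < X"
  shows "0 < vel w x"
proof (rule ccontr)
  assume "\<not> 0 < vel w x"
  have "0 < w x0 powr n * (ratio w x0 - alp)"
    using r0 sol_D(2)[OF sol, of x0] x0 by simp
  from DERIV_pos_inc_right[OF vel_deriv_at_critical[OF sol x0 crit] this] obtain d where d: "0 < d"
      "\<forall>h>0. h < d \<longrightarrow> vel w x0 < vel w (x0 + h)" by blast
  define a where "a = x0 + min d (x - x0) / 2"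
  have a: "x0 < a" "a < x0 + d" "a < x" using d x by (auto simp: a_def min_def field_simps)
  have pos: "0 < vel w y" if "x0 < y" "y \<le> a" for y
    using d(2)[rule_format, of "y - x0"] that a crit by auto
  obtain c where c: "a < c" "c \<le> x" "- vel w c = 0" "\<And>y. a \<le> y \<Longrightarrow> y < c \<Longrightarrow> - vel w y < 0"
  proof (rule first_zero[of a x "\<lambda>y. - vel w y"])
    show "continuous_on {a..x} (\<lambda>y. - vel w y)"
      using a x x0 by (intro continuous_on_minus continuous_on_subset[OF sol_continuous(2)[OF sol]]) auto
  qed (use pos[of a] a \<open>\<not> 0 < vel w x\<close> in auto)
  have pos': "0 < vel w y" if "x0 < y" "y < c" for y
    using pos[of y] c(4)[of y] that by (cases "y \<le> a") auto
  have "w x0 \<le> w c"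
  proof (rule DERIV_nonneg_imp_increasing_open[of x0 c w])
    fix y assume y: "x0 < y" "y < c"
    then show "\<exists>z. (w has_real_derivative z) (at y) \<and> 0 \<le> z"
      using sol_deriv[OF sol, of y] pos'[OF y] x0 c x by (intro exI[of _ "vel w y"]) auto
  qed (use a c x0 x in \<open>auto intro: continuous_on_subset[OF sol_D(1)[OF sol]]\<close>)
  moreover have "0 < w x0" using sol_D(2)[OF sol] x0 by auto
  ultimately have "ratio w x0 \<le> ratio w c"
    unfolding ratio_def using a c x0 sigma_pos nq by (intro mult_mono powr_mono2) auto
  then have rc: "0 < w c powr n * (ratio w c - alp)"
    using r0 sol_D(2)[OF sol, of c] a c x0 x by simp
  have "(vel w has_real_derivative w c powr n * (ratio w c - alp)) (at c)"
    by (rule vel_deriv_at_critical[OF sol]) (use a c x0 x in auto)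
  from DERIV_pos_inc_left[OF this rc] obtain e where e: "0 < e"
    "\<forall>h>0. h < e \<longrightarrow> vel w (c - h) < vel w c" by blast
  define h where "h = min e (c - a) / 2"
  have h: "0 < h" "h < e" "h < c - a" using e c by (auto simp: h_def min_def)
  show False using e(2)[rule_format, OF h(1,2)] c(3) c(4)[of "c - h"] h by auto
qed

end

section \<open>The family of maximal profiles\<close>

text \<open>Here \<open>v a\<close> is the profile with initial value \<open>a\<close> on its maximal interval \<open>[0, R a)\<close>. By uniqueness,
  maximality amounts to saying that no solution with the same initial value lives on a closed interval
  reaching beyond \<open>R a\<close>.\<close>

locale shooting_family = shooting +
  fixes v :: "real \<Rightarrow> real \<Rightarrow> real" and R :: "real \<Rightarrow> ereal"
  assumes R_pos: "0 < a \<Longrightarrow> 0 < R a"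
    and v_0: "0 < a \<Longrightarrow> v a 0 = a"
    and v_sol: "0 < a \<Longrightarrow> 0 \<le> X \<Longrightarrow> ereal X < R a \<Longrightarrow> sol (v a) X"
    and maximal: "0 < a \<Longrightarrow> sol w X \<Longrightarrow> w 0 = a \<Longrightarrow> ereal X \<le> R a"
begin

lemma room_to_the_right:
  assumes "ereal x < R a"
  obtains X where "x < X" "ereal X < R a"
  using ereal_dense2[OF assms] by auto

lemma below_R: "ereal y < R a \<Longrightarrow> x \<le> y \<Longrightarrow> ereal x < R a"
  by (metis ereal_less_eq(3) order_le_less_trans)

lemma v_pos: "0 < a \<Longrightarrow> 0 \<le> x \<Longrightarrow> ereal x < R a \<Longrightarrow> 0 < v a x"
  using sol_D(2)[OF v_sol] by blast

lemma v_continuous: "0 < a \<Longrightarrow> ereal X < R a \<Longrightarrow> 0 \<le> s \<Longrightarrow> continuous_on {s..X} (v a)"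
  using continuous_on_subset[OF sol_D(1)[OF v_sol[of a X]], of "{s..X}"] by (cases "0 \<le> X") auto

lemma v_deriv: "0 < a \<Longrightarrow> 0 < x \<Longrightarrow> ereal x < R a \<Longrightarrow> (v a has_real_derivative vel (v a) x) (at x)"
  by (metis room_to_the_right order_less_trans less_imp_le sol_deriv v_sol)

lemma v_strict_decreasing:
  assumes "0 < a" "0 \<le> s" "s < t" "ereal t < R a" "\<And>x. s < x \<Longrightarrow> x < t \<Longrightarrow> vel (v a) x < 0"
  shows "v a t < v a s"
proof (rule DERIV_neg_imp_decreasing_open[OF assms(3), of "v a"])
  fix x assume x: "s < x" "x < t"
  then show "\<exists>y. (v a has_real_derivative y) (at x) \<and> y < 0"
    using v_deriv[OF assms(1), of x] assms x below_R[OF assms(4), of x] by auto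
qed (rule v_continuous[OF assms(1,4,2)])

lemma v_strict_increasing:
  assumes "0 < a" "0 \<le> s" "s < t" "ereal t < R a" "\<And>x. s < x \<Longrightarrow> x < t \<Longrightarrow> 0 < vel (v a) x"
  shows "v a s < v a t"
proof (rule DERIV_pos_imp_increasing_open[OF assms(3), of "v a"])
  fix x assume x: "s < x" "x < t"
  then show "\<exists>y. (v a has_real_derivative y) (at x) \<and> 0 < y"
    using v_deriv[OF assms(1), of x] assms x below_R[OF assms(4), of x] by auto
qed (rule v_continuous[OF assms(1,4,2)])

definition turns :: "real \<Rightarrow> bool" where
  "turns a \<longleftrightarrow> (\<exists>x>0. ereal x < R a \<and> 0 \<le> vel (v a) x)"

lemma turning_point:
  assumes a: "0 < a" and "turns a"
  obtains x0 where "0 < x0" "ereal x0 < R a" "alp < ratio (v a) x0"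
    "\<And>x. 0 < x \<Longrightarrow> x < x0 \<Longrightarrow> vel (v a) x < 0"
    "\<And>x. x0 < x \<Longrightarrow> ereal x < R a \<Longrightarrow> 0 < vel (v a) x"
proof -
  obtain x1 where x1: "0 < x1" "ereal x1 < R a" "0 \<le> vel (v a) x1"
    using assms by (auto simp: turns_def)
  obtain X where X: "x1 < X" "ereal X < R a" using room_to_the_right[OF x1(2)] .
  have sol: "sol (v a) X" using v_sol[OF a, of X] X x1 by simp
  obtain d where d: "0 < d" "d \<le> X" "\<And>x. 0 < x \<Longrightarrow> x \<le> d \<Longrightarrow> vel (v a) x < 0"
    using vel_neg_near_0[OF sol] X x1 by (metis order_less_trans)
  have dx: "d < x1" using d(3)[of x1] x1 by (meson not_le not_less)
  obtain x0 where x0: "d < x0" "x0 \<le> x1" "vel (v a) x0 = 0" "\<And>x. d \<le> x \<Longrightarrow> x < x0 \<Longrightarrow> vel (v a) x < 0"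
  proof (rule first_zero[of d x1 "vel (v a)"])
    show "continuous_on {d..x1} (vel (v a))"
      using continuous_on_subset[OF sol_continuous(2)[OF sol]] d X by auto
  qed (use d dx x1 in auto)
  have neg: "vel (v a) x < 0" if "0 < x" "x < x0" for x
    using d(3)[of x] x0(4)[of x] that by (cases "x \<le> d") auto
  have x0p: "0 < x0" "x0 < X" "ereal x0 < R a" using x0 d X below_R[OF x1(2)] by auto
  have r: "alp < ratio (v a) x0"
    by (rule ratio_at_first_critical[OF sol x0p(1,2) x0(3) neg])
  show thesis
  proof (rule that[OF x0p(1,3) r neg])
    fix x assume x: "x0 < x" "ereal x < R a"
    obtain Y where Y: "x < Y" "ereal Y < R a" using room_to_the_right[OF x(2)] .
    show "0 < vel (v a) x"
      by (rule vel_pos_after_critical[OF v_sol[OF a _ Y(2)] x0p(1) _ x0(3) r x(1) Y(1)])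
         (use x Y x0p in auto)
  qed
qed

lemma turning_min:
  assumes a: "0 < a" and t: "turns a"
  obtains x0 where "0 < x0" "ereal x0 < R a"
    "\<And>s t. 0 \<le> s \<Longrightarrow> s < t \<Longrightarrow> t \<le> x0 \<Longrightarrow> v a t < v a s"
    "\<And>s t. x0 \<le> s \<Longrightarrow> s < t \<Longrightarrow> ereal t < R a \<Longrightarrow> v a s < v a t"
    "\<And>x. 0 \<le> x \<Longrightarrow> ereal x < R a \<Longrightarrow> x \<noteq> x0 \<Longrightarrow> v a x0 < v a x"
proof -
  obtain x0 where x0: "0 < x0" "ereal x0 < R a" "alp < ratio (v a) x0"
    "\<And>x. 0 < x \<Longrightarrow> x < x0 \<Longrightarrow> vel (v a) x < 0"
    "\<And>x. x0 < x \<Longrightarrow> ereal x < R a \<Longrightarrow> 0 < vel (v a) x"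
    using turning_point[OF assms] by blast
  have 1: "v a t < v a s" if "0 \<le> s" "s < t" "t \<le> x0" for s t
    by (rule v_strict_decreasing[OF a that(1,2)]) (use that x0 below_R[OF x0(2)] in auto)
  have 2: "v a s < v a t" if "x0 \<le> s" "s < t" "ereal t < R a" for s t
    by (rule v_strict_increasing[OF a _ that(2,3)]) (use that x0 below_R[OF that(3)] in auto)
  show thesis by (rule that[OF x0(1,2) 1 2]) (use 1 2 x0 in \<open>auto simp: neq_iff\<close>)
qed

lemma not_turns_decreasing:
  assumes "0 < a" "\<not> turns a" "0 \<le> s" "s < t" "ereal t < R a"
  shows "v a t < v a s"
  by (rule v_strict_decreasing[OF assms(1,3-5)])
     (use assms below_R[OF assms(5)] in \<open>force simp: turns_def not_le\<close>)

lemma not_turns_le: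
  assumes "0 < a" "\<not> turns a" "0 \<le> t" "ereal t < R a"
  shows "v a t \<le> a"
  using not_turns_decreasing[OF assms(1,2), of 0 t] v_0[OF assms(1)] assms(3,4) by (cases "t = 0") auto

lemma eq_truncated:
  assumes "0 < a" "tsol M w X" "\<And>x. 0 \<le> x \<Longrightarrow> x \<le> X \<Longrightarrow> w x \<le> M" "0 \<le> M" "w 0 = a"
    "0 \<le> y" "y \<le> X" "ereal y < R a"
  shows "v a y = w y"
proof (rule sol_eq_tsol[OF tsol_mono[OF assms(2,7)] _ assms(4) v_sol[OF assms(1,6,8)] _ assms(6) order_refl])
  show "v a 0 = w 0" using assms(1,5) v_0 by simp
qed (use assms(3,7) in auto)

text \<open>A profile cannot stop at a finite radius while it stays in a compact part of the positive
  half-line: the truncated solution continues it.\<close>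

lemma finite_end_unbounded:
  assumes a: "0 < a" and r: "R a = ereal r" and c: "0 < c"
    and bd: "\<And>x. 0 \<le> x \<Longrightarrow> x < r \<Longrightarrow> c \<le> v a x \<and> v a x \<le> M"
  shows False
proof -
  have r0: "0 < r" using R_pos[OF a] r by simp
  have M: "c \<le> M" using bd[of 0] r0 by linarith
  obtain w where w: "tsol (M + 1) w (r + 1)" "w 0 = a"
    using tsol_exists[of "M + 1" "r + 1" a] M c r0 by auto
  have eq: "v a x = w x" if "0 \<le> x" "x < r" for x
  proof (rule tsol_unique[of "M + 1" "v a" x w x])
    show "tsol (M + 1) (v a) x"
      by (rule sol_imp_tsol[OF v_sol[OF a that(1)]]) (use bd that r in force)+
    show "tsol (M + 1) w x" by (rule tsol_mono[OF w(1)]) (use that in auto)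
  qed (use that M c w v_0[OF a] in auto)
  define e where "e = min (c / 4) (1 / 4)"
  have e: "0 < e" "e \<le> c / 4" "e \<le> 1 / 4" using c by (auto simp: e_def)
  have "continuous_on {0..r + 1} w" using w by (simp add: tsol_def)
  then have "\<exists>d>0. \<forall>x\<in>{0..r + 1}. dist x r < d \<longrightarrow> dist (w x) (w r) < e"
    unfolding continuous_on_iff using r0 e(1) by (metis atLeastAtMost_iff less_add_one less_imp_le)
  then obtain d where d: "0 < d" "\<And>x. 0 \<le> x \<Longrightarrow> x \<le> r + 1 \<Longrightarrow> \<bar>x - r\<bar> < d \<Longrightarrow> \<bar>w x - w r\<bar> < e"
    by (auto simp: dist_real_def)
  define h where "h = min (min d r) 1 / 2"
  have h: "0 < h" "h < d" "h < r" "h < 1" using d r0 by (auto simp: h_def)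
  have "\<bar>w (r - h) - w r\<bar> < e" using h r0 by (intro d(2)) auto
  moreover have "c \<le> w (r - h)" "w (r - h) \<le> M"
    using bd[of "r - h"] eq[of "r - h"] h by auto
  ultimately have wr: "c - e < w r" "w r < M + e" by linarith+
  have "sol w (r + h)"
  proof (rule tsol_imp_sol)
    show "tsol (M + 1) w (r + h)" by (rule tsol_mono[OF w(1)]) (use h in auto)
    fix x assume x: "0 \<le> x" "x \<le> r + h"
    have "w x \<le> M + 1 \<and> 0 < w x"
    proof (cases "x < r")
      case True
      then show ?thesis using bd[OF x(1)] eq[OF x(1)] c by auto
    next
      case False
      then have "\<bar>w x - w r\<bar> < e" using x h by (intro d(2)) auto
      then show ?thesis using wr e c by linarith
    qed
    then show "w x \<le> M + 1" "0 < w x" by auto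
  qed
  from maximal[OF a this w(2)] r h show False by simp
qed

text \<open>A profile turns if and only if it takes a larger value at some later radius, and such a strict
  inequality survives small changes of the initial value. Closeness of the truncated solutions also
  keeps them positive, which shows that the nearby profiles live long enough.\<close>

lemma turns_open:
  assumes a0: "0 < a0" and t: "turns a0"
  obtains d where "0 < d" "\<And>a. 0 < a \<Longrightarrow> \<bar>a - a0\<bar> < d \<Longrightarrow> turns a"
proof -
  obtain x0 where x0: "0 < x0" "ereal x0 < R a0"
    "\<And>s t. 0 \<le> s \<Longrightarrow> s < t \<Longrightarrow> t \<le> x0 \<Longrightarrow> v a0 t < v a0 s"
    "\<And>s t. x0 \<le> s \<Longrightarrow> s < t \<Longrightarrow> ereal t < R a0 \<Longrightarrow> v a0 s < v a0 t"
    "\<And>x. 0 \<le> x \<Longrightarrow> ereal x < R a0 \<Longrightarrow> x \<noteq> x0 \<Longrightarrow> v a0 x0 < v a0 x"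
    using turning_min[OF assms] by blast
  obtain x2 where x2: "x0 < x2" "ereal x2 < R a0" using room_to_the_right[OF x0(2)] .
  obtain x3 where x3: "x2 < x3" "ereal x3 < R a0" using room_to_the_right[OF x2(2)] .
  have lt: "v a0 x0 < v a0 x2" by (rule x0(4)) (use x2 in auto)
  have x3p: "0 \<le> x3" using x0 x2 x3 by auto
  have sol: "sol (v a0) x3" by (rule v_sol[OF a0 x3p x3(2)])
  obtain B where B: "0 < B" "\<And>x. 0 \<le> x \<Longrightarrow> x \<le> x3 \<Longrightarrow> v a0 x \<le> B"
    using cont_bounded_above[OF sol_D(1)[OF sol]] by blast
  have "\<exists>y\<in>{0..x3}. \<forall>x\<in>{0..x3}. v a0 y \<le> v a0 x"
    by (rule continuous_attains_inf) (use x3p sol_D(1)[OF sol] in auto)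
  then obtain c where c: "0 < c" "\<And>x. 0 \<le> x \<Longrightarrow> x \<le> x3 \<Longrightarrow> c \<le> v a0 x"
    using sol_D(2)[OF sol] by (metis atLeastAtMost_iff)
  have M: "0 \<le> B + 1" using B by simp
  have ts0: "tsol (B + 1) (v a0) x3" by (rule sol_imp_tsol[OF sol]) (use B(2) in force)
  obtain K where K: "0 < K" "\<And>w1 w2 x. tsol (B + 1) w1 x3 \<Longrightarrow> tsol (B + 1) w2 x3 \<Longrightarrow> 0 \<le> x \<Longrightarrow> x \<le> x3 \<Longrightarrow>
      \<bar>w1 x - w2 x\<bar> \<le> K * \<bar>w1 0 - w2 0\<bar>"
    using tsol_stable[OF M x3p] by blast
  define e where "e = min (c / 2) (min 1 ((v a0 x2 - v a0 x0) / 3))"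
  have e: "0 < e" using c lt by (simp add: e_def)
  have e': "e \<le> c / 2" "e \<le> 1" "e \<le> (v a0 x2 - v a0 x0) / 3"
    unfolding e_def by (intro min.coboundedI1 min.coboundedI2 order_refl)+
  show thesis
  proof (rule that[of "e / K"])
    fix a assume a: "0 < a" "\<bar>a - a0\<bar> < e / K"
    obtain w where w: "tsol (B + 1) w x3" "w 0 = a" using tsol_exists[OF M x3p] .
    have close: "\<bar>w x - v a0 x\<bar> < e" if "0 \<le> x" "x \<le> x3" for x
    proof -
      have "\<bar>w x - v a0 x\<bar> \<le> K * \<bar>a - a0\<bar>"
        using K(2)[OF w(1) ts0 that] w(2) v_0[OF a0] by simp
      also have "\<dots> < e" using a K(1) by (simp add: pos_less_divide_eq mult.commute)
      finally show ?thesis .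
    qed
    have wb: "w x \<le> B + 1" "0 < w x" if "0 \<le> x" "x \<le> x3" for x
      using close[OF that] B(2)[OF that] c(2)[OF that] c(1) e e' by linarith+
    have "ereal x3 \<le> R a" by (rule maximal[OF a(1) tsol_imp_sol[OF w(1) wb] w(2)])
    then have R: "ereal x2 < R a" using x3(1) by (metis ereal_less(2) less_ereal.simps(1) order_less_le_trans)
    have eq: "v a x = w x" if "0 \<le> x" "x \<le> x2" for x
      by (rule eq_truncated[OF a(1) w(1) wb(1) M w(2)]) (use that x3 below_R[OF R] in auto)
    have "v a x0 < v a x2"
      using close[of x0] close[of x2] eq[of x0] eq[of x2] e e' lt x0 x2 x3 by (simp add: abs_less_iff)
    then show "turns a"
      using not_turns_decreasing[OF a(1), of x0 x2] x0 x2 R by (metis less_imp_le not_less_iff_gr_or_eq)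
  qed (use e K in auto)
qed

end

lemma le_powr_of_root_le:
  fixes Z s a :: real
  assumes "0 < s" "0 < Z" "Z powr (1 / s) \<le> a"
  shows "Z \<le> a powr s"
proof -
  have "Z = (Z powr (1 / s)) powr s" using assms by (simp add: powr_powr)
  also have "\<dots> \<le> a powr s" using assms by (intro powr_mono2) auto
  finally show ?thesis .
qed

context shooting_family
begin

section \<open>Small initial values\<close>

lemma decreasing_le:
  assumes "0 < a" "ereal x < R a" "\<And>y. 0 < y \<Longrightarrow> y < x \<Longrightarrow> vel (v a) y < 0" "0 \<le> y" "y \<le> x"
  shows "v a y \<le> a"
proof (cases "y = 0")
  case False
  then have "v a y < v a 0"
    using assms below_R[OF assms(2,5)] by (intro v_strict_decreasing) auto
  then show ?thesis using v_0[OF assms(1)] by simp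
qed (use v_0[OF assms(1)] in auto)

text \<open>Dropping the absorption and bounding \<open>v\<close> by its initial value gives the largest possible inward flux;
  two integrations turn this into a parabola below the profile.\<close>

lemma flux_lower:
  assumes a: "0 < a" and x: "0 \<le> x" "ereal x < R a"
    and neg: "\<And>y. 0 < y \<Longrightarrow> y < x \<Longrightarrow> vel (v a) y < 0"
  shows "- eps * a powr n * x ^ (k + 1) \<le> flux (v a) x"
proof -
  obtain X where X: "x < X" "ereal X < R a" using room_to_the_right[OF x(2)] .
  have sol: "sol (v a) X" using v_sol[OF a _ X(2)] x X by simp
  let ?F = "\<lambda>x. flux (v a) x + eps * a powr n * x ^ (k + 1)"
  have "?F 0 \<le> ?F x"
  proof (rule DERIV_nonneg_imp_increasing_open[of 0 x ?F, OF x(1)])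
    fix y assume y: "0 < y" "y < x"
    have vy: "0 < v a y" "v a y \<le> a"
      using v_pos[OF a, of y] decreasing_le[OF a x(2) neg, of y] y below_R[OF x(2), of y] by auto
    have "(?F has_real_derivative y ^ k * (y powr \<sigma> * v a y powr q - eps * v a y powr n)
        + eps * a powr n * ((1 + real k) * y ^ k)) (at y)"
      using sol_flux_deriv[OF sol, of y] y X
      by (auto intro!: DERIV_add DERIV_cmult simp: DERIV_pow[of "Suc k", simplified])
    moreover have "0 \<le> y ^ k * (y powr \<sigma> * v a y powr q - eps * v a y powr n)
        + eps * a powr n * ((1 + real k) * y ^ k)"
    proof -
      have "v a y powr n \<le> a powr n" using vy n1 by (intro powr_mono2) auto
      then have "eps * v a y powr n \<le> eps * a powr n" using eps_pos by simp
      moreover have "0 \<le> eps * a powr n * real k" using eps_pos by simp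
      moreover have "0 \<le> y powr \<sigma> * v a y powr q" by simp
      ultimately have "0 \<le> y powr \<sigma> * v a y powr q - eps * v a y powr n + eps * a powr n * (1 + real k)"
        unfolding distrib_left mult_1_right by linarith
      then have "0 \<le> y ^ k * (y powr \<sigma> * v a y powr q - eps * v a y powr n + eps * a powr n * (1 + real k))"
        using y by simp
      then show ?thesis by (simp add: algebra_simps)
    qed
    ultimately show "\<exists>z. (?F has_real_derivative z) (at y) \<and> 0 \<le> z" by blast
  next
    show "continuous_on {0..x} ?F"
      using X by (intro continuous_on_add continuous_on_subset[OF sol_continuous(1)[OF sol]] continuous_intros) auto
  qed
  then show ?thesis by simp
qed

lemma eps_le: "eps + \<beta> \<le> alp"
  using beta_pos by (simp add: eps_def algebra_simps)

lemma profile_lower: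
  assumes a: "0 < a" and x: "0 \<le> x" "ereal x < R a"
    and neg: "\<And>y. 0 < y \<Longrightarrow> y < x \<Longrightarrow> vel (v a) y < 0"
  shows "a - alp * a powr n * x\<^sup>2 / 2 \<le> v a x"
proof -
  let ?F = "\<lambda>x. v a x + alp * a powr n * x\<^sup>2 / 2"
  have "?F 0 \<le> ?F x"
  proof (rule DERIV_nonneg_imp_increasing_open[of 0 x ?F, OF x(1)])
    fix y assume y: "0 < y" "y < x"
    have yR: "ereal y < R a" using below_R[OF x(2), of y] y by simp
    have vy: "0 < v a y" "v a y \<le> a"
      using v_pos[OF a, of y] decreasing_le[OF a x(2) neg, of y] y yR by auto
    have "(?F has_real_derivative vel (v a) y + alp * a powr n * y) (at y)"
      using v_deriv[OF a y(1) yR] by (auto intro!: derivative_eq_intros)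
    moreover have "0 \<le> vel (v a) y + alp * a powr n * y"
    proof -
      have "- eps * a powr n * y ^ (k + 1) \<le> flux (v a) y"
        by (rule flux_lower[OF a _ yR]) (use y neg in auto)
      then have "- eps * a powr n * y \<le> flux (v a) y / y ^ k"
        using y by (simp add: pos_le_divide_eq mult_ac)
      moreover have "\<beta> * y * v a y powr n \<le> \<beta> * y * a powr n"
        using beta_pos y vy n1 by (intro mult_left_mono powr_mono2) auto
      ultimately have "- (eps + \<beta>) * (a powr n * y) \<le> vel (v a) y"
        by (simp add: vel_def algebra_simps)
      moreover have "(eps + \<beta>) * (a powr n * y) \<le> alp * (a powr n * y)"
        using y by (intro mult_right_mono eps_le) auto
      ultimately show ?thesis by (simp add: algebra_simps)
    qed
    ultimately show "\<exists>z. (?F has_real_derivative z) (at y) \<and> 0 \<le> z" by blast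
  next
    show "continuous_on {0..x} ?F"
      using v_continuous[OF a x(2), of 0] by (intro continuous_on_add continuous_intros) auto
  qed
  then show ?thesis using v_0[OF a] by simp
qed

text \<open>The radius at which the parabola \<open>a - \<alpha> a^n x^2 / 2\<close> has dropped to \<open>a / 2\<close>.\<close>

definition half_radius :: "real \<Rightarrow> real" where
  "half_radius a = (a powr (1 - n) / alp) powr (1 / 2)"

lemma half_radius_pos: "0 < a \<Longrightarrow> 0 < half_radius a"
  using alp_pos by (simp add: half_radius_def)

lemma half_radius_sq: "0 < a \<Longrightarrow> alp * a powr n * (half_radius a)\<^sup>2 = a"
proof -
  assume a: "0 < a"
  have "(half_radius a)\<^sup>2 = a powr (1 - n) / alp"
    using alp_pos a by (simp add: half_radius_def powr_half_sqrt)
  then show ?thesis using a alp_pos by (simp flip: powr_add)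
qed

lemma above_half:
  assumes a: "0 < a" and x: "0 \<le> x" "x \<le> half_radius a" "ereal x < R a"
    and neg: "\<And>y. 0 < y \<Longrightarrow> y < x \<Longrightarrow> vel (v a) y < 0"
  shows "a / 2 \<le> v a x"
proof -
  have "alp * a powr n * x\<^sup>2 \<le> alp * a powr n * (half_radius a)\<^sup>2"
    using x alp_pos by (intro mult_left_mono power_mono) auto
  then show ?thesis using half_radius_sq[OF a] profile_lower[OF a x(1,3) neg] by linarith
qed

text \<open>If the profile did not turn, it would lie between \<open>a / 2\<close> and \<open>a\<close> up to the half radius \<open>X\<close>, where
  absorption compares with the linear terms like \<open>X^\<sigma> a^(q-n)\<close>. This is a constant times \<open>a^(- \<rho>)\<close>
  with \<open>\<rho> > 0\<close> by \<open>\<sigma> > \<sigma>_*\<close>, so for small \<open>a\<close> the velocity at \<open>X\<close> would be positive.\<close>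

lemma turns_of_small:
  obtains \<delta> where "0 < \<delta>" "\<And>a. 0 < a \<Longrightarrow> a < \<delta> \<Longrightarrow> turns a"
proof -
  define \<rho> where "\<rho> = \<sigma> * (n - 1) / 2 - (q - n)"
  have \<rho>: "0 < \<rho>" using supercritical by (simp add: \<rho>_def)
  define s where "s = \<sigma> + real k + 1"
  have s: "0 < s" using sigma_pos by (simp add: s_def)
  define Q where "Q = alp * 2 powr q * s * alp powr (\<sigma> / 2)"
  have Q: "0 < Q" using alp_pos s by (simp add: Q_def)
  show thesis
  proof (rule that[of "Q powr (- (1 / \<rho>))"])
    show "0 < Q powr (- (1 / \<rho>))" using Q by simp
    fix a assume a: "0 < a" "a < Q powr (- (1 / \<rho>))"
    have aQ: "Q < a powr (- \<rho>)"
    proof -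
      have "Q = (Q powr (- (1 / \<rho>))) powr (- \<rho>)" using Q \<rho> by (simp add: powr_powr)
      also have "\<dots> < a powr (- \<rho>)" using a \<rho> by (intro powr_less_mono2_neg) auto
      finally show ?thesis .
    qed
    define X where "X = half_radius a"
    have X: "0 < X" using half_radius_pos a by (simp add: X_def)
    show "turns a"
    proof (rule ccontr)
      assume nt: "\<not> turns a"
      have neg: "vel (v a) y < 0" if "0 < y" "ereal y < R a" for y
        using nt that by (auto simp: turns_def not_le)
      have half: "a / 2 \<le> v a x \<and> v a x \<le> a" if "0 \<le> x" "x \<le> X" "ereal x < R a" for x
        using above_half[OF a(1) that(1) that(2)[unfolded X_def] that(3)] not_turns_le[OF a(1) nt that(1,3)]
          neg below_R[OF that(3)] by auto
      have XR: "ereal X < R a"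
      proof (rule ccontr)
        assume "\<not> ereal X < R a"
        then obtain r where r: "R a = ereal r" "r \<le> X"
          using R_pos[OF a(1)] by (cases "R a") auto
        show False
          by (rule finite_end_unbounded[OF a(1) r(1), of "a / 2" a]) (use half r a in auto)
      qed
      obtain Y where Y: "X < Y" "ereal Y < R a" using room_to_the_right[OF XR] .
      have sol: "sol (v a) Y" using v_sol[OF a(1) _ Y(2)] X Y by simp
      let ?F = "\<lambda>x. flux (v a) x + eps * a powr n * x ^ (k + 1) - (a / 2) powr q * (x powr s / s)"
      have "?F 0 \<le> ?F X"
      proof (rule DERIV_nonneg_imp_increasing_open[of 0 X ?F])
        fix y assume y: "0 < y" "y < X"
        have yR: "ereal y < R a" using below_R[OF XR, of y] y by simp
        have vy: "a / 2 \<le> v a y" "v a y \<le> a" using half[of y] y yR by auto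
        have ps: "((\<lambda>x. x powr s / s) has_real_derivative y powr \<sigma> * y ^ k) (at y)"
        proof -
          have "((\<lambda>x. x powr s / s) has_real_derivative y powr (s - 1)) (at y)"
            using has_real_derivative_powr[OF y(1), of s] s by (auto dest: DERIV_cdivide[where c = s])
          moreover have "y powr (s - 1) = y powr \<sigma> * y ^ k"
            using y by (simp add: s_def powr_add powr_realpow)
          ultimately show ?thesis by simp
        qed
        have pk: "((\<lambda>x. x ^ (k + 1)) has_real_derivative (1 + real k) * y ^ k) (at y)"
          using DERIV_pow[of "Suc k" y UNIV] by simp
        have "(?F has_real_derivative y ^ k * (y powr \<sigma> * v a y powr q - eps * v a y powr n)
          + eps * a powr n * ((1 + real k) * y ^ k) - (a / 2) powr q * (y powr \<sigma> * y ^ k)) (at y)"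
          by (intro DERIV_add DERIV_diff DERIV_cmult ps pk sol_flux_deriv[OF sol]) (use y Y in auto)
        moreover have "0 \<le> y ^ k * (y powr \<sigma> * v a y powr q - eps * v a y powr n)
          + eps * a powr n * ((1 + real k) * y ^ k) - (a / 2) powr q * (y powr \<sigma> * y ^ k)"
        proof -
          have "v a y powr n \<le> a powr n" using vy n1 a by (intro powr_mono2) auto
          then have "eps * v a y powr n \<le> eps * a powr n" using eps_pos by simp
          moreover have "0 \<le> real k * (eps * a powr n)" using eps_pos by simp
          moreover have "y powr \<sigma> * (a / 2) powr q \<le> y powr \<sigma> * v a y powr q"
            using vy n1 nq a by (intro mult_left_mono powr_mono2) auto
          ultimately have "0 \<le> y powr \<sigma> * v a y powr q - eps * v a y powr n
              + eps * a powr n * (1 + real k) - (a / 2) powr q * y powr \<sigma>"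
            by (simp add: algebra_simps)
          then have "0 \<le> y ^ k * (y powr \<sigma> * v a y powr q - eps * v a y powr n
              + eps * a powr n * (1 + real k) - (a / 2) powr q * y powr \<sigma>)"
            using y by simp
          then show ?thesis by (simp add: algebra_simps)
        qed
        ultimately show "\<exists>z. (?F has_real_derivative z) (at y) \<and> 0 \<le> z" by blast
      next
        have "continuous_on {0..X} (\<lambda>x. x powr s)"
          by (rule continuous_on_powr'[OF continuous_on_id continuous_on_const]) (use s in auto)
        then show "continuous_on {0..X} ?F"
          using Y s by (intro continuous_on_add continuous_on_diff continuous_on_mult continuous_on_divide
              continuous_on_subset[OF sol_continuous(1)[OF sol]] continuous_on_const continuous_on_power continuous_on_id) auto
      qed (use X in simp)
      then have F: "(a / 2) powr q * (X powr s / s) - eps * a powr n * X ^ (k + 1) \<le> flux (v a) X" by simp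
      have Xs: "X powr s = X powr \<sigma> * X * X ^ k"
        using X by (simp add: s_def powr_add powr_realpow)
      have "(X * ((a / 2) powr q * X powr \<sigma> / s - eps * a powr n)) * X ^ k \<le> flux (v a) X"
        using F unfolding Xs by (simp add: algebra_simps)
      then have "X * ((a / 2) powr q * X powr \<sigma> / s - eps * a powr n) \<le> flux (v a) X / X ^ k"
        using X by (simp add: pos_le_divide_eq)
      moreover have "\<beta> * X * v a X powr n \<le> \<beta> * X * a powr n"
        using beta_pos X half[of X] XR n1 a by (intro mult_left_mono powr_mono2) auto
      ultimately have "X * ((a / 2) powr q * X powr \<sigma> / s - (eps + \<beta>) * a powr n) \<le> vel (v a) X"
        by (simp add: vel_def algebra_simps)
      moreover have "0 \<le> X * ((a / 2) powr q * X powr \<sigma> / s - (eps + \<beta>) * a powr n)"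
      proof -
        have "(eps + \<beta>) * a powr n \<le> alp * a powr n" by (intro mult_right_mono eps_le) auto
        also have "alp = Q * (1 / (2 powr q * s * alp powr (\<sigma> / 2)))"
          using s alp_pos by (simp add: Q_def)
        also have "Q * (1 / (2 powr q * s * alp powr (\<sigma> / 2))) * a powr n
            \<le> a powr (- \<rho>) * (1 / (2 powr q * s * alp powr (\<sigma> / 2))) * a powr n"
          using aQ s alp_pos by (intro mult_right_mono) auto
        also have "\<dots> = (a / 2) powr q * X powr \<sigma> / s"
        proof -
          have "X powr \<sigma> = a powr ((1 - n) * \<sigma> / 2) / alp powr (\<sigma> / 2)"
            using a alp_pos by (simp add: X_def half_radius_def powr_powr powr_divide)
          moreover have "a powr (- \<rho>) * a powr n = a powr q * a powr ((1 - n) * \<sigma> / 2)"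
          proof -
            have "- \<rho> + n = q + (1 - n) * \<sigma> / 2" by (simp add: \<rho>_def field_simps)
            then show ?thesis by (metis powr_add)
          qed
          ultimately show ?thesis using a by (simp add: powr_divide field_simps)
        qed
        finally show ?thesis using X by simp
      qed
      ultimately show False using neg[OF X XR] by linarith
    qed
  qed
qed

section \<open>Large initial values\<close>

text \<open>Before turning, the ratio must pass the value \<open>(\<alpha> - N \<beta>) / 2\<close>, first at \<open>x1\<close>, say. Up to \<open>x1\<close> the drift alone
  gives \<open>v^(1-n) \<ge> c x^2\<close>, a bound independent of \<open>a\<close>; inserted into the ratio it shows \<open>x1 \<ge> L\<close> for
  a radius \<open>L\<close> independent of \<open>a\<close>. On \<open>[0, L]\<close> the inward flux is at least a multiple of the mass, and the
  mass inside the half radius is of order \<open>a^s\<close> with \<open>s > 0\<close>. For large \<open>a\<close> this flux brings \<open>v\<close> from the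
  universal bound \<open>B\<close> at \<open>L / 2\<close> to a negative value at \<open>L\<close>.\<close>

lemma not_turns_of_large:
  obtains a where "0 < a" "\<not> turns a"
proof -
  define c where "c = (n - 1) * \<beta> / 2"
  have c: "0 < c" using n1 beta_pos by (simp add: c_def)
  define \<tau> where "\<tau> = \<sigma> - 2 * (q - n) / (n - 1)"
  have \<tau>: "0 < \<tau>" using supercritical n1 by (simp add: \<tau>_def field_simps)
  define Z where "Z = eps / 2 * c powr ((q - n) / (n - 1))"
  have Z: "0 < Z" using eps_pos c by (simp add: Z_def)
  \<comment> \<open>With \<open>v^(1-n) = c x^2\<close> the ratio would reach \<open>(\<alpha> - N \<beta>) / 2\<close> exactly at \<open>L\<close>.\<close>
  define L where "L = Z powr (1 / \<tau>)"
  have L: "0 < L" using Z by (simp add: L_def)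
  define B where "B = (c * (L / 2)\<^sup>2) powr (- (1 / (n - 1)))"
  have B: "0 < B" using c L by (simp add: B_def)
  define s where "s = n - (n - 1) * (real k + 1) / 2"
  have s: "0 < s" using fast_diffusion by (simp add: s_def field_simps)
  define C where "C = eps / 2 * (1 / 2) powr n / alp powr ((real k + 1) / 2) / (real k + 1)"
  have C: "0 < C" using eps_pos alp_pos by (simp add: C_def)
  \<comment> \<open>The first entry puts the half radius below \<open>L / 2\<close>; the second makes the flux \<open>C a^s\<close> large enough.\<close>
  define a where "a = max ((4 / (alp * L\<^sup>2)) powr (1 / (n - 1))) (((2 * B * L ^ k / L + 1) / C) powr (1 / s))"
  have p: "0 < 4 / (alp * L\<^sup>2)" using alp_pos L by simp
  then have "0 < (4 / (alp * L\<^sup>2)) powr (1 / (n - 1))" unfolding powr_gt_zero by linarith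
  then have a: "0 < a" unfolding a_def by (simp add: less_max_iff_disj)
  have a1: "4 / (alp * L\<^sup>2) \<le> a powr (n - 1)"
    by (rule le_powr_of_root_le[OF _ p]) (use n1 in \<open>auto simp: a_def\<close>)
  have "(2 * B * L ^ k / L + 1) / C \<le> a powr s"
    by (rule le_powr_of_root_le) (use s B L C in \<open>auto simp: a_def intro!: divide_pos_pos add_nonneg_pos\<close>)
  then have a2: "2 * B * L ^ k / L < C * a powr s"
    using C by (simp add: pos_divide_le_eq mult.commute)
  define Y where "Y = half_radius a"
  have Y: "0 < Y" using half_radius_pos a by (simp add: Y_def)
  have YL: "Y \<le> L / 2"
  proof (rule power2_le_imp_le)
    have "Y\<^sup>2 = a powr (1 - n) / alp"
      using alp_pos a by (simp add: Y_def half_radius_def powr_half_sqrt)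
    also have "\<dots> = 1 / (alp * a powr (n - 1))"
      using a by (simp add: powr_diff field_simps)
    also have "\<dots> \<le> 1 / (alp * (4 / (alp * L\<^sup>2)))"
    proof (rule frac_le[OF zero_le_one order_refl])
      show "0 < alp * (4 / (alp * L\<^sup>2))" using alp_pos L by simp
      show "alp * (4 / (alp * L\<^sup>2)) \<le> alp * a powr (n - 1)"
        by (rule mult_left_mono[OF a1 less_imp_le[OF alp_pos]])
    qed
    also have "\<dots> = (L / 2)\<^sup>2" using alp_pos L by (simp add: power_divide)
    finally show "Y\<^sup>2 \<le> (L / 2)\<^sup>2" .
  qed (use L in auto)
  have "\<not> turns a"
  proof
    assume "turns a"
    obtain x0 where x0: "0 < x0" "ereal x0 < R a" "alp < ratio (v a) x0"
      "\<And>x. 0 < x \<Longrightarrow> x < x0 \<Longrightarrow> vel (v a) x < 0"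
      "\<And>x. x0 < x \<Longrightarrow> ereal x < R a \<Longrightarrow> 0 < vel (v a) x"
      using turning_point[OF a \<open>turns a\<close>] by blast
    obtain X where X: "x0 < X" "ereal X < R a" using room_to_the_right[OF x0(2)] .
    have sol: "sol (v a) X" using v_sol[OF a _ X(2)] x0 X by simp
    obtain x1 where x1: "0 < x1" "x1 \<le> x0" "ratio (v a) x1 - eps / 2 = 0"
      "\<And>x. 0 \<le> x \<Longrightarrow> x < x1 \<Longrightarrow> ratio (v a) x - eps / 2 < 0"
    proof (rule first_zero[of 0 x0 "\<lambda>x. ratio (v a) x - eps / 2"])
      show "continuous_on {0..x0} (\<lambda>x. ratio (v a) x - eps / 2)"
        using X by (intro continuous_on_diff continuous_on_const continuous_on_subset[OF ratio_continuous[OF sol]]) auto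
      have "eps / 2 \<le> alp" using eps_le eps_pos beta_pos by linarith
      then show "0 \<le> ratio (v a) x0 - eps / 2" using x0 by simp
    qed (use eps_pos x0 in auto)
    have vp: "0 < v a x" if "0 \<le> x" "x \<le> x1" for x
      using sol_D(2)[OF sol, of x] that x1 X by auto
    have upper: "v a x \<le> (c * x\<^sup>2) powr (- (1 / (n - 1)))" if x: "0 < x" "x \<le> x1" for x
    proof -
      let ?F = "\<lambda>x. v a x powr (1 - n) - c * x\<^sup>2"
      have "?F 0 \<le> ?F x"
      proof (rule DERIV_nonneg_imp_increasing_open[of 0 x ?F])
        fix y assume y: "0 < y" "y < x"
        have vy: "0 < v a y" using vp[of y] y x by simp
        have dv: "(v a has_real_derivative vel (v a) y) (at y)"
          by (rule sol_deriv[OF sol]) (use y x x1 X in auto)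
        have "(?F has_real_derivative (1 - n) * v a y powr (- n) * vel (v a) y - 2 * c * y) (at y)"
          by (rule DERIV_cong, rule DERIV_diff[OF DERIV_fun_powr[OF dv vy] DERIV_cmult[OF DERIV_pow]]) simp
        moreover have "0 \<le> (1 - n) * v a y powr (- n) * vel (v a) y - 2 * c * y"
        proof -
          have "vel (v a) y \<le> - \<beta> * y * v a y powr n"
          proof (rule vel_le_of_ratio(1)[OF sol y(1)])
            fix u assume "0 < u" "u < y"
            then show "ratio (v a) u \<le> eps" using x1(4)[of u] y x eps_pos by auto
          qed (use y x x1 X in auto)
          then have "(n - 1) * v a y powr (- n) * vel (v a) y \<le> (n - 1) * v a y powr (- n) * (- \<beta> * y * v a y powr n)"
            using n1 by (intro mult_left_mono) auto
          also have "\<dots> = - 2 * c * y" using vy by (simp add: c_def powr_minus field_simps)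
          finally show ?thesis by (simp add: algebra_simps)
        qed
        ultimately show "\<exists>z. (?F has_real_derivative z) (at y) \<and> 0 \<le> z" by blast
      next
        have "continuous_on {0..x} (\<lambda>x. v a x powr (1 - n))"
          by (rule continuous_on_powr[OF continuous_on_subset[OF sol_D(1)[OF sol]] continuous_on_const])
             (use vp x x1 X in \<open>force+\<close>)
        then show "continuous_on {0..x} ?F" by (rule continuous_on_diff) (intro continuous_intros)
      qed (use x in simp)
      then have "a powr (1 - n) \<le> v a x powr (1 - n) - c * x\<^sup>2" using v_0[OF a] by simp
      then have "c * x\<^sup>2 \<le> v a x powr (1 - n)" using powr_ge_zero[of a "1 - n"] by linarith
      then have "(v a x powr (1 - n)) powr (- (1 / (n - 1))) \<le> (c * x\<^sup>2) powr (- (1 / (n - 1)))"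
        using c x n1 by (intro powr_mono2') auto
      moreover have "(v a x powr (1 - n)) powr (- (1 / (n - 1))) = v a x"
      proof -
        have "(1 - n) * (- (1 / (n - 1))) = 1" using n1 by (simp add: field_simps)
        then show ?thesis using vp[of x] x by (simp only: powr_powr powr_one less_imp_le)
      qed
      ultimately show ?thesis by simp
    qed
    have L1: "L \<le> x1"
    proof -
      have "eps / 2 = x1 powr \<sigma> * v a x1 powr (q - n)" using x1(3) by (simp add: ratio_def)
      also have "\<dots> \<le> x1 powr \<sigma> * ((c * x1\<^sup>2) powr (- (1 / (n - 1)))) powr (q - n)"
        using upper[of x1] vp[of x1] x1 nq by (intro mult_left_mono powr_mono2) auto
      also have "\<dots> = x1 powr \<tau> / c powr ((q - n) / (n - 1))"
      proof -
        define s' where "s' = (q - n) / (n - 1)"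
        have "((c * x1\<^sup>2) powr (- (1 / (n - 1)))) powr (q - n) = (c * x1\<^sup>2) powr (- s')"
          by (simp add: powr_powr s'_def)
        also have "\<dots> = c powr (- s') * (x1 powr 2) powr (- s')"
          using c x1 by (simp add: powr_mult)
        also have "(x1 powr 2) powr (- s') = x1 powr (- (2 * s'))"
          by (simp only: powr_powr) simp
        finally have "((c * x1\<^sup>2) powr (- (1 / (n - 1)))) powr (q - n) = c powr (- s') * x1 powr (- (2 * s'))" .
        moreover have "\<tau> = \<sigma> - 2 * s'" by (simp add: \<tau>_def s'_def)
        ultimately show ?thesis
          unfolding s'_def[symmetric] by (simp add: powr_diff powr_minus_divide)
      qed
      finally have "Z \<le> x1 powr \<tau>" using c by (simp add: Z_def pos_le_divide_eq)
      then have "L \<le> (x1 powr \<tau>) powr (1 / \<tau>)"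
        unfolding L_def using Z \<tau> by (intro powr_mono2) auto
      then show ?thesis using x1 \<tau> by (simp add: powr_powr)
    qed
    define Q where "Q = eps / 2 * (a / 2) powr n * (Y ^ (k + 1) / (real k + 1))"
    have dflux: "(flux (v a) has_real_derivative x ^ k * (v a x powr n * (ratio (v a) x - eps))) (at x)"
      and sflux: "x ^ k * (v a x powr n * (ratio (v a) x - eps)) \<le> - (eps / 2 * x ^ k * v a x powr n)"
      if "0 < x" "x < L" for x
    proof -
      show "(flux (v a) has_real_derivative x ^ k * (v a x powr n * (ratio (v a) x - eps))) (at x)"
        by (rule flux_deriv_ratio[OF sol]) (use that L1 x1 X in auto)
      have "(x ^ k * v a x powr n) * (ratio (v a) x - eps) \<le> (x ^ k * v a x powr n) * (- (eps / 2))"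
        using x1(4)[of x] that L1 by (intro mult_left_mono) auto
      then show "x ^ k * (v a x powr n * (ratio (v a) x - eps)) \<le> - (eps / 2 * x ^ k * v a x powr n)"
        by (simp add: algebra_simps)
    qed
    have cflux: "continuous_on {s..t} (flux (v a))" if "0 \<le> s" "t \<le> L" for s t
      using that L1 x1 X by (intro continuous_on_subset[OF sol_continuous(1)[OF sol]]) auto
    have fluxY: "flux (v a) Y \<le> - Q"
    proof -
      let ?F = "\<lambda>x. flux (v a) x + eps / 2 * (a / 2) powr n * (x ^ (k + 1) / (real k + 1))"
      have "?F Y \<le> ?F 0"
      proof (rule DERIV_nonpos_imp_decreasing_open[of 0 Y ?F])
        fix y assume y: "0 < y" "y < Y"
        have yL: "y < L" using y YL Y by simp
        have "a / 2 \<le> v a y"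
          by (rule above_half[OF a]) (use y yL L1 x1 x0 below_R[OF x0(2), of y] in \<open>auto simp: Y_def\<close>)
        then have "(a / 2) powr n \<le> v a y powr n" using a n1 by (intro powr_mono2) auto
        then have "eps / 2 * y ^ k * (a / 2) powr n \<le> eps / 2 * y ^ k * v a y powr n"
          using eps_pos y by (intro mult_left_mono) auto
        then have le: "y ^ k * (v a y powr n * (ratio (v a) y - eps))
            + eps / 2 * (a / 2) powr n * y ^ k \<le> 0"
          using sflux[OF y(1) yL] by (simp add: mult_ac)
        have "((\<lambda>x. x ^ (k + 1) / (real k + 1)) has_real_derivative y ^ k) (at y)"
          using DERIV_cdivide[OF DERIV_pow[of "Suc k" y UNIV], of "real k + 1"] by (simp add: add.commute)
        then have "(?F has_real_derivative y ^ k * (v a y powr n * (ratio (v a) y - eps))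
            + eps / 2 * (a / 2) powr n * y ^ k) (at y)"
          by (intro DERIV_add DERIV_cmult dflux) (use y yL in auto)
        then show "\<exists>z. (?F has_real_derivative z) (at y) \<and> z \<le> 0" using le by blast
      next
        show "continuous_on {0..Y} ?F"
          using cflux[of 0 Y] YL L by (intro continuous_on_add continuous_intros) auto
      qed (use Y in simp)
      then show ?thesis by (simp add: Q_def)
    qed
    have fluxQ: "flux (v a) x \<le> - Q" if x: "Y \<le> x" "x < L" for x
    proof -
      have "flux (v a) x \<le> flux (v a) Y"
      proof (rule DERIV_nonpos_imp_decreasing_open[of Y x "flux (v a)"])
        fix y assume y: "Y < y" "y < x"
        have "0 \<le> eps / 2 * y ^ k * v a y powr n" using eps_pos y Y by simp
        then show "\<exists>z. (flux (v a) has_real_derivative z) (at y) \<and> z \<le> 0"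
          using dflux[of y] sflux[of y] y x Y by (intro exI conjI) auto
      qed (use x Y cflux[of Y x] in auto)
      then show ?thesis using fluxY by simp
    qed
    have "Q = C * a powr s"
    proof -
      have "Y ^ (k + 1) = Y powr (real k + 1)" using Y by (simp add: powr_add powr_realpow)
      also have "\<dots> = a powr ((1 - n) * (real k + 1) / 2) / alp powr ((real k + 1) / 2)"
        using a alp_pos by (simp add: Y_def half_radius_def powr_powr powr_divide)
      finally have "Y ^ (k + 1) = a powr ((1 - n) * (real k + 1) / 2) / alp powr ((real k + 1) / 2)" .
      moreover have "a powr s = a powr n * a powr ((1 - n) * (real k + 1) / 2)"
      proof -
        have "s = n + (1 - n) * (real k + 1) / 2" by (simp add: s_def field_simps)
        then show ?thesis by (metis powr_add)
      qed
      moreover have "(a / 2) powr n = a powr n * (1 / 2) powr n"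
        using a by (simp add: powr_divide)
      ultimately show ?thesis by (simp add: Q_def C_def mult_ac)
    qed
    then have Qbig: "2 * B * L ^ k / L < Q" using a2 by simp
    have "0 < 2 * B * L ^ k / L" using B L by simp
    then have Q0: "0 < Q" using Qbig by (rule less_trans)
    let ?F = "\<lambda>x. v a x + Q / L ^ k * x"
    have "?F L \<le> ?F (L / 2)"
    proof (rule DERIV_nonpos_imp_decreasing_open[of "L / 2" L ?F])
      fix y assume y: "L / 2 < y" "y < L"
      have y0: "0 < y" using y L by simp
      have "vel (v a) y \<le> flux (v a) y / y ^ k"
        using beta_pos y0 by (simp add: vel_def)
      also have "\<dots> \<le> - Q / y ^ k" using fluxQ[of y] y YL y0 by (intro divide_right_mono) auto
      finally have "vel (v a) y \<le> - (Q / y ^ k)" by simp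
      moreover have "Q / L ^ k \<le> Q / y ^ k"
        by (rule divide_left_mono) (use Q0 y0 y in \<open>auto intro: power_mono\<close>)
      ultimately have le: "vel (v a) y + Q / L ^ k \<le> 0" by linarith
      have "(v a has_real_derivative vel (v a) y) (at y)"
        by (rule sol_deriv[OF sol]) (use y y0 L1 x1 X in auto)
      then have "(?F has_real_derivative vel (v a) y + Q / L ^ k) (at y)"
        by (rule DERIV_add[OF _ DERIV_cmult_Id])
      then show "\<exists>z. (?F has_real_derivative z) (at y) \<and> z \<le> 0" using le by blast
    next
      have "continuous_on {L / 2..L} (v a)"
        using L L1 x1 X by (intro continuous_on_subset[OF sol_D(1)[OF sol]]) auto
      then show "continuous_on {L / 2..L} ?F" by (intro continuous_on_add continuous_intros)
    qed (use L in simp)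
    moreover have "v a (L / 2) \<le> B" unfolding B_def by (rule upper) (use L L1 in auto)
    moreover have "0 < v a L" using vp[of L] L L1 by simp
    moreover have "Q / L ^ k * L = 2 * (Q / L ^ k * (L / 2))" by simp
    ultimately have "Q / L ^ k * (L / 2) < B" by linarith
    moreover have "B < Q / L ^ k * (L / 2)" using Qbig L by (simp add: field_simps)
    ultimately show False by simp
  qed
  then show thesis using a that by blast
qed

end

context shooting_family
begin

section \<open>The critical initial value\<close>

text \<open>The first initial value that does not turn: openness excludes that the supremum itself turns.\<close>

lemma critical_value:
  obtains a where "0 < a" "\<not> turns a" "\<And>b. 0 < b \<Longrightarrow> b < a \<Longrightarrow> turns b"
proof -
  define S where "S = {a. 0 < a \<and> (\<forall>b. 0 < b \<and> b < a \<longrightarrow> turns b)}"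
  obtain \<delta> where \<delta>: "0 < \<delta>" "\<And>a. 0 < a \<Longrightarrow> a < \<delta> \<Longrightarrow> turns a" using turns_of_small by blast
  obtain a1 where a1: "0 < a1" "\<not> turns a1" using not_turns_of_large by blast
  have \<delta>S: "\<delta> \<in> S" using \<delta> by (auto simp: S_def)
  have "s \<le> a1" if "s \<in> S" for s using that a1 by (force simp: S_def not_le)
  then have bdd: "bdd_above S" by (auto simp: bdd_above_def)
  define a where "a = Sup S"
  have "\<delta> \<le> a" unfolding a_def by (rule cSup_upper[OF \<delta>S bdd])
  then have a: "0 < a" using \<delta> by simp
  have below: "turns b" if b: "0 < b" "b < a" for b
  proof -
    obtain s where "s \<in> S" "b < s" using b less_cSup_iff[OF _ bdd, of b] \<delta>S unfolding a_def by blast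
    then show ?thesis using b by (auto simp: S_def)
  qed
  have "\<not> turns a"
  proof
    assume "turns a"
    then obtain d where d: "0 < d" "\<And>b. 0 < b \<Longrightarrow> \<bar>b - a\<bar> < d \<Longrightarrow> turns b"
      using turns_open[OF a] by blast
    have "turns b" if "0 < b" "b < a + d / 2" for b
      using that below[of b] d(2)[of b] d(1) by (cases "b < a") auto
    then have "a + d / 2 \<in> S" using a d by (auto simp: S_def)
    then have "a + d / 2 \<le> a" unfolding a_def by (rule cSup_upper[OF _ bdd])
    then show False using d by simp
  qed
  then show thesis using that a below by blast
qed

text \<open>If the critical profile reached zero at a finite radius, it would do so transversally, so its
  truncated continuation would become negative and the same would happen for all nearby initial values;
  but turning profiles stay above their positive minimum.\<close>

lemma critical_global:
  assumes a: "0 < a" and nt: "\<not> turns a" and below: "\<And>b. 0 < b \<Longrightarrow> b < a \<Longrightarrow> turns b"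
  shows "R a = \<infinity>"
proof (rule ccontr)
  assume "R a \<noteq> \<infinity>"
  then obtain r where r: "R a = ereal r" using R_pos[OF a] by (cases "R a") auto
  have r0: "0 < r" using R_pos[OF a] r by simp
  have vel_neg: "vel (v a) y < 0" if "0 < y" "y < r" for y
    using nt that r by (auto simp: turns_def not_le)
  define M where "M = a + 1"
  have M: "0 \<le> M" using a by (simp add: M_def)
  obtain w where w: "tsol M w (r + 1)" "w 0 = a" using tsol_exists[OF M, of "r + 1" a] r0 by auto
  have va: "0 < v a x" "v a x \<le> a" if "0 \<le> x" "x < r" for x
    using v_pos[OF a that(1)] not_turns_le[OF a nt that(1)] that r by auto
  have eq: "v a x = w x" if "0 \<le> x" "x < r" for x
  proof (rule tsol_unique[of M "v a" x w x])
    show "tsol M (v a) x"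
    proof (rule sol_imp_tsol[OF v_sol[OF a that(1)]])
      fix y assume "0 \<le> y" "y \<le> x"
      then show "v a y \<le> M" using va(2)[of y] that by (simp add: M_def)
    qed (use that r in auto)
    show "tsol M w x" by (rule tsol_mono[OF w(1)]) (use that in auto)
  qed (use that M w v_0[OF a] in auto)
  have wcont: "continuous_on {0..r + 1} w" using w by (simp add: tsol_def)
  have wlim: "(w \<longlongrightarrow> w r) (at_left r)"
    by (rule continuous_on_Icc_at_leftD[of 0]) (use r0 in \<open>auto intro: continuous_on_subset[OF wcont]\<close>)
  have ev: "\<forall>\<^sub>F x in at_left r. s < x \<and> x < r" if "s < r" for s
    using that by (auto simp: eventually_at_left_field intro: exI[of _ s])
  have w_ge: "0 \<le> w r"
    by (rule tendsto_lowerbound[OF wlim]) (use ev[OF r0] eq va(1) in \<open>auto elim!: eventually_mono intro: less_imp_le\<close>)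
  have w_le: "w r \<le> w x" if x: "0 \<le> x" "x < r" for x
  proof (rule tendsto_upperbound[OF wlim])
    show "\<forall>\<^sub>F y in at_left r. w y \<le> w x"
      using ev[OF x(2)]
    proof (rule eventually_mono)
      fix y assume y: "x < y \<and> y < r"
      then have "v a y < v a x" by (intro not_turns_decreasing[OF a nt x(1)]) (auto simp: r)
      then show "w y \<le> w x" using eq[of x] eq[of y] x y by simp
    qed
  qed simp
  have wr: "w r = 0"
  proof (rule ccontr)
    assume "w r \<noteq> 0"
    then have "0 < w r" using w_ge by simp
    then show False
      using finite_end_unbounded[OF a r, of "w r" a] w_le eq va(2) by auto
  qed
  define G where "G = flux (\<lambda>x. clip M (w x))"
  have clw: "continuous_on {0..r + 1} (\<lambda>x. clip M (w x))" by (rule continuous_on_clip[OF wcont])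
  have Gcont: "continuous_on {0..r + 1} G"
    unfolding G_def by (rule flux_continuous[OF clw]) (use M in \<open>auto intro: clip_bounds\<close>)
  have G_eq: "G x = flux (v a) x" if "0 \<le> x" "x < r" for x
    unfolding G_def
  proof (rule flux_cong)
    fix y assume "0 \<le> y" "y \<le> x"
    then show "clip M (w y) = v a y"
      using va[of y] eq[of y] that by (auto simp: M_def intro!: clip_id)
  qed
  have Glim: "(G \<longlongrightarrow> G r) (at_left r)"
    by (rule continuous_on_Icc_at_leftD[of 0]) (use r0 in \<open>auto intro: continuous_on_subset[OF Gcont]\<close>)
  \<comment> \<open>The velocity is negative before \<open>r\<close>, and its drift part vanishes at \<open>r\<close>.\<close>
  have "G r \<le> 0"
  proof -
    have "((\<lambda>x. \<beta> * x ^ (k + 1) * w x powr n) \<longlongrightarrow> \<beta> * r ^ (k + 1) * w r powr n) (at_left r)"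
      by (intro tendsto_mult tendsto_powr' tendsto_power tendsto_const tendsto_ident_at wlim)
         (use n1 wr ev[OF r0] eq va(1) in \<open>auto elim!: eventually_mono intro: less_imp_le\<close>)
    then have lim0: "((\<lambda>x. \<beta> * x ^ (k + 1) * w x powr n) \<longlongrightarrow> 0) (at_left r)" using wr by simp
    show ?thesis
    proof (rule tendsto_le[OF _ lim0 Glim])
      show "\<forall>\<^sub>F x in at_left r. G x \<le> \<beta> * x ^ (k + 1) * w x powr n"
        using ev[OF r0]
      proof (rule eventually_mono)
        fix x assume x: "0 < x \<and> x < r"
        then have "flux (v a) x / x ^ k < \<beta> * x * v a x powr n"
          using vel_neg[of x] by (simp add: vel_def)
        then show "G x \<le> \<beta> * x ^ (k + 1) * w x powr n"
          using x G_eq[of x] eq[of x] by (simp add: divide_less_eq mult_ac)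
      qed
    qed simp
  qed
  moreover have "G r \<noteq> 0"
  proof
    assume Gr: "G r = 0"
    have "((\<lambda>x. r powr \<sigma> * w x powr (q - n)) \<longlongrightarrow> r powr \<sigma> * w r powr (q - n)) (at_left r)"
      by (intro tendsto_mult tendsto_powr' tendsto_const wlim)
         (use nq wr ev[OF r0] eq va(1) in \<open>auto elim!: eventually_mono intro: less_imp_le\<close>)
    then have "\<forall>\<^sub>F x in at_left r. r powr \<sigma> * w x powr (q - n) < eps"
      by (rule order_tendstoD) (use wr nq eps_pos in auto)
    then have "\<forall>\<^sub>F x in at_left r. r powr \<sigma> * w x powr (q - n) < eps \<and> 0 < x \<and> x < r"
      using ev[OF r0] by (rule eventually_conj)
    then obtain s where s: "0 < s" "s < r" "r powr \<sigma> * w s powr (q - n) < eps"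
      using eventually_happens[of _ "at_left r"] by (auto simp: trivial_limit_at_left_real)
    have ratio_small: "ratio (v a) x < eps" if x: "s \<le> x" "x < r" for x
    proof -
      have "v a x \<le> v a s"
        using not_turns_decreasing[OF a nt, of s x] s x r by (cases "x = s") auto
      then have "ratio (v a) x \<le> r powr \<sigma> * w s powr (q - n)"
        unfolding ratio_def using x s nq sigma_pos va(1)[of x] eq[of s]
        by (intro mult_mono powr_mono2) auto
      then show ?thesis using s by simp
    qed
    have Gpos: "0 \<le> flux (v a) x" if x: "s \<le> x" "x < r" for x
    proof -
      have "G r \<le> G x"
      proof (rule DERIV_nonpos_imp_decreasing_open[of x r G])
        fix y assume y: "x < y" "y < r"
        obtain Y where Y: "y < Y" "Y < r" using dense[OF y(2)] by blast
        have "(flux (v a) has_real_derivative y ^ k * (v a y powr n * (ratio (v a) y - eps))) (at y)"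
          by (rule flux_deriv_ratio[OF v_sol[OF a, of Y]]) (use Y y s x r in auto)
        then have "(G has_real_derivative y ^ k * (v a y powr n * (ratio (v a) y - eps))) (at y)"
          by (rule has_field_derivative_transform_within_open[where S = "{0<..<r}"])
             (use G_eq y x s in auto)
        moreover have "y ^ k * (v a y powr n * (ratio (v a) y - eps)) \<le> 0"
          using ratio_small[of y] y x s by (intro mult_nonneg_nonpos) auto
        ultimately show "\<exists>d. (G has_real_derivative d) (at y) \<and> d \<le> 0" by blast
      qed (use x s in \<open>auto intro: continuous_on_subset[OF Gcont]\<close>)
      then show ?thesis using Gr G_eq[of x] x s by simp
    qed
    \<comment> \<open>A nonnegative flux leaves only the drift, which cannot bring \<open>v\<close> to 0 in finite distance.\<close>
    define C where "C = \<beta> * r * a powr (n - 1)"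
    have keep: "v a s * exp (C * s) \<le> w x * exp (C * x)" if x: "s < x" "x < r" for x
    proof -
      let ?F = "\<lambda>x. v a x * exp (C * x)"
      have "?F s \<le> ?F x"
      proof (rule DERIV_nonneg_imp_increasing_open[of s x ?F])
        fix y assume y: "s < y" "y < x"
        have vy: "0 < v a y" "v a y \<le> a" using va[of y] y x s by auto
        have "(v a has_real_derivative vel (v a) y) (at y)"
          by (rule v_deriv[OF a]) (use y x s r in auto)
        then have "(?F has_real_derivative (vel (v a) y + C * v a y) * exp (C * y)) (at y)"
          by (auto intro!: derivative_eq_intros simp: algebra_simps)
        moreover have "0 \<le> vel (v a) y + C * v a y"
        proof -
          have "0 \<le> flux (v a) y / y ^ k" using Gpos[of y] y x s by simp
          moreover have "\<beta> * y * v a y powr n \<le> C * v a y"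
          proof -
            have "v a y powr n = v a y powr (n - 1) * v a y" using vy by (simp add: powr_diff)
            then have "\<beta> * y * v a y powr n = (\<beta> * y * v a y powr (n - 1)) * v a y" by simp
            also have "\<dots> \<le> C * v a y"
              unfolding C_def using vy n1 beta_pos y x s
              by (intro mult_right_mono mult_mono powr_mono2) auto
            finally show ?thesis .
          qed
          ultimately show ?thesis by (simp add: vel_def)
        qed
        ultimately show "\<exists>z. (?F has_real_derivative z) (at y) \<and> 0 \<le> z" by auto
      next
        show "continuous_on {s..x} ?F"
          using v_continuous[OF a, of x s] x s r by (intro continuous_intros) auto
      qed (use x in simp)
      then show ?thesis using eq[of x] x s by simp
    qed
    have "((\<lambda>x. w x * exp (C * x)) \<longlongrightarrow> w r * exp (C * r)) (at_left r)"
      by (intro tendsto_intros wlim)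
    then have "v a s * exp (C * s) \<le> w r * exp (C * r)"
      by (rule tendsto_lowerbound) (use ev[OF s(2)] keep in \<open>auto elim!: eventually_mono\<close>)
    moreover have "0 < v a s * exp (C * s)" using va(1)[of s] s by simp
    ultimately show False using wr by simp
  qed
  ultimately have Gneg: "G r < 0" by simp
  have "(w has_real_derivative vel (\<lambda>x. clip M (w x)) r) (at r)"
    by (rule tsol_deriv[OF w(1) M]) (use r0 in auto)
  moreover have "vel (\<lambda>x. clip M (w x)) r < 0"
    using Gneg r0 wr M by (simp add: vel_def G_def clip_def divide_neg_pos)
  ultimately obtain d where d: "0 < d" "\<forall>h>0. h < d \<longrightarrow> w (r + h) < w r"
    using DERIV_neg_dec_right by blast
  define x where "x = r + min d 1 / 2"
  have x: "r < x" "x < r + d" "x < r + 1" using d by (auto simp: x_def)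
  have wx: "w y < 0" if "r < y" "y \<le> x" for y
    using d(2)[rule_format, of "y - r"] that x wr by auto
  have w_le_a: "w y \<le> a" if "0 \<le> y" "y \<le> x" for y
    using va(2)[of y] eq[of y] wr wx[of y] that a by (cases y r rule: linorder_cases) auto
  obtain K where K: "0 < K" "\<And>w1 w2 y. tsol M w1 (r + 1) \<Longrightarrow> tsol M w2 (r + 1) \<Longrightarrow> 0 \<le> y \<Longrightarrow> y \<le> r + 1 \<Longrightarrow>
      \<bar>w1 y - w2 y\<bar> \<le> K * \<bar>w1 0 - w2 0\<bar>"
    using tsol_stable[OF M, of "r + 1"] r0 by (metis add_nonneg_nonneg less_imp_le zero_le_one)
  define e where "e = min 1 (- w x)"
  have e: "0 < e" "e \<le> 1" "e \<le> - w x" using wx[of x] x by (auto simp: e_def)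
  define h where "h = min a (e / K)"
  have eK: "0 < e / K" using e K by simp
  then have h: "0 < h" "h \<le> a" "h \<le> e / K" using a by (auto simp: h_def)
  define b where "b = a - h / 2"
  have b: "0 < b" "b < a" "a - b < e / K" using h unfolding b_def by linarith+
  have tb: "turns b" by (rule below[OF b(1,2)])
  obtain u where u: "tsol M u (r + 1)" "u 0 = b" using tsol_exists[OF M, of "r + 1" b] r0 by auto
  have close: "\<bar>u y - w y\<bar> < e" if "0 \<le> y" "y \<le> x" for y
  proof -
    have "\<bar>u y - w y\<bar> \<le> K * (a - b)"
      using K(2)[OF u(1) w(1), of y] u(2) w(2) b that x by simp
    also have "\<dots> < e" using b K(1) by (simp add: pos_less_divide_eq mult.commute)
    finally show ?thesis .
  qed
  have uM: "u y \<le> M" if "0 \<le> y" "y \<le> x" for y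
    using close[OF that] w_le_a[OF that] e by (simp add: M_def)
  have ux: "u x < 0" using close[of x] e x r0 by simp
  have vb: "v b y = u y" if "0 \<le> y" "y \<le> x" "ereal y < R b" for y
    by (rule eq_truncated[OF b(1) tsol_mono[OF u(1)] uM M u(2) that]) (use x in auto)
  have Rb: "\<not> ereal x < R b"
    using vb[of x] ux v_pos[OF b(1), of x] x r0 by auto
  then obtain rb where rb: "R b = ereal rb" "rb \<le> x"
    using R_pos[OF b(1)] by (cases "R b") auto
  obtain x0 where x0: "0 < x0" "ereal x0 < R b"
    "\<And>s t. 0 \<le> s \<Longrightarrow> s < t \<Longrightarrow> t \<le> x0 \<Longrightarrow> v b t < v b s"
    "\<And>s t. x0 \<le> s \<Longrightarrow> s < t \<Longrightarrow> ereal t < R b \<Longrightarrow> v b s < v b t"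
    "\<And>x. 0 \<le> x \<Longrightarrow> ereal x < R b \<Longrightarrow> x \<noteq> x0 \<Longrightarrow> v b x0 < v b x"
    using turning_min[OF b(1) tb] by blast
  show False
  proof (rule finite_end_unbounded[OF b(1) rb(1)])
    show "0 < v b x0" using v_pos[OF b(1)] x0 by simp
    fix y assume y: "0 \<le> y" "y < rb"
    have "v b x0 \<le> v b y" using x0(5)[of y] y rb by (cases "y = x0") auto
    moreover have "v b y \<le> M" using vb[of y] uM[of y] y rb by simp
    ultimately show "v b x0 \<le> v b y \<and> v b y \<le> M" by simp
  qed
qed

end

lemma decreasing_converges_at_top:
  fixes W :: "real \<Rightarrow> real"
  assumes mono: "\<And>x y. X \<le> x \<Longrightarrow> x \<le> y \<Longrightarrow> W y \<le> W x" and low: "\<And>x. X \<le> x \<Longrightarrow> b \<le> W x"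
  obtains l where "b \<le> l" "(W \<longlongrightarrow> l) at_top"
proof
  define l where "l = Inf (W ` {X..})"
  have bdd: "bdd_below (W ` {X..})" using low by (auto simp: bdd_below_def)
  show "b \<le> l" unfolding l_def by (rule cInf_greatest) (use low in auto)
  show "(W \<longlongrightarrow> l) at_top"
  proof (rule decreasing_tendsto)
    show "\<forall>\<^sub>F x in at_top. l \<le> W x"
      unfolding l_def using eventually_ge_at_top[of X]
      by eventually_elim (auto intro: cInf_lower[OF _ bdd])
    fix z assume "l < z"
    then obtain x where x: "X \<le> x" "W x < z"
      using cInf_less_iff[OF _ bdd, of z] by (auto simp: l_def)
    show "\<forall>\<^sub>F x in at_top. W x < z"
      using eventually_ge_at_top[of x]
    proof eventually_elim
      case (elim y)
      show ?case using mono[OF x(1) elim] x(2) by simp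
    qed
  qed
qed

context shooting_family
begin

section \<open>Asymptotics of the critical profile\<close>

context
  fixes a :: real
  assumes a: "0 < a" and global: "R a = \<infinity>" and nt: "\<not> turns a"
begin

text \<open>Emden-Fowler variables: \<open>W\<close> is constant for the expected decay, and \<open>P\<close> is its derivative with respect
  to \<open>ln x\<close>.\<close>

definition W :: "real \<Rightarrow> real" where
  "W x = x powr kap * v a x"

definition P :: "real \<Rightarrow> real" where
  "P x = x powr kap * (kap * v a x + x * vel (v a) x)"

definition K :: real where
  "K = kap * (kap + 1 - real k)"

lemma K_pos: "0 < K"
  using kap_pos dim_less by (simp add: K_def)

lemma sol_all: "0 \<le> X \<Longrightarrow> sol (v a) X"
  using v_sol[OF a] global by simp

lemma pos_all: "0 \<le> x \<Longrightarrow> 0 < v a x"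
  using v_pos[OF a] global by simp

lemma vel_neg_all: "0 < x \<Longrightarrow> vel (v a) x < 0"
  using nt global by (auto simp: turns_def not_le)

lemma le_all: "0 \<le> x \<Longrightarrow> v a x \<le> a"
  using not_turns_le[OF a nt] global by simp

lemma W_pos: "0 < x \<Longrightarrow> 0 < W x"
  using pos_all by (simp add: W_def)

lemma W_deriv: "0 < x \<Longrightarrow> (W has_real_derivative P x / x) (at x)"
proof -
  assume x: "0 < x"
  have "(v a has_real_derivative vel (v a) x) (at x)" by (rule v_deriv[OF a x]) (simp add: global)
  then have "(W has_real_derivative x powr kap * vel (v a) x + kap * x powr (kap - 1) * v a x) (at x)"
    unfolding W_def using x by (intro DERIV_mult' has_real_derivative_powr) auto
  moreover have "x powr kap * vel (v a) x + kap * x powr (kap - 1) * v a x = P x / x"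
    using x by (simp add: P_def powr_diff field_simps)
  ultimately show ?thesis by simp
qed

text \<open>In the variable \<open>ln x\<close> this reads \<open>W'' = (b - E) W' - K W + W^q\<close> with \<open>b = 2 \<kappa> + 1 - k > 0\<close>. The terms with \<open>\<alpha>\<close> and
  \<open>\<beta>\<close> combine into the damping coefficient \<open>E\<close>, because \<open>\<alpha> = \<beta> n \<kappa>\<close>; so the equilibrium \<open>W^(q-1) = K\<close> is an exact solution.\<close>

lemma P_deriv:
  assumes x: "0 < x"
  shows "(P has_real_derivative ((2 * kap + 1 - real k - \<beta> * n * x\<^sup>2 * v a x powr (n - 1)) * P x
     - K * W x + W x powr q) / x) (at x)"
proof -
  define y where "y = x powr kap"
  define u where "u = vel (v a) x"
  define V where "V = x powr \<sigma> * v a x powr q - alp * v a x powr n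
           - (real k / x + \<beta> * n * x * v a x powr (n - 1)) * u"
  have dv: "(v a has_real_derivative u) (at x)"
    unfolding u_def by (rule v_deriv[OF a x]) (simp add: global)
  have dV: "(vel (v a) has_real_derivative V) (at x)"
    unfolding V_def u_def by (rule sol_vel_deriv[OF sol_all[of "x + 1"]]) (use x in auto)
  have d1: "((\<lambda>x. kap * v a x + x * vel (v a) x) has_real_derivative kap * u + (x * V + 1 * u)) (at x)"
    by (rule DERIV_cong, rule DERIV_add[OF DERIV_cmult[OF dv] DERIV_mult'[OF DERIV_ident dV]]) (simp add: u_def)
  have "(P has_real_derivative y * (kap * u + (x * V + 1 * u)) + kap * x powr (kap - 1) * (kap * v a x + x * u)) (at x)"
    unfolding P_def y_def u_def by (rule DERIV_mult'[OF has_real_derivative_powr[OF x] d1[unfolded u_def]])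
  moreover have "y * (kap * u + (x * V + 1 * u)) + kap * x powr (kap - 1) * (kap * v a x + x * u)
     = ((2 * kap + 1 - real k - \<beta> * n * x\<^sup>2 * v a x powr (n - 1)) * P x - K * W x + W x powr q) / x"
  proof -
    have Wq: "W x powr q = y * x\<^sup>2 * x powr \<sigma> * v a x powr q"
    proof -
      have "kap * q = kap + 2 + \<sigma>" using kap_eq by (simp add: algebra_simps)
      then have "W x powr q = x powr (kap + 2 + \<sigma>) * v a x powr q"
        using x pos_all[of x] by (simp add: W_def powr_mult powr_powr)
      then show ?thesis using x by (simp add: y_def powr_add)
    qed
    have vn: "v a x powr n = v a x powr (n - 1) * v a x" using pos_all[of x] x by (simp add: powr_diff)
    have k1: "x powr (kap - 1) = y / x" using x by (simp add: y_def powr_diff)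
    have xV: "x * (x * V) = x\<^sup>2 * x powr \<sigma> * v a x powr q - alp * x\<^sup>2 * v a x powr n
        - real k * x * u - \<beta> * n * x\<^sup>2 * v a x powr (n - 1) * (x * u)"
      using x by (simp add: V_def field_simps power2_eq_square)
    have "x * (y * (kap * u + (x * V + 1 * u)) + kap * x powr (kap - 1) * (kap * v a x + x * u))
       = y * (kap * (x * u) + x * (x * V) + x * u) + kap * y * (kap * v a x + x * u)"
      unfolding k1 using x by (simp add: field_simps)
    also have "\<dots> = (2 * kap + 1 - real k - \<beta> * n * x\<^sup>2 * v a x powr (n - 1)) * P x - K * W x + W x powr q"
      unfolding xV Wq unfolding vn P_def W_def K_def alp_def y_def[symmetric] u_def[symmetric]
      by (simp add: algebra_simps)
    finally show ?thesis using x by (simp add: field_simps)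
  qed
  ultimately show ?thesis by simp
qed

lemma P_continuous: "0 < s \<Longrightarrow> continuous_on {s..t} P"
  by (rule DERIV_continuous_on[OF DERIV_subset[OF P_deriv]]) auto

lemma W_continuous: "0 < s \<Longrightarrow> continuous_on {s..t} W"
  by (rule DERIV_continuous_on[OF DERIV_subset[OF W_deriv]]) auto

lemma P_deriv_at_zero:
  assumes "0 < x" "P x = 0"
  shows "(P has_real_derivative W x * (W x powr (q - 1) - K) / x) (at x)"
proof -
  have "W x * (W x powr (q - 1) - K) = - K * W x + W x powr q"
    using W_pos[OF assms(1)] by (simp add: powr_diff field_simps)
  then show ?thesis using P_deriv[OF assms(1)] assms(2) by simp
qed

lemma P_pos_near_0:
  obtains d where "0 < d" "\<And>x. 0 < x \<Longrightarrow> x \<le> d \<Longrightarrow> 0 < P x"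
proof -
  let ?p = "\<lambda>x. kap * v a x + x * vel (v a) x"
  have "continuous_on {0..1} ?p"
    using sol_D(1)[OF sol_all[of 1]] sol_continuous(2)[OF sol_all[of 1]] by (intro continuous_intros) auto
  then have "\<exists>d>0. \<forall>x\<in>{0..1}. dist x 0 < d \<longrightarrow> dist (?p x) (?p 0) < kap * a"
    unfolding continuous_on_iff using a kap_pos by (metis atLeastAtMost_iff mult_pos_pos order_refl zero_le_one)
  then obtain d where d: "0 < d" "\<And>x. 0 \<le> x \<Longrightarrow> x \<le> 1 \<Longrightarrow> x < d \<Longrightarrow> 0 < ?p x"
    using v_0[OF a] by (fastforce simp: dist_real_def abs_less_iff)
  show thesis
  proof (rule that[of "min 1 d / 2"])
    fix x assume "0 < x" "x \<le> min 1 d / 2"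
    then show "0 < P x" unfolding P_def using d by (intro mult_pos_pos d(2)) auto
  qed (use d in simp)
qed

lemma W_increasing:
  assumes "0 < s" "s \<le> t" "\<And>x. s < x \<Longrightarrow> x < t \<Longrightarrow> 0 \<le> P x"
  shows "W s \<le> W t"
proof (rule DERIV_nonneg_imp_increasing_open[of s t W, OF assms(2) _ W_continuous[OF assms(1)]])
  fix x assume "s < x" "x < t"
  then show "\<exists>y. (W has_real_derivative y) (at x) \<and> 0 \<le> y"
    using W_deriv[of x] assms(1,3) by (intro exI[of _ "P x / x"]) auto
qed

lemma W_decreasing:
  assumes "0 < s" "s \<le> t" "\<And>x. s < x \<Longrightarrow> x < t \<Longrightarrow> P x \<le> 0"
  shows "W t \<le> W s"
proof (rule DERIV_nonpos_imp_decreasing_open[of s t W, OF assms(2) _ W_continuous[OF assms(1)]])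
  fix x assume "s < x" "x < t"
  then show "\<exists>y. (W has_real_derivative y) (at x) \<and> y \<le> 0"
    using W_deriv[of x] assms(1,3) by (intro exI[of _ "P x / x"]) (auto simp: divide_nonpos_pos)
qed

text \<open>Uniqueness at the equilibrium, in backward direction: the squared distance \<open>N\<close> from the
  equilibrium satisfies \<open>N' \<ge> - D N\<close>, so it would vanish to the left of a contact point as well, where \<open>P\<close> is
  positive.\<close>

lemma no_equilibrium_contact:
  assumes z: "0 < z" "P z = 0" "W z powr (q - 1) = K" and pos: "\<And>x. 0 < x \<Longrightarrow> x < z \<Longrightarrow> 0 < P x"
  shows False
proof -
  define w where "w = W z"
  have w: "0 < w" using W_pos z by (simp add: w_def)
  have Kw: "w powr q = K * w" using z w by (simp add: w_def powr_diff field_simps)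
  have Wle: "W x \<le> w" if "0 < x" "x \<le> z" for x
    unfolding w_def by (rule W_increasing[OF that]) (use pos that in \<open>auto intro: less_imp_le\<close>)
  define c where "c x = 2 * kap + 1 - real k - \<beta> * n * x\<^sup>2 * v a x powr (n - 1)" for x
  define g where "g x = W x powr q - K * W x" for x
  define Cc where "Cc = 2 * kap + 1 + \<beta> * n * z\<^sup>2 * a powr (n - 1) + real k"
  have c_bound: "\<bar>c x\<bar> \<le> Cc" if "0 < x" "x \<le> z" for x
  proof -
    have "\<beta> * n * x\<^sup>2 * v a x powr (n - 1) \<le> \<beta> * n * z\<^sup>2 * a powr (n - 1)"
      using that beta_pos n1 pos_all[of x] le_all[of x]
      by (intro mult_mono mult_left_mono power_mono powr_mono2) auto
    moreover have "0 \<le> \<beta> * n * x\<^sup>2 * v a x powr (n - 1)" using beta_pos n1 by simp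
    ultimately show ?thesis using kap_pos by (simp add: c_def Cc_def abs_le_iff)
  qed
  define Lg where "Lg = q * w powr (q - 1) + K"
  have g_bound: "\<bar>g x\<bar> \<le> Lg * \<bar>W x - w\<bar>" if "0 < x" "x \<le> z" for x
  proof -
    have "g x = (W x powr q - w powr q) - K * (W x - w)" by (simp add: g_def Kw algebra_simps)
    also have "\<bar>\<dots>\<bar> \<le> \<bar>W x powr q - w powr q\<bar> + K * \<bar>W x - w\<bar>"
      using K_pos by (intro order_trans[OF abs_triangle_ineq4]) (simp add: abs_mult)
    also have "\<bar>W x powr q - w powr q\<bar> \<le> q * w powr (q - 1) * \<bar>W x - w\<bar>"
      using n1 nq w W_pos[of x] Wle that by (intro powr_lipschitz) auto
    finally show ?thesis by (simp add: Lg_def algebra_simps)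
  qed
  define D where "D = (1 + Lg + 2 * Cc) / (z / 2)"
  have Lg: "0 \<le> Lg" using n1 nq K_pos by (simp add: Lg_def)
  have Cc: "0 \<le> Cc" using c_bound[of z] z by linarith
  define N where "N x = (W x - w)\<^sup>2 + (P x)\<^sup>2" for x
  let ?F = "\<lambda>x. N x * exp (D * x)"
  have "?F (z / 2) \<le> ?F z"
  proof (rule DERIV_nonneg_imp_increasing_open[of "z / 2" z ?F])
    fix x assume x: "z / 2 < x" "x < z"
    have x0: "0 < x" using x z by simp
    let ?u = "W x - w" and ?p = "P x"
    have dP: "(P has_real_derivative (c x * ?p + g x) / x) (at x)"
      using P_deriv[OF x0] by (simp add: c_def g_def algebra_simps)
    define N' where "N' = 2 * ?u * (?p / x) + 2 * ?p * ((c x * ?p + g x) / x)"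
    have "(N has_real_derivative N') (at x)"
      unfolding N_def N'_def using W_deriv[OF x0] dP x0
      by (auto intro!: derivative_eq_intros simp: field_simps)
    then have "(?F has_real_derivative (N' + D * N x) * exp (D * x)) (at x)"
      by (auto intro!: derivative_eq_intros simp: algebra_simps)
    moreover have "0 \<le> N' + D * N x"
    proof -
      have N0: "0 \<le> N x" by (simp add: N_def)
      have up: "2 * \<bar>?u\<bar> * \<bar>?p\<bar> \<le> N x"
        using sum_squares_bound[of "\<bar>?u\<bar>" "\<bar>?p\<bar>"] by (simp add: N_def)
      have pp: "?p\<^sup>2 \<le> N x" by (simp add: N_def)
      have "x * N' = 2 * ?u * ?p + 2 * c x * ?p\<^sup>2 + 2 * ?p * g x"
        using x0 by (simp add: N'_def field_simps power2_eq_square)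
      also have "- \<dots> \<le> 2 * \<bar>?u\<bar> * \<bar>?p\<bar> + 2 * \<bar>c x\<bar> * ?p\<^sup>2 + 2 * \<bar>?p\<bar> * \<bar>g x\<bar>"
      proof -
        have "- (?u * ?p) \<le> \<bar>?u\<bar> * \<bar>?p\<bar>" "- (c x * ?p\<^sup>2) \<le> \<bar>c x\<bar> * ?p\<^sup>2" "- (?p * g x) \<le> \<bar>?p\<bar> * \<bar>g x\<bar>"
          by (metis abs_ge_minus_self abs_mult) (metis abs_ge_minus_self abs_mult abs_power2, metis abs_ge_minus_self abs_mult)
        then show ?thesis by linarith
      qed
      also have "\<dots> \<le> N x + 2 * Cc * N x + Lg * N x"
      proof -
        have "2 * \<bar>c x\<bar> * ?p\<^sup>2 \<le> 2 * Cc * N x"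
          using c_bound[of x] x x0 pp Cc by (intro mult_mono) auto
        moreover have "2 * \<bar>?p\<bar> * \<bar>g x\<bar> \<le> Lg * N x"
        proof -
          have "2 * \<bar>?p\<bar> * \<bar>g x\<bar> \<le> 2 * \<bar>?p\<bar> * (Lg * \<bar>?u\<bar>)"
            using g_bound[of x] x x0 by (intro mult_left_mono) auto
          also have "\<dots> = Lg * (2 * \<bar>?u\<bar> * \<bar>?p\<bar>)" by simp
          also have "\<dots> \<le> Lg * N x" using up Lg by (intro mult_left_mono) auto
          finally show ?thesis .
        qed
        ultimately show ?thesis using up by linarith
      qed
      also have "\<dots> = (1 + Lg + 2 * Cc) * N x" by (simp add: algebra_simps)
      also have "\<dots> = D * (z / 2) * N x" using z by (simp add: D_def)
      also have "\<dots> \<le> D * x * N x"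
        using x N0 Lg Cc z by (intro mult_right_mono mult_left_mono) (auto simp: D_def)
      finally have "0 \<le> x * (N' + D * N x)" by (simp add: algebra_simps)
      then show ?thesis using x0 by (simp add: zero_le_mult_iff)
    qed
    ultimately show "\<exists>y. (?F has_real_derivative y) (at x) \<and> 0 \<le> y" by auto
  next
    show "continuous_on {z / 2..z} ?F"
      unfolding N_def using z by (intro continuous_intros W_continuous P_continuous) auto
  qed (use z in simp)
  moreover have "N z = 0" using z by (simp add: N_def w_def)
  ultimately have "N (z / 2) * exp (D * (z / 2)) \<le> 0" by simp
  then have "N (z / 2) \<le> 0" by (simp add: mult_le_0_iff)
  then have "P (z / 2) = 0" by (simp add: N_def sum_power2_le_zero_iff)
  then show False using pos[of "z / 2"] z by simp
qed

text \<open>At a zero of \<open>P\<close> the derivative of \<open>P\<close> has the sign of \<open>W^(q-1) - K\<close>. Since \<open>P\<close> starts positive, at its first zero \<open>W\<close>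
  lies below the equilibrium; from then on \<open>W\<close> decreases, and the sign of the derivative excludes a further zero.\<close>

lemma P_dichotomy:
  obtains "\<And>x. 0 < x \<Longrightarrow> 0 < P x" | z where "0 < z" "\<And>x. z < x \<Longrightarrow> P x < 0"
proof (cases "\<forall>x>0. 0 < P x")
  case True
  then show thesis using that(1) by blast
next
  case False
  then obtain x1 where x1: "0 < x1" "P x1 \<le> 0" by (auto simp: not_less)
  obtain d where d: "0 < d" "\<And>x. 0 < x \<Longrightarrow> x \<le> d \<Longrightarrow> 0 < P x" using P_pos_near_0 by blast
  have dx: "d < x1" using d(2)[of x1] x1 by (meson not_le not_less)
  obtain z where z: "d < z" "z \<le> x1" "- P z = 0" "\<And>x. d \<le> x \<Longrightarrow> x < z \<Longrightarrow> - P x < 0"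
  proof (rule first_zero[of d x1 "\<lambda>x. - P x"])
    show "continuous_on {d..x1} (\<lambda>x. - P x)" by (intro continuous_on_minus P_continuous d)
  qed (use d dx x1 in auto)
  have z0: "0 < z" "P z = 0" using z d by auto
  have pos: "0 < P x" if "0 < x" "x < z" for x
    using d(2)[of x] z(4)[of x] that by (cases "x \<le> d") auto
  have Wz: "W z powr (q - 1) < K"
  proof (rule ccontr)
    assume "\<not> W z powr (q - 1) < K"
    then consider "W z powr (q - 1) = K" | "K < W z powr (q - 1)" by linarith
    then show False
    proof cases
      case 1
      then show False by (rule no_equilibrium_contact[OF z0 _ pos])
    next
      case 2
      then have "0 < W z * (W z powr (q - 1) - K) / z" using W_pos[of z] z0 by simp
      from DERIV_pos_inc_left[OF P_deriv_at_zero[OF z0] this] obtain e where e: "0 < e"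
        "\<forall>h>0. h < e \<longrightarrow> P (z - h) < P z" by blast
      define h where "h = min e z / 2"
      have "0 < h" "h < e" "h < z" using e z0 by (auto simp: h_def)
      then show False using e(2)[rule_format, of h] pos[of "z - h"] z0 by auto
    qed
  qed
  have neg_deriv: "W x * (W x powr (q - 1) - K) / x < 0" if "z \<le> x" "W x \<le> W z" for x
  proof -
    have x: "0 < x" using that z0 by simp
    have "W x powr (q - 1) \<le> W z powr (q - 1)"
      using that W_pos[OF x] n1 nq by (intro powr_mono2) auto
    then show ?thesis using Wz W_pos[OF x] x by (simp add: divide_neg_pos mult_pos_neg)
  qed
  from DERIV_neg_dec_right[OF P_deriv_at_zero[OF z0] neg_deriv] obtain e where e: "0 < e"
    "\<forall>h>0. h < e \<longrightarrow> P (z + h) < P z" by auto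
  have "P x < 0" if x: "z < x" for x
  proof (rule ccontr)
    assume "\<not> P x < 0"
    define b where "b = z + min e (x - z) / 2"
    have b: "z < b" "b < z + e" "b < x" using e x by (auto simp: b_def min_def field_simps)
    have near: "P y < 0" if "z < y" "y \<le> b" for y
      using e(2)[rule_format, of "y - z"] that b z0 by auto
    obtain c where c: "b < c" "c \<le> x" "P c = 0" "\<And>y. b \<le> y \<Longrightarrow> y < c \<Longrightarrow> P y < 0"
      by (rule first_zero[of b x P]) (use P_continuous near b z0 \<open>\<not> P x < 0\<close> in auto)
    have neg: "P y < 0" if "z < y" "y < c" for y
      using near[of y] c(4)[of y] that by (cases "y \<le> b") auto
    have c0: "0 < c" using c b z0 by simp
    have "W c \<le> W z"
      by (rule W_decreasing) (use z0 b c neg in \<open>auto intro: less_imp_le\<close>)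
    then have "W c * (W c powr (q - 1) - K) / c < 0" using neg_deriv b c by simp
    from DERIV_neg_dec_left[OF P_deriv_at_zero[OF c0 c(3)] this] obtain e' where e': "0 < e'"
      "\<forall>h>0. h < e' \<longrightarrow> P c < P (c - h)" by blast
    define h where "h = min e' (c - b) / 2"
    have h: "0 < h" "h < e'" "h < c - b" using e' c by (auto simp: h_def min_def)
    show False using e'(2)[rule_format, OF h(1,2)] c(3) c(4)[of "c - h"] h by auto
  qed
  then show thesis using that(2) z0 by blast
qed

text \<open>The damping equals \<open>\<beta> n x^(2 - \<kappa> (n-1)) W^(n-1)\<close>, and the exponent of \<open>x\<close> is negative.\<close>

lemma damping_bound:
  assumes "1 \<le> x"
  shows "\<beta> * n * x\<^sup>2 * v a x powr (n - 1) \<le> \<beta> * n * W x powr (n - 1)"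
proof -
  have "x\<^sup>2 \<le> x powr (kap * (n - 1))"
    using powr_mono[of 2 "kap * (n - 1)" x] theta_pos assms by simp
  then have "x\<^sup>2 * v a x powr (n - 1) \<le> x powr (kap * (n - 1)) * v a x powr (n - 1)"
    by (intro mult_right_mono) auto
  also have "\<dots> = W x powr (n - 1)"
    using assms pos_all[of x] by (simp add: W_def powr_mult powr_powr)
  finally show ?thesis
    using mult_left_mono[of "x\<^sup>2 * v a x powr (n - 1)" "W x powr (n - 1)" "\<beta> * n"] beta_pos n1
    by (simp add: mult_ac)
qed

text \<open>The quantity \<open>P - \<kappa> W = x^(\<kappa>+1) v'\<close> is negative. For large \<open>W\<close> the term \<open>W^q\<close> dominates the damping, of
  order \<open>W^n\<close>, and \<open>K W\<close>; the quantity then grows at least like \<open>ln x\<close> and becomes positive.\<close>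

lemma W_bounded_if_increasing:
  assumes pos: "\<And>x. 0 < x \<Longrightarrow> 0 < P x"
  obtains B where "\<And>x. 1 \<le> x \<Longrightarrow> W x \<le> B"
proof -
  define B where "B = max 1 ((alp + K + 1) powr (1 / (q - n)))"
  have big: "1 + alp * w powr n + K * w \<le> w powr q" if "B \<le> w" for w
  proof -
    have w1: "1 \<le> w" using that by (simp add: B_def)
    have "alp + K + 1 \<le> w powr (q - n)"
      by (rule le_powr_of_root_le) (use that nq alp_pos K_pos in \<open>auto simp: B_def\<close>)
    then have "(alp + K + 1) * w powr n \<le> w powr (q - n) * w powr n" by (intro mult_right_mono) auto
    also have "\<dots> = w powr q" by (simp flip: powr_add)
    finally have "alp * w powr n + K * w powr n + w powr n \<le> w powr q" by (simp add: algebra_simps)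
    moreover have "w \<le> w powr n" using powr_mono[of 1 n w] w1 n1 by simp
    moreover have "K * w \<le> K * w powr n" using calculation(2) K_pos by simp
    ultimately show ?thesis using w1 by linarith
  qed
  have "W x \<le> B" if x: "1 \<le> x" for x
  proof (rule ccontr)
    assume "\<not> W x \<le> B"
    have large: "B \<le> W y" if "x \<le> y" for y
    proof -
      have "W x \<le> W y" by (rule W_increasing) (use x that pos in \<open>auto intro: less_imp_le\<close>)
      then show ?thesis using \<open>\<not> W x \<le> B\<close> by simp
    qed
    have Y_neg: "P y - kap * W y < 0" if "0 < y" for y
    proof -
      have "P y - kap * W y = y powr kap * (y * vel (v a) y)" by (simp add: P_def W_def algebra_simps)
      also have "\<dots> < 0" using vel_neg_all[OF that] that by (simp add: mult_pos_neg)
      finally show ?thesis .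
    qed
    \<comment> \<open>Chosen so that the logarithmic lower bound reaches 1 at \<open>t\<close>.\<close>
    define t where "t = x * exp (1 - (P x - kap * W x))"
    have xt: "x \<le> t" using x Y_neg[of x] by (simp add: t_def)
    let ?F = "\<lambda>y. P y - kap * W y - ln y"
    have "?F x \<le> ?F t"
    proof (rule DERIV_nonneg_imp_increasing_open[of x t ?F, OF xt])
      fix y assume y: "x < y" "y < t"
      have y1: "0 < y" "1 \<le> y" using x y by auto
      define E where "E = \<beta> * n * y\<^sup>2 * v a y powr (n - 1)"
      have dF: "(?F has_real_derivative ((2 * kap + 1 - real k - E) * P y - K * W y + W y powr q) / y
          - kap * (P y / y) - 1 / y) (at y)"
        unfolding E_def by (intro DERIV_diff DERIV_cmult P_deriv W_deriv DERIV_ln_divide y1(1))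
      have "E * P y \<le> \<beta> * n * W y powr (n - 1) * (kap * W y)"
      proof (rule mult_mono)
        show "E \<le> \<beta> * n * W y powr (n - 1)" unfolding E_def by (rule damping_bound[OF y1(2)])
        show "P y \<le> kap * W y" using Y_neg[OF y1(1)] by simp
      qed (use pos[OF y1(1)] beta_pos n1 in auto)
      also have "\<dots> = alp * W y powr n"
        using W_pos[OF y1(1)] by (simp add: alp_def powr_diff)
      finally have "E * P y \<le> alp * W y powr n" .
      moreover have "1 + alp * W y powr n + K * W y \<le> W y powr q" by (rule big[OF large]) (use y in simp)
      moreover have "0 \<le> (kap + 1 - real k) * P y" using pos[OF y1(1)] dim_less by simp
      ultimately have "0 \<le> (2 * kap + 1 - real k - E) * P y - K * W y + W y powr q - kap * P y - 1"
        by (simp add: algebra_simps)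
      then have "0 \<le> ((2 * kap + 1 - real k - E) * P y - K * W y + W y powr q - kap * P y - 1) / y"
        using y1 by simp
      then have "0 \<le> ((2 * kap + 1 - real k - E) * P y - K * W y + W y powr q) / y - kap * (P y / y) - 1 / y"
        by (simp add: diff_divide_distrib)
      then show "\<exists>z. (?F has_real_derivative z) (at y) \<and> 0 \<le> z" using dF by blast
    next
      show "continuous_on {x..t} ?F"
        using x by (intro continuous_intros P_continuous W_continuous) auto
    qed
    moreover have "ln t = ln x + (1 - (P x - kap * W x))"
      using x by (simp add: t_def ln_mult)
    ultimately show False using Y_neg[of t] xt x by simp
  qed
  then show thesis by (rule that)
qed

text \<open>Once \<open>W\<close> is small, \<open>P\<close> decreases, hence stays below a negative constant, and \<open>W\<close> decreases at least like a
  multiple of \<open>ln x\<close>, contradicting positivity.\<close>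

lemma decreasing_limit_nonzero:
  assumes z: "0 < z" and neg: "\<And>x. z < x \<Longrightarrow> P x < 0" and lim: "(W \<longlongrightarrow> 0) at_top"
  shows False
proof -
  define b where "b = 2 * kap + 1 - real k"
  have b: "0 < b" using dim_less kap_pos by (simp add: b_def)
  define \<mu> where "\<mu> = min ((b / (\<beta> * n)) powr (1 / (n - 1))) (K powr (1 / (q - 1)))"
  have bb: "0 < b / (\<beta> * n)" using b beta_pos n1 by simp
  have \<mu>: "0 < \<mu>" using b beta_pos n1 K_pos unfolding \<mu>_def min_less_iff_conj powr_gt_zero by simp
  have "\<forall>\<^sub>F x in at_top. W x < \<mu> \<and> max 1 z < x"
    using order_tendstoD(2)[OF lim \<mu>] eventually_gt_at_top[of "max 1 z"] by (rule eventually_conj)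
  then obtain x2 where x2: "1 < x2" "z < x2" "\<And>x. x2 \<le> x \<Longrightarrow> W x < \<mu>"
    by (auto simp: eventually_at_top_linorder)
  have P_le: "P x \<le> P x2" if x: "x2 \<le> x" for x
  proof (rule DERIV_nonpos_imp_decreasing_open[of x2 x P, OF x])
    fix y assume y: "x2 < y" "y < x"
    have y1: "1 \<le> y" "0 < y" "z < y" using y x2 by auto
    have Wy: "0 < W y" "W y \<le> \<mu>" using W_pos[OF y1(2)] x2(3)[of y] y by auto
    have "W y powr (n - 1) \<le> ((b / (\<beta> * n)) powr (1 / (n - 1))) powr (n - 1)"
      using Wy n1 by (intro powr_mono2) (auto simp: \<mu>_def)
    also have "\<dots> = b / (\<beta> * n)" using n1 b beta_pos by (simp add: powr_powr)
    finally have "\<beta> * n * W y powr (n - 1) \<le> b" using beta_pos n1 by (simp add: field_simps)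
    then have "0 \<le> b - \<beta> * n * y\<^sup>2 * v a y powr (n - 1)" using damping_bound[OF y1(1)] by simp
    then have 1: "(b - \<beta> * n * y\<^sup>2 * v a y powr (n - 1)) * P y \<le> 0"
      using neg[OF y1(3)] by (intro mult_nonneg_nonpos) auto
    have "W y powr (q - 1) \<le> (K powr (1 / (q - 1))) powr (q - 1)"
      using Wy n1 nq by (intro powr_mono2) (auto simp: \<mu>_def)
    also have "\<dots> = K" using n1 nq K_pos by (simp add: powr_powr)
    finally have "W y * W y powr (q - 1) \<le> W y * K" using Wy by (intro mult_left_mono) auto
    moreover have "W y * W y powr (q - 1) = W y powr q" using Wy by (simp add: powr_diff)
    ultimately have 2: "- K * W y + W y powr q \<le> 0" by (simp add: mult.commute)
    have "((b - \<beta> * n * y\<^sup>2 * v a y powr (n - 1)) * P y - K * W y + W y powr q) / y \<le> 0"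
      using 1 2 y1 by (intro divide_nonpos_pos) auto
    then show "\<exists>d. (P has_real_derivative d) (at y) \<and> d \<le> 0"
      using P_deriv[OF y1(2)] unfolding b_def by blast
  qed (use x2 P_continuous in auto)
  define c where "c = - P x2"
  have c: "0 < c" using neg x2 by (simp add: c_def)
  \<comment> \<open>Chosen so that the logarithmic bound reaches 0 at \<open>t\<close>.\<close>
  define t where "t = x2 * exp (W x2 / c)"
  have xt: "x2 \<le> t" using x2 c W_pos[of x2] by (simp add: t_def)
  let ?F = "\<lambda>x. W x + c * ln x"
  have "?F t \<le> ?F x2"
  proof (rule DERIV_nonpos_imp_decreasing_open[of x2 t ?F, OF xt])
    fix y assume y: "x2 < y" "y < t"
    have y0: "0 < y" using y x2 by simp
    have "(?F has_real_derivative P y / y + c * (1 / y)) (at y)"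
      by (intro DERIV_add DERIV_cmult W_deriv DERIV_ln_divide y0)
    moreover have "P y / y + c * (1 / y) \<le> 0"
      using P_le[of y] y y0 by (simp add: c_def divide_simps)
    ultimately show "\<exists>d. (?F has_real_derivative d) (at y) \<and> d \<le> 0" by blast
  next
    show "continuous_on {x2..t} ?F"
      using x2 by (intro continuous_intros W_continuous) auto
  qed
  moreover have "ln t = ln x2 + W x2 / c" using x2 by (simp add: t_def ln_mult)
  ultimately have "W t \<le> 0" using c by (simp add: algebra_simps)
  then show False using W_pos[of t] xt x2 by simp
qed

lemma W_converges:
  obtains l where "0 < l" "(W \<longlongrightarrow> l) at_top"
proof (rule P_dichotomy)
  assume pos: "\<And>x. 0 < x \<Longrightarrow> 0 < P x"
  obtain B where B: "\<And>x. 1 \<le> x \<Longrightarrow> W x \<le> B" using W_bounded_if_increasing[OF pos] by blast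
  have mono: "W x \<le> W y" if "1 \<le> x" "x \<le> y" for x y
    by (rule W_increasing) (use that pos in \<open>auto intro: less_imp_le\<close>)
  obtain l where l: "((\<lambda>x. - W x) \<longlongrightarrow> l) at_top"
    by (rule decreasing_converges_at_top[of 1 "\<lambda>x. - W x" "- B"]) (use mono B in auto)
  have lim: "(W \<longlongrightarrow> - l) at_top" using tendsto_minus[OF l] by simp
  have "\<forall>\<^sub>F x in at_top. W 1 \<le> W x"
    using eventually_ge_at_top[of 1] by eventually_elim (rule mono, auto)
  then have "W 1 \<le> - l" by (intro tendsto_lowerbound[OF lim]) auto
  then have "0 < - l" using W_pos[of 1] by simp
  then show thesis using that lim by blast
next
  fix z assume z: "0 < z" and neg: "\<And>x. z < x \<Longrightarrow> P x < 0"
  have mono: "W y \<le> W x" if "z \<le> x" "x \<le> y" for x y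
    by (rule W_decreasing) (use that z neg in \<open>auto intro: less_imp_le\<close>)
  obtain l where l: "0 \<le> l" "(W \<longlongrightarrow> l) at_top"
    by (rule decreasing_converges_at_top[of z W 0]) (use mono W_pos z in \<open>auto intro: less_imp_le\<close>)
  have "l \<noteq> 0" using decreasing_limit_nonzero[OF z neg] l by blast
  then have "0 < l" using l(1) by simp
  then show thesis using that l(2) by blast
qed

end

end

section \<open>From profiles to the integral equation and back\<close>

text \<open>The dimension is \<open>N = k + 1\<close>.\<close>

locale profile_parameters =
  fixes k :: nat and m p \<sigma> :: real
  assumes m_gt: "m_crit (Suc k) < m" and m1: "m < 1" and p1: "1 < p"
    and sigma_gt: "sigma_crit m p < \<sigma>"
begin

lemma m_pos: "0 < m"
  using m_gt by (auto simp: m_crit_def intro: le_less_trans[rotated])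

lemma dim_m: "(real k + 1) * (1 - m) < 2"
proof -
  have "(real (Suc k) - 2) / real (Suc k) \<le> m_crit (Suc k)"
    unfolding m_crit_def by (rule divide_right_mono) auto
  then have "(real (Suc k) - 2) / real (Suc k) < m" using m_gt by linarith
  then show ?thesis by (simp add: divide_less_eq algebra_simps)
qed

lemma sigma_m: "2 * (p - 1) < \<sigma> * (1 - m)"
  using sigma_gt m1 by (simp add: sigma_crit_def divide_less_eq)

lemma shooting: "shooting k (1 / m) (p / m) \<sigma> (beta_exp m p \<sigma>)"
proof
  show "1 < 1 / m" "1 / m < p / m" using m_pos m1 p1 by (auto simp: divide_strict_right_mono)
  show "0 < beta_exp m p \<sigma>"
    using m1 p1 sigma_gt by (auto simp: beta_exp_def intro!: divide_pos_pos mult_pos_pos)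
  show "2 * (p / m - 1 / m) < \<sigma> * (1 / m - 1)"
  proof -
    have "2 * (p / m - 1 / m) = 2 * (p - 1) / m" by (simp add: diff_divide_distrib right_diff_distrib)
    also have "\<dots> < \<sigma> * (1 - m) / m" by (rule divide_strict_right_mono[OF sigma_m m_pos])
    also have "\<dots> = \<sigma> * (1 / m - 1)" using m_pos by (simp add: field_simps)
    finally show ?thesis .
  qed
  show "(real k + 1) * (1 / m - 1) < 2 * (1 / m)"
  proof -
    have "(real k + 1) * (1 / m - 1) = (real k + 1) * (1 - m) / m" using m_pos by (simp add: field_simps)
    also have "\<dots> < 2 / m" by (rule divide_strict_right_mono[OF dim_m m_pos])
    finally show ?thesis by simp
  qed
qed

sublocale shooting k "1 / m" "p / m" \<sigma> "beta_exp m p \<sigma>"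
  by (rule shooting)

lemma kap_param: "kap / m = (\<sigma> + 2) / (p - m)"
  using m_pos p1 m1 by (simp add: kap_def field_simps)

lemma alp_param: "alp = alpha_exp m p \<sigma>"
proof -
  have "p - m \<noteq> 0" using p1 m1 by simp
  moreover have "alp = beta_exp m p \<sigma> * (kap / m)" by (simp add: alp_def)
  ultimately show ?thesis unfolding kap_param by (simp add: beta_exp_def alpha_exp_def)
qed

lemma eps_param: "eps = alpha_exp m p \<sigma> - (real k + 1) * beta_exp m p \<sigma>"
  by (simp add: eps_def alp_param)

lemma positive_solution_deriv:
  assumes ps: "positive_solution (Suc k) m p \<sigma> A f R" and x: "0 < x" "ereal x < R"
  shows "0 < f x" "(f has_real_derivative deriv f x) (at x)"
    "((\<lambda>x. f x powr m) has_real_derivative deriv (\<lambda>x. f x powr m) x) (at x)"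
    "((\<lambda>x. x ^ k * deriv (\<lambda>x. f x powr m) x + beta_exp m p \<sigma> * x ^ Suc k * f x) has_real_derivative
       x ^ k * (x powr \<sigma> * f x powr p - eps * f x)) (at x)"
proof -
  let ?v = "\<lambda>x. f x powr m"
  show fx: "0 < f x" using ps x by (simp add: positive_solution_def)
  have ode: "satisfies_profile_ode (Suc k) m p \<sigma> f x" using ps x by (simp add: positive_solution_def)
  then show df: "(f has_real_derivative deriv f x) (at x)"
    by (simp add: satisfies_profile_ode_def DERIV_deriv_iff_real_differentiable)
  show "(?v has_real_derivative deriv ?v x) (at x)"
    using DERIV_fun_powr[OF df fx, of m] by (metis DERIV_imp_deriv)
  have d2: "(deriv ?v has_real_derivative deriv (deriv ?v) x) (at x)"
    using ode by (simp add: satisfies_profile_ode_def DERIV_deriv_iff_real_differentiable)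
  have eq: "deriv (deriv ?v) x = x powr \<sigma> * f x powr p - real k / x * deriv ?v x
      - alpha_exp m p \<sigma> * f x - beta_exp m p \<sigma> * x * deriv f x"
    using ode by (simp add: satisfies_profile_ode_def)
  have pk: "real k * x ^ (k - 1) = real k / x * x ^ k"
    using x by (cases k) auto
  have "((\<lambda>x. x ^ k * deriv ?v x + beta_exp m p \<sigma> * x ^ Suc k * f x) has_real_derivative
      (x ^ k * deriv (deriv ?v) x + real k * x ^ (k - 1) * deriv ?v x)
      + ((beta_exp m p \<sigma> * x ^ Suc k) * deriv f x + beta_exp m p \<sigma> * ((real k + 1) * x ^ k) * f x)) (at x)"
    by (intro DERIV_add DERIV_mult' DERIV_cmult d2 df) (use DERIV_pow[of k x UNIV] DERIV_pow[of "Suc k" x UNIV] in \<open>auto simp: add.commute\<close>)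
  also have "(x ^ k * deriv (deriv ?v) x + real k * x ^ (k - 1) * deriv ?v x)
      + ((beta_exp m p \<sigma> * x ^ Suc k) * deriv f x + beta_exp m p \<sigma> * ((real k + 1) * x ^ k) * f x)
      = x ^ k * (x powr \<sigma> * f x powr p - eps * f x)"
    unfolding pk eq eps_param using x by (simp add: algebra_simps)
  finally show "((\<lambda>x. x ^ k * deriv ?v x + beta_exp m p \<sigma> * x ^ Suc k * f x) has_real_derivative
       x ^ k * (x powr \<sigma> * f x powr p - eps * f x)) (at x)" .
qed

text \<open>The profile equation says that \<open>Z = x^k (v' + \<beta> x v^n)\<close> and the flux have the same derivative, so they differ by
  a constant \<open>C\<close>. The condition \<open>f'(0) = 0\<close> concerns difference quotients only; by the mean value theorem these are
  values of \<open>v'\<close> at points tending to 0, and there \<open>Z\<close> tends to 0. Hence \<open>C = 0\<close>.\<close>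

lemma positive_solution_imp_sol:
  assumes ps: "positive_solution (Suc k) m p \<sigma> A f R" and Y: "0 \<le> Y" "ereal Y < R"
  shows "sol (\<lambda>x. f x powr m) Y"
proof -
  obtain X where X: "Y < X" "ereal X < R" using ereal_dense2[OF Y(2)] by auto
  have X0: "0 < X" using X Y by simp
  have XR: "ereal x < R" if "x \<le> X" for x using X(2) that by (metis ereal_less_eq(3) order_le_less_trans)
  define v where "v = (\<lambda>x. f x powr m)"
  have fpos: "0 < f x" if "0 \<le> x" "x \<le> X" for x
    using ps XR[OF that(2)] that by (simp add: positive_solution_def)
  have vpos: "0 < v x" if "0 \<le> x" "x \<le> X" for x using fpos[OF that] by (simp add: v_def)
  have vn: "v x powr (1 / m) = f x" "v x powr (p / m) = f x powr p" if "0 \<le> x" "x \<le> X" for x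
    using fpos[OF that] m_pos by (auto simp: v_def powr_powr)
  note D = positive_solution_deriv[OF ps, folded v_def]
  have v0: "(v has_real_derivative 0) (at 0 within {0..})"
  proof -
    have f0: "(f has_real_derivative 0) (at 0 within {0..})" using ps by (simp add: positive_solution_def)
    have "((\<lambda>y. y powr m) has_real_derivative m * f 0 powr (m - 1)) (at (f 0))"
      using has_real_derivative_powr fpos[of 0] X0 by simp
    from DERIV_chain2[OF this f0] show ?thesis by (simp add: v_def)
  qed
  have v_cont: "continuous_on {0..X} v"
  proof (rule continuous_on_eq_continuous_within[THEN iffD2], rule ballI)
    fix x assume x: "x \<in> {0..X}"
    show "continuous (at x within {0..X}) v"
    proof (cases "x = 0")
      case True
      have "continuous (at 0 within {0..}) v" by (rule DERIV_continuous[OF v0])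
      then show ?thesis unfolding True by (rule continuous_within_subset) auto
    next
      case False
      then have "isCont v x" using D(3)[of x] x XR[of x] by (intro DERIV_isCont) auto
      then show ?thesis by (rule continuous_at_imp_continuous_at_within)
    qed
  qed
  have v_nonneg: "0 \<le> v x" if "0 \<le> x" "x \<le> X" for x using vpos[OF that] by simp
  define Z where "Z = (\<lambda>x. x ^ k * deriv v x + beta_exp m p \<sigma> * x ^ Suc k * f x)"
  have diff_const: "Z x - flux v x = Z y - flux v y" if "x \<in> {0<..<X}" "y \<in> {0<..<X}" for x y
  proof (rule DERIV_isconst3[OF X0 that, of "\<lambda>x. Z x - flux v x"])
    fix t assume t: "t \<in> {0<..<X}"
    have "(Z has_real_derivative t ^ k * (t powr \<sigma> * f t powr p - eps * f t)) (at t)"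
      unfolding Z_def by (rule D(4)) (use t XR in auto)
    moreover have "(flux v has_real_derivative t ^ k * (t powr \<sigma> * f t powr p - eps * f t)) (at t)"
      using flux_deriv[OF v_cont v_nonneg, of t] t vn[of t] by simp
    ultimately show "((\<lambda>x. Z x - flux v x) has_real_derivative 0) (at t)"
      using DERIV_diff by fastforce
  qed
  have Z_flux: "Z x = flux v x" if x: "x \<in> {0<..<X}" for x
  proof (rule ccontr)
    define C where "C = Z x - flux v x"
    assume "Z x \<noteq> flux v x"
    then have C: "0 < \<bar>C\<bar> / 2" by (simp add: C_def)
    have "continuous_on {0..X} (\<lambda>y. beta_exp m p \<sigma> * y ^ Suc k * v y powr (1 / m) - flux v y)"
      using m_pos v_nonneg
      by (intro continuous_on_diff continuous_on_mult continuous_on_const continuous_on_power continuous_on_id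
          continuous_on_powr'[OF v_cont] flux_continuous[OF v_cont v_nonneg]) auto
    then have "\<exists>d>0. \<forall>y\<in>{0..X}. dist y 0 < d \<longrightarrow>
        dist (beta_exp m p \<sigma> * y ^ Suc k * v y powr (1 / m) - flux v y)
         (beta_exp m p \<sigma> * 0 ^ Suc k * v 0 powr (1 / m) - flux v 0) < \<bar>C\<bar> / 2"
      using C X0 unfolding continuous_on_iff by (metis atLeastAtMost_iff less_imp_le order_refl)
    then obtain d1 where d1: "0 < d1" "\<And>y. 0 \<le> y \<Longrightarrow> y \<le> X \<Longrightarrow> y < d1 \<Longrightarrow>
        \<bar>beta_exp m p \<sigma> * y ^ Suc k * v y powr (1 / m) - flux v y\<bar> < \<bar>C\<bar> / 2"
      by (auto simp: dist_real_def)
    have "((\<lambda>y. (v y - v 0) / (y - 0)) \<longlongrightarrow> 0) (at 0 within {0..})"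
      using v0 by (simp add: has_field_derivative_iff)
    from tendstoD[OF this C] obtain d2 where d2: "0 < d2"
      "\<And>y. 0 \<le> y \<Longrightarrow> y \<noteq> 0 \<Longrightarrow> y < d2 \<Longrightarrow> \<bar>(v y - v 0) / y\<bar> < \<bar>C\<bar> / 2"
      by (auto simp: eventually_at dist_real_def)
    define t where "t = min (min d1 d2) (min 1 X) / 2"
    have t: "0 < t" "t < d1" "t < d2" "t < 1" "t < X" using d1 d2 X0 by (auto simp: t_def)
    have "\<exists>l y. 0 < y \<and> y < t \<and> (v has_real_derivative l) (at y) \<and> v t - v 0 = (t - 0) * l"
    proof (rule MVT[OF t(1)])
      show "continuous_on {0..t} v" using continuous_on_subset[OF v_cont] t by auto
      fix y assume "0 < y" "y < t"
      then show "v differentiable (at y)"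
        using D(3)[of y] XR[of y] t by (auto simp: real_differentiable_def)
    qed
    then obtain l y where y: "0 < y" "y < t" "(v has_real_derivative l) (at y)" "v t - v 0 = (t - 0) * l"
      by blast
    have "deriv v y = l" using y(3) by (rule DERIV_imp_deriv)
    then have "deriv v y = (v t - v 0) / t" using y(4) t by simp
    then have dy: "\<bar>deriv v y\<bar> < \<bar>C\<bar> / 2" using d2(2)[of t] t by simp
    have "C = Z y - flux v y" unfolding C_def by (rule diff_const) (use x y t in auto)
    also have "\<dots> = y ^ k * deriv v y + (beta_exp m p \<sigma> * y ^ Suc k * v y powr (1 / m) - flux v y)"
      using vn(1)[of y] y t by (simp add: Z_def)
    finally have "\<bar>C\<bar> \<le> \<bar>y ^ k * deriv v y\<bar>
        + \<bar>beta_exp m p \<sigma> * y ^ Suc k * v y powr (1 / m) - flux v y\<bar>" by simp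
    moreover have "\<bar>y ^ k * deriv v y\<bar> \<le> 1 * \<bar>deriv v y\<bar>"
      unfolding abs_mult using y t by (intro mult_right_mono) (auto simp: power_le_one)
    moreover have "\<bar>beta_exp m p \<sigma> * y ^ Suc k * v y powr (1 / m) - flux v y\<bar> < \<bar>C\<bar> / 2"
      by (rule d1(2)) (use y t in auto)
    ultimately show False using dy by linarith
  qed
  have dv: "(v has_real_derivative vel v x) (at x)" if x: "0 < x" "x < X" for x
  proof -
    have "x ^ k * deriv v x + beta_exp m p \<sigma> * x ^ Suc k * f x = flux v x"
      using Z_flux[of x] x by (simp add: Z_def)
    then have "deriv v x = vel v x"
      using x vn(1)[of x] by (simp add: vel_def field_simps)
    then show ?thesis using D(3)[of x] x XR[of x] by simp
  qed
  show "sol (\<lambda>x. f x powr m) Y"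
    unfolding v_def[symmetric] sol_def
  proof (intro conjI ballI)
    show "continuous_on {0..Y} v" using continuous_on_subset[OF v_cont] X by auto
    fix x assume x: "x \<in> {0..Y}"
    then show "0 < v x" using vpos X by auto
    have "(vel v has_integral v x - v 0) {0..x}"
    proof (rule fundamental_theorem_of_calculus_interior)
      show "continuous_on {0..x} v" using continuous_on_subset[OF v_cont] x X by auto
      fix y assume "y \<in> {0<..<x}"
      then show "(v has_vector_derivative vel v y) (at y)"
        using dv[of y] x X by (simp add: has_real_derivative_iff_has_vector_derivative)
    qed (use x in auto)
    then show "integral {0..x} (vel v) = v x - v 0" by (rule integral_unique)
  qed
qed

lemma sol_imp_positive_solution:
  assumes sol: "sol w X" and X: "0 < X"
  shows "positive_solution (Suc k) m p \<sigma> (w 0 powr (1 / m)) (\<lambda>x. w x powr (1 / m)) (ereal X)"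
  unfolding positive_solution_def
proof (intro conjI allI impI)
  let ?f = "\<lambda>x. w x powr (1 / m)"
  have wpos: "0 < w x" if "0 \<le> x" "x \<le> X" for x using sol_D(2)[OF sol that] .
  show "0 < ereal X" using X by simp
  show "?f 0 = w 0 powr (1 / m)" ..
  show "(?f has_real_derivative 0) (at 0 within {0..})"
  proof -
    have "(w has_real_derivative 0) (at 0 within {0..X})" using sol_deriv_within[OF sol, of 0] X by simp
    then have w0: "(w has_real_derivative 0) (at 0 within {0..})"
      using X by (simp add: at_within_Icc_at_right at_within_Ici_at_right)
    have "((\<lambda>y. y powr (1 / m)) has_real_derivative 1 / m * w 0 powr (1 / m - 1)) (at (w 0))"
      by (rule has_real_derivative_powr) (use wpos[of 0] X in simp)
    from DERIV_chain2[OF this w0] show ?thesis by simp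
  qed
  fix x
  show "0 < ?f x" if "0 \<le> x \<and> ereal x < ereal X" using wpos[of x] that by simp
  show "satisfies_profile_ode (Suc k) m p \<sigma> ?f x" if xX: "0 < x \<and> ereal x < ereal X"
  proof -
    have x: "0 < x" "x < X" using xX by auto
    have fm: "?f y powr m = w y" if "0 < y" "y < X" for y
      using wpos[of y] that m_pos by (simp add: powr_powr)
    have dfm: "deriv (\<lambda>x. ?f x powr m) y = vel w y" if "0 < y" "y < X" for y
    proof (rule DERIV_imp_deriv)
      show "((\<lambda>x. ?f x powr m) has_real_derivative vel w y) (at y)"
        by (rule has_field_derivative_transform_within_open[OF sol_deriv[OF sol that], of "{0<..<X}"])
           (use that fm in auto)
    qed
    let ?d2 = "x powr \<sigma> * w x powr (p / m) - alp * w x powr (1 / m)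
           - (real k / x + beta_exp m p \<sigma> * (1 / m) * x * w x powr (1 / m - 1)) * vel w x"
    have d2: "(deriv (\<lambda>x. ?f x powr m) has_real_derivative ?d2) (at x)"
      by (rule has_field_derivative_transform_within_open[OF sol_vel_deriv[OF sol x], of "{0<..<X}"])
         (use x dfm in auto)
    have df: "(?f has_real_derivative 1 / m * w x powr (1 / m - 1) * vel w x) (at x)"
      using DERIV_fun_powr[OF sol_deriv[OF sol x], of "1 / m"] wpos[of x] x by simp
    have fp: "?f x powr p = w x powr (p / m)" by (simp add: powr_powr)
    show ?thesis
      unfolding satisfies_profile_ode_def DERIV_imp_deriv[OF d2] DERIV_imp_deriv[OF df] dfm[OF x] fp
      using d2 df
      by (auto simp: real_differentiable_def alp_param algebra_simps)
  qed
qed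

end

locale profile_family = profile_parameters +
  fixes f :: "real \<Rightarrow> real \<Rightarrow> real" and \<xi>max :: "real \<Rightarrow> ereal"
  assumes profile: "\<And>A. A > 0 \<Longrightarrow> is_profile (Suc k) m p \<sigma> A (f A) (\<xi>max A)"
begin

text \<open>The family is reparametrised by \<open>a = A^m\<close>, the initial value of \<open>f^m\<close>.\<close>

definition v :: "real \<Rightarrow> real \<Rightarrow> real" where
  "v a x = f (a powr (1 / m)) x powr m"

definition R :: "real \<Rightarrow> ereal" where
  "R a = \<xi>max (a powr (1 / m))"

lemma family_solution: "0 < a \<Longrightarrow> positive_solution (Suc k) m p \<sigma> (a powr (1 / m)) (f (a powr (1 / m))) (R a)"
  using profile[of "a powr (1 / m)"] by (simp add: is_profile_def R_def)

lemma v_root: "0 < a \<Longrightarrow> 0 \<le> x \<Longrightarrow> ereal x < R a \<Longrightarrow> v a x powr (1 / m) = f (a powr (1 / m)) x"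
  using family_solution[of a] m_pos by (simp add: v_def powr_powr positive_solution_def abs_of_pos)

lemma v_initial: "0 < a \<Longrightarrow> v a 0 = a"
  using family_solution[of a] m_pos by (simp add: v_def powr_powr positive_solution_def)

lemma v_is_sol: "0 < a \<Longrightarrow> 0 \<le> X \<Longrightarrow> ereal X < R a \<Longrightarrow> sol (v a) X"
  using positive_solution_imp_sol[OF family_solution] by (simp add: v_def[abs_def])

sublocale shooting_family k "1 / m" "p / m" \<sigma> "beta_exp m p \<sigma>" v R
proof
  fix a :: real assume a: "0 < a"
  show Rpos: "0 < R a" using family_solution[OF a] by (simp add: positive_solution_def)
  show "v a 0 = a" by (rule v_initial[OF a])
  show "sol (v a) X" if "0 \<le> X" "ereal X < R a" for X by (rule v_is_sol[OF a that])
  fix w X assume w: "sol w X" "w 0 = a"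
  show "ereal X \<le> R a"
  proof (rule ccontr)
    assume "\<not> ereal X \<le> R a"
    then have RX: "R a < ereal X" by simp
    then have X: "0 < X" using Rpos by (metis ereal_less(2) less_trans)
    let ?g = "\<lambda>x. w x powr (1 / m)"
    have "positive_solution (Suc k) m p \<sigma> (a powr (1 / m)) ?g (ereal X)"
      using sol_imp_positive_solution[OF w(1) X] w(2) by simp
    moreover have "?g x = f (a powr (1 / m)) x" if x: "0 \<le> x" "ereal x < R a" for x
    proof -
      have "ereal x < ereal X" using x RX by (rule_tac less_trans)
      then have "v a x = w x"
        using v_is_sol[OF a x] sol_mono[OF w(1), of x] v_initial[OF a] w(2) x
        by (intro sol_unique[of "v a" x w x]) auto
      then show ?thesis using v_root[OF a x] by simp
    qed
    ultimately show False
      using profile[of "a powr (1 / m)"] a RX unfolding is_profile_def R_def by fastforce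
  qed
qed

end

section \<open>The critical profile and the profiles below it\<close>

theorem theorem1p2:
  fixes N :: nat and m p \<sigma> :: real
    and f :: "real \<Rightarrow> real \<Rightarrow> real" and \<xi>max :: "real \<Rightarrow> ereal"
  assumes "N \<ge> 1"
    and "m_crit N < m" and "m < 1" and "p > 1" and "\<sigma> > sigma_crit m p"
    and profile: "\<And>A. A > 0 \<Longrightarrow> is_profile N m p \<sigma> A (f A) (\<xi>max A)"
  shows "\<exists>A_up > 0.
     \<xi>max A_up = \<infinity> \<and>
     (\<exists>L > 0. ((\<lambda>\<xi>. \<xi> powr ((\<sigma> + 2) / (p - m)) * f A_up \<xi>) \<longlongrightarrow> L) at_top) \<and>
     (\<exists>A_low > 0. A_low \<le> A_up \<and>
       (\<forall>A. 0 < A \<and> A < A_low \<longrightarrow>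
         (\<exists>\<xi>0. 0 < \<xi>0 \<and> ereal \<xi>0 < \<xi>max A \<and>
            0 < f A \<xi>0 \<and> f A \<xi>0 < A \<and>
            (\<forall>\<xi>. 0 < \<xi> \<and> ereal \<xi> < \<xi>max A \<and> \<xi> \<noteq> \<xi>0 \<longrightarrow> f A \<xi>0 < f A \<xi>) \<and>
            strict_mono_on {\<xi>. \<xi>0 < \<xi> \<and> ereal \<xi> < \<xi>max A} (f A))))"
proof -
  obtain k where N: "N = Suc k" using assms(1) by (cases N) auto
  interpret profile_family k m p \<sigma> f \<xi>max
    by unfold_locales (use assms in \<open>simp_all add: N\<close>)
  obtain a where a: "0 < a" "\<not> turns a" and below: "\<And>b. 0 < b \<Longrightarrow> b < a \<Longrightarrow> turns b"
    using critical_value by blast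
  have Ra: "R a = \<infinity>" by (rule critical_global[OF a below])
  define A' where "A' = a powr (1 / m)"
  have A': "0 < A'" using a by (simp add: A'_def)
  have infinite: "\<xi>max A' = \<infinity>" using Ra by (simp add: R_def A'_def)
  have decay: "\<exists>L > 0. ((\<lambda>\<xi>. \<xi> powr ((\<sigma> + 2) / (p - m)) * f A' \<xi>) \<longlongrightarrow> L) at_top"
  proof -
    obtain l where l: "0 < l" "(W a \<longlongrightarrow> l) at_top" using W_converges[OF a(1) Ra a(2)] by blast
    have "((\<lambda>\<xi>. W a \<xi> powr (1 / m)) \<longlongrightarrow> l powr (1 / m)) at_top"
      using l by (intro tendsto_powr tendsto_const) auto
    moreover have "\<forall>\<^sub>F \<xi> in at_top. W a \<xi> powr (1 / m) = \<xi> powr ((\<sigma> + 2) / (p - m)) * f A' \<xi>"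
      using eventually_gt_at_top[of 0]
    proof eventually_elim
      case (elim \<xi>)
      then have "W a \<xi> powr (1 / m) = \<xi> powr (kap / m) * v a \<xi> powr (1 / m)"
        using v_pos[OF a(1), of \<xi>] Ra by (simp add: W_def[OF a(1) Ra a(2)] powr_mult powr_powr)
      then show ?case using v_root[OF a(1), of \<xi>] elim Ra by (simp add: kap_param A'_def)
    qed
    ultimately have "((\<lambda>\<xi>. \<xi> powr ((\<sigma> + 2) / (p - m)) * f A' \<xi>) \<longlongrightarrow> l powr (1 / m)) at_top"
      by (rule Lim_transform_eventually)
    then show ?thesis using l by (intro exI[of _ "l powr (1 / m)"]) simp
  qed
  have shape: "\<exists>\<xi>0. 0 < \<xi>0 \<and> ereal \<xi>0 < \<xi>max A \<and> 0 < f A \<xi>0 \<and> f A \<xi>0 < A \<and>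
            (\<forall>\<xi>. 0 < \<xi> \<and> ereal \<xi> < \<xi>max A \<and> \<xi> \<noteq> \<xi>0 \<longrightarrow> f A \<xi>0 < f A \<xi>) \<and>
            strict_mono_on {\<xi>. \<xi>0 < \<xi> \<and> ereal \<xi> < \<xi>max A} (f A)" if A: "0 < A" "A < A'" for A
  proof -
    define b where "b = A powr m"
    have b: "0 < b" using A by (simp add: b_def)
    have bA: "b powr (1 / m) = A" using A m_pos by (simp add: b_def powr_powr)
    have "b < a"
    proof -
      have "b < A' powr m" unfolding b_def using A m_pos by (intro powr_less_mono2) auto
      also have "A' powr m = a" using a m_pos by (simp add: A'_def powr_powr)
      finally show ?thesis .
    qed
    obtain x0 where x0: "0 < x0" "ereal x0 < R b"
      "\<And>s t. 0 \<le> s \<Longrightarrow> s < t \<Longrightarrow> t \<le> x0 \<Longrightarrow> v b t < v b s"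
      "\<And>s t. x0 \<le> s \<Longrightarrow> s < t \<Longrightarrow> ereal t < R b \<Longrightarrow> v b s < v b t"
      "\<And>x. 0 \<le> x \<Longrightarrow> ereal x < R b \<Longrightarrow> x \<noteq> x0 \<Longrightarrow> v b x0 < v b x"
      using turning_min[OF b below[OF b \<open>b < a\<close>]] by blast
    have RA: "R b = \<xi>max A" by (simp add: R_def bA)
    have less: "f A s < f A t" if "v b s < v b t" "0 \<le> s" "ereal s < R b" "0 \<le> t" "ereal t < R b" for s t
    proof -
      have "v b s powr (1 / m) < v b t powr (1 / m)"
        using that(1) v_pos[OF b that(2,3)] m_pos by (intro powr_less_mono2) auto
      then show ?thesis using v_root[OF b that(2,3)] v_root[OF b that(4,5)] by (simp add: bA)
    qed
    have R0: "ereal 0 < R b" using R_pos[OF b] by (simp add: zero_ereal_def)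
    have f0: "f A 0 = A" using family_solution[OF b] by (simp add: bA positive_solution_def)
    have "0 < f A x0" using family_solution[OF b] x0 by (simp add: bA positive_solution_def)
    moreover have "f A x0 < A" using less[OF x0(5)[of 0]] x0 R0 f0 by simp
    moreover have "f A x0 < f A \<xi>" if "0 < \<xi>" "ereal \<xi> < \<xi>max A" "\<xi> \<noteq> x0" for \<xi>
      using less[OF x0(5)[of \<xi>]] that x0 RA by simp
    moreover have "strict_mono_on {\<xi>. x0 < \<xi> \<and> ereal \<xi> < \<xi>max A} (f A)"
    proof (rule strict_mono_onI)
      fix s t assume "s \<in> {\<xi>. x0 < \<xi> \<and> ereal \<xi> < \<xi>max A}" "t \<in> {\<xi>. x0 < \<xi> \<and> ereal \<xi> < \<xi>max A}" "s < t"
      then show "f A s < f A t" using x0(1) RA by (intro less x0(4)) auto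
    qed
    ultimately show ?thesis using x0(1,2) RA by (intro exI[of _ x0]) auto
  qed
  show ?thesis
    by (rule exI[of _ A'], intro conjI A' infinite decay, rule exI[of _ A'],
        intro conjI A' order_refl allI impI, elim conjE, rule shape)
qed

end
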